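(* Let $\mu\in C_c^\infty(\mathbb C)$ (complex-valued) with $\|\mu\|_\infty = k<1$. Then there exists an orientation-preserving homeomorphism $\Phi\colon\mathbb C\to\mathbb C$ with $\Phi\in C^1(\mathbb C)$ that solves the Beltrami equation $$\partial_{\bar z}\Phi=\mu\,\partial_z\Phi \quad\text{on } \mathbb C.$$
   Context: $\partial_z = \frac12(\partial_x - i\partial_y)$ and $\partial_{\bar z}=\frac12(\partial_x+i\partial_y)$, where $z=x+iy$. $C^1(\mathbb C)$ denotes complex-valued functions that are continuously differentiable in the real sense. *)

theory Defs
  imports "HOL-Complex_Analysis.Complex_Analysis"
begin

definition partial_x :: "(complex \<Rightarrow> complex) \<Rightarrow> complex \<Rightarrow> complex" where
  "partial_x f z = vector_derivative (\<lambda>t. f (z + of_real t)) (at 0)"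

definition partial_y :: "(complex \<Rightarrow> complex) \<Rightarrow> complex \<Rightarrow> complex" where
  "partial_y f z = vector_derivative (\<lambda>t. f (z + \<i> * of_real t)) (at 0)"

definition partial_z :: "(complex \<Rightarrow> complex) \<Rightarrow> complex \<Rightarrow> complex" where
  "partial_z f z = 1/2 * (partial_x f z - \<i> * partial_y f z)"

definition partial_zbar :: "(complex \<Rightarrow> complex) \<Rightarrow> complex \<Rightarrow> complex" where
  "partial_zbar f z = 1/2 * (partial_x f z + \<i> * partial_y f z)"

(* Real differentiability of class C^k on the whole plane. Here "differentiable" is the
   Frechet notion over the reals, so it does not mean complex differentiability. *)
primrec C_k :: "nat \<Rightarrow> (complex \<Rightarrow> complex) \<Rightarrow> bool" where
  "C_k 0 f \<longleftrightarrow> continuous_on UNIV f"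
| "C_k (Suc k) f \<longleftrightarrow>
     (\<forall>z. f differentiable (at z)) \<and> C_k k (partial_x f) \<and> C_k k (partial_y f)"

definition C_infinity :: "(complex \<Rightarrow> complex) \<Rightarrow> bool" where
  "C_infinity f \<longleftrightarrow> (\<forall>k. C_k k f)"

definition C_c_infinity :: "(complex \<Rightarrow> complex) \<Rightarrow> bool" where
  "C_c_infinity f \<longleftrightarrow> C_infinity f \<and> compact (closure {z. f z \<noteq> 0})"

(* The supremum is taken in the reals, so this is meaningful only for bounded f;
   for continuous f it agrees with the essential supremum. *)
definition sup_norm :: "(complex \<Rightarrow> complex) \<Rightarrow> real" where
  "sup_norm f = (SUP z. cmod (f z))"

(* Topological notion, which refers to no derivative: every positively oriented circle is
   mapped to a Jordan curve winding once, in the positive direction, around the image of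
   the centre. *)
definition orientation_preserving_homeomorphism :: "(complex \<Rightarrow> complex) \<Rightarrow> bool" where
  "orientation_preserving_homeomorphism f \<longleftrightarrow>
     (\<exists>g. homeomorphism UNIV UNIV f g) \<and>
     (\<forall>z r. r > 0 \<longrightarrow> winding_number (f \<circ> circlepath z r) (f z) = 1)"

end

theory Submission
  imports Defs
begin

text \<open>Look for the logarithm of \<open>\<partial>\<^sub>z \<Phi>\<close> instead of \<open>\<Phi>\<close>. If \<open>\<partial>\<^sub>z \<Phi> = exp \<sigma>\<close>, then the Beltrami equation says
\<open>d\<Phi> = exp \<sigma> dz + \<mu> exp \<sigma> dz'\<close> (with \<open>z'\<close> the conjugate of \<open>z\<close>), and this form is closed exactly when
\<open>\<partial>\<^sub>z\<^sub>' \<sigma> = \<mu> \<partial>\<^sub>z \<sigma> + \<partial>\<^sub>z \<mu>\<close>. A \<open>C\<^sup>1\<close> solution \<open>\<sigma>\<close> of this linear equation with \<open>\<sigma> \<longlongrightarrow> 0\<close> at infinity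
therefore yields, by integrating a closed form over the plane (\<open>closed_form_has_primitive\<close>), a solution
\<open>\<Phi>\<close> whose Jacobian \<open>(1 - |\<mu>|\<^sup>2) |exp \<sigma>|\<^sup>2\<close> vanishes nowhere: the ansatz builds local invertibility into
the construction.

The linear equation is solved with the Cauchy transform \<open>C\<close>, the inverse of \<open>\<partial>\<^sub>z\<^sub>'\<close> on test functions
(\<open>partial_zbar_cauchy_transform\<close>), and the Beurling transform \<open>S = \<partial>\<^sub>z C\<close>: put \<open>\<sigma> = C g\<close> with
\<open>g = \<mu> S g + \<partial>\<^sub>z \<mu>\<close>, and expand \<open>g\<close> in a Neumann series. The operator \<open>S\<close> does not increase \<open>L\<^sup>2\<close> norms
(\<open>energy_beurling_le\<close>), because \<open>|f\<^sub>z|\<^sup>2 - |f\<^sub>z\<^sub>'|\<^sup>2\<close> is the Jacobian of \<open>f\<close>, a divergence. So the terms of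
the series decay geometrically in \<open>L\<^sup>2\<close> as \<open>|\<mu>| \<le> k < 1\<close>. Since \<open>S\<close> commutes with derivatives, a
differentiated term obeys the same recursion up to an error that involves only derivatives of lower
order, so the derivatives \<open>\<partial>\<^sub>x\<close>, \<open>\<partial>\<^sub>y\<close> and \<open>\<partial>\<^sub>y \<partial>\<^sub>x\<close> of the terms decay geometrically as well
(\<open>neumann_energy_geometric\<close>). An elementary Sobolev inequality (\<open>sobolev_plane\<close>) bounds the supremum of
a function by its \<open>L\<^sup>2\<close> norm and those of precisely these derivatives; hence \<open>g\<close> and \<open>S g\<close> are uniformly
convergent sums of continuous functions and \<open>\<sigma>\<close> is of class \<open>C\<^sup>1\<close>. This is where
derivatives of \<open>\<mu>\<close> enter.

It remains to see that a \<open>C\<^sup>1\<close> map with positive Jacobian whose derivative tends to the identity at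
infinity is a homeomorphism. Such a map stays close enough to the identity to be proper, so its image
is open and closed, and so is the set of points with exactly one preimage. A point far out on the
positive real axis has all its preimages in a half plane on which the map is a small perturbation of
the identity, hence it has only one (\<open>plane_map_inj\<close>). Injectivity lets a circle be blown up without
meeting the image of its centre, and for a large circle the winding number can be compared with that
of the circle itself (\<open>plane_map_orientation_preserving_homeomorphism\<close>).\<close>

section \<open>Partial derivatives and smooth functions\<close>

lemma partials_of_has_derivative:
  assumes "(f has_derivative D) (at z)"
  shows "partial_x f z = D 1" "partial_y f z = D \<i>"
proof -
  interpret D: bounded_linear D using assms by (rule has_derivative_bounded_linear)
  have *: "((\<lambda>t. f (z + c * of_real t)) has_vector_derivative D c) (at 0)" for c
  proof -
    have "((\<lambda>t::real. z + c * of_real t) has_derivative (\<lambda>t. c * of_real t)) (at 0)"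
      by (auto intro!: derivative_eq_intros)
    from has_derivative_compose[OF this, of f D] assms
    have "((\<lambda>t. f (z + c * of_real t)) has_derivative (\<lambda>t. D (c * of_real t))) (at 0)" by simp
    moreover have "(\<lambda>t. D (c * of_real t)) = (\<lambda>t. t *\<^sub>R D c)"
    proof
      fix t :: real
      have "c * of_real t = t *\<^sub>R c" by (simp add: scaleR_conv_of_real)
      then show "D (c * of_real t) = t *\<^sub>R D c" by (simp only: D.scaleR)
    qed
    ultimately show ?thesis by (simp add: has_vector_derivative_def)
  qed
  show "partial_x f z = D 1" unfolding partial_x_def
    using *[of 1] by (simp add: vector_derivative_at)
  show "partial_y f z = D \<i>" unfolding partial_y_def
    using *[of \<i>] by (simp add: vector_derivative_at)
qed

lemma has_derivative_partials:
  assumes "f differentiable (at z)"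
  shows "(f has_derivative (\<lambda>v. Re v *\<^sub>R partial_x f z + Im v *\<^sub>R partial_y f z)) (at z)"
proof -
  obtain D where D: "(f has_derivative D) (at z)" using assms unfolding differentiable_def by blast
  interpret D: bounded_linear D using D by (rule has_derivative_bounded_linear)
  have Dv: "D v = Re v *\<^sub>R D 1 + Im v *\<^sub>R D \<i>" for v
  proof -
    have e: "Re v *\<^sub>R 1 + Im v *\<^sub>R \<i> = v" by (simp add: complex_eq_iff)
    have "D v = D (Re v *\<^sub>R 1 + Im v *\<^sub>R \<i>)" by (simp only: e)
    also have "\<dots> = Re v *\<^sub>R D 1 + Im v *\<^sub>R D \<i>" unfolding D.add D.scaleR ..
    finally show ?thesis .
  qed
  have "D = (\<lambda>v. Re v *\<^sub>R partial_x f z + Im v *\<^sub>R partial_y f z)"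
    unfolding partials_of_has_derivative[OF D] by (rule ext) (rule Dv)
  then show ?thesis using D by simp
qed

lemma has_vector_derivative_horizontal:
  assumes "f differentiable (at (Complex x y))"
  shows "((\<lambda>s. f (Complex s y)) has_vector_derivative partial_x f (Complex x y)) (at x within S)"
proof -
  have "((\<lambda>s. Complex s y) has_derivative (\<lambda>s. Complex s 0)) (at x)"
    unfolding Complex_eq by (auto intro!: derivative_eq_intros)
  from has_derivative_compose[OF this has_derivative_partials[OF assms]]
  have "((\<lambda>s. f (Complex s y)) has_derivative (\<lambda>s. s *\<^sub>R partial_x f (Complex x y))) (at x)"
    by simp
  then show ?thesis
    using has_derivative_at_withinI has_vector_derivative_def by blast
qed

lemma has_vector_derivative_vertical:
  assumes "f differentiable (at (Complex x y))"
  shows "((\<lambda>t. f (Complex x t)) has_vector_derivative partial_y f (Complex x y)) (at y within S)"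
proof -
  have "((\<lambda>s. Complex x s) has_derivative (\<lambda>s. Complex 0 s)) (at y)"
    unfolding Complex_eq by (auto intro!: derivative_eq_intros)
  from has_derivative_compose[OF this has_derivative_partials[OF assms]]
  have "((\<lambda>s. f (Complex x s)) has_derivative (\<lambda>s. s *\<^sub>R partial_y f (Complex x y))) (at y)"
    by simp
  then show ?thesis
    using has_derivative_at_withinI has_vector_derivative_def by blast
qed

lemma partial_add:
  assumes "f differentiable (at z)" "g differentiable (at z)"
  shows "partial_x (\<lambda>z. f z + g z) z = partial_x f z + partial_x g z"
    and "partial_y (\<lambda>z. f z + g z) z = partial_y f z + partial_y g z"
  using partials_of_has_derivative[OF has_derivative_add[OF has_derivative_partials[OF assms(1)]
      has_derivative_partials[OF assms(2)]]]
  by auto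

lemma partial_mult:
  assumes "f differentiable (at z)" "g differentiable (at z)"
  shows "partial_x (\<lambda>z. f z * g z) z = f z * partial_x g z + partial_x f z * g z"
    and "partial_y (\<lambda>z. f z * g z) z = f z * partial_y g z + partial_y f z * g z"
  using partials_of_has_derivative[OF has_derivative_mult[OF has_derivative_partials[OF assms(1)]
      has_derivative_partials[OF assms(2)]]]
  by auto

lemma partial_const [simp]: "partial_x (\<lambda>z. c) = (\<lambda>z. 0)" "partial_y (\<lambda>z. c) = (\<lambda>z. 0)"
  using partials_of_has_derivative[OF has_derivative_const] by auto

lemma partial_cmult:
  assumes "f differentiable (at z)"
  shows "partial_x (\<lambda>z. c * f z) z = c * partial_x f z"
    and "partial_y (\<lambda>z. c * f z) z = c * partial_y f z"
  using partial_mult[of "\<lambda>_. c" z f] assms by auto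

lemma C_k_const: "C_k k (\<lambda>z. c)"
  by (induction k arbitrary: c) auto

lemma C_k_continuous:
  assumes "C_k k f"
  shows "continuous_on UNIV f"
proof (cases k)
  case (Suc m)
  then have "f differentiable (at z)" for z using assms by simp
  then show ?thesis
    using continuous_at_imp_continuous_on differentiable_imp_continuous_within by blast
qed (use assms in simp)

text \<open>The classes are nested although \<open>C_k 0\<close> is not defined through derivatives: differentiability
gives continuity at the bottom of the induction.\<close>

lemma C_k_Suc_imp: "C_k (Suc k) f \<Longrightarrow> C_k k f"
proof (induction k arbitrary: f)
  case 0
  then have "continuous_on UNIV f" by (rule C_k_continuous)
  then show ?case by simp
next
  case (Suc k)
  then have "\<forall>z. f differentiable (at z)" "C_k k (partial_x f)" "C_k k (partial_y f)"
    using C_k.simps(2) by blast+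
  then show ?case unfolding C_k.simps(2) by blast
qed

lemma C_k_add: "C_k k f \<Longrightarrow> C_k k g \<Longrightarrow> C_k k (\<lambda>z. f z + g z)"
proof (induction k arbitrary: f g)
  case (Suc k)
  then have d: "f differentiable (at z)" "g differentiable (at z)" for z by auto
  have "partial_x (\<lambda>z. f z + g z) = (\<lambda>z. partial_x f z + partial_x g z)"
    "partial_y (\<lambda>z. f z + g z) = (\<lambda>z. partial_y f z + partial_y g z)"
    using partial_add[OF d] by auto
  with Suc d show ?case by auto
qed (auto intro: continuous_on_add)

lemma C_k_mult: "C_k k f \<Longrightarrow> C_k k g \<Longrightarrow> C_k k (\<lambda>z. f z * g z)"
proof (induction k arbitrary: f g)
  case (Suc k)
  then have d: "f differentiable (at z)" "g differentiable (at z)" for z by auto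
  have "partial_x (\<lambda>z. f z * g z) = (\<lambda>z. f z * partial_x g z + partial_x f z * g z)"
    "partial_y (\<lambda>z. f z * g z) = (\<lambda>z. f z * partial_y g z + partial_y f z * g z)"
    using partial_mult[OF d] by auto
  moreover have "C_k k f" "C_k k g" using Suc.prems C_k_Suc_imp by blast+
  ultimately show ?case using Suc.prems Suc.IH by (auto intro!: C_k_add)
qed (auto intro: continuous_on_mult)

lemma C_infinityD:
  assumes "C_infinity f"
  shows "f differentiable (at z)" "continuous_on A f"
    "C_infinity (partial_x f)" "C_infinity (partial_y f)"
proof -
  have *: "C_k (Suc k) f" for k using assms by (auto simp: C_infinity_def simp del: C_k.simps)
  then show "f differentiable (at z)" "C_infinity (partial_x f)" "C_infinity (partial_y f)"
    by (auto simp: C_infinity_def)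
  show "continuous_on A f"
    using C_k_continuous[OF *] continuous_on_subset by blast
qed

lemma C_infinity_mult: "C_infinity f \<Longrightarrow> C_infinity g \<Longrightarrow> C_infinity (\<lambda>z. f z * g z)"
  by (simp add: C_infinity_def C_k_mult)

lemma C_infinity_add: "C_infinity f \<Longrightarrow> C_infinity g \<Longrightarrow> C_infinity (\<lambda>z. f z + g z)"
  by (simp add: C_infinity_def C_k_add)

lemma C_infinity_const: "C_infinity (\<lambda>z. c)"
  by (simp add: C_infinity_def C_k_const)

lemma C_infinity_partial_z: "C_infinity f \<Longrightarrow> C_infinity (partial_z f)"
proof -
  assume "C_infinity f"
  then have "C_infinity (\<lambda>z. 1/2 * (partial_x f z + (- \<i>) * partial_y f z))"
    by (intro C_infinity_mult C_infinity_add C_infinity_const C_infinityD)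
  then show ?thesis by (simp add: partial_z_def[abs_def])
qed

lemma continuous_on_Complex [continuous_intros]:
  "continuous_on A f \<Longrightarrow> continuous_on A g \<Longrightarrow> continuous_on A (\<lambda>x. Complex (f x) (g x))"
  unfolding Complex_eq by (intro continuous_intros)

text \<open>Schwarz's theorem. The value of \<open>f\<close> is recovered by integrating \<open>\<partial>\<^sub>y f\<close> along a vertical segment;
differentiating in \<open>x\<close> under the integral sign expresses \<open>\<partial>\<^sub>x f\<close> as an integral of \<open>\<partial>\<^sub>x \<partial>\<^sub>y f\<close>, and
differentiating that integral in its upper limit gives the claim.\<close>

lemma partial_x_partial_y_commute:
  assumes "C_k 2 f"
  shows "partial_x (partial_y f) = partial_y (partial_x f)"
proof
  fix z
  obtain x0 y0 where z: "z = Complex x0 y0" by (cases z)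
  have d: "f differentiable (at w)" "partial_x f differentiable (at w)"
      "partial_y f differentiable (at w)" for w
    using assms by (auto simp: eval_nat_numeral)
  have c: "continuous_on UNIV (partial_y f)" "continuous_on UNIV (partial_x (partial_y f))"
    using assms d by (auto simp: eval_nat_numeral intro: differentiable_imp_continuous_on simp:
        differentiable_on_def)
  note cc = continuous_on_compose2[OF c(1)] continuous_on_compose2[OF c(2)]
  define a where "a = y0 - 1"
  have 1: "integral {a..y} (\<lambda>t. partial_y f (Complex x t)) = f (Complex x y) - f (Complex x a)" if
      "a \<le> y" for x y
    by (intro integral_unique fundamental_theorem_of_calculus that has_vector_derivative_vertical d)
  have 2: "((\<lambda>x. integral (cbox a y) (\<lambda>t. partial_y f (Complex x t))) has_vector_derivative
     integral (cbox a y) (\<lambda>t. partial_x (partial_y f) (Complex x0 t))) (at x0 within UNIV)" for y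
  proof (rule leibniz_rule_vector_derivative)
    show "continuous_on (UNIV \<times> cbox a y) (\<lambda>(x, t). partial_x (partial_y f) (Complex x t))"
      by (auto simp: split_beta intro!: cc continuous_intros)
    show "(\<lambda>t. partial_y f (Complex x t)) integrable_on cbox a y" for x
      by (rule integrable_continuous) (auto intro!: cc continuous_intros)
  qed (auto intro!: has_vector_derivative_horizontal d)
  have 3: "integral {a..y} (\<lambda>t. partial_x (partial_y f) (Complex x0 t))
      = partial_x f (Complex x0 y) - partial_x f (Complex x0 a)"
    if "a \<le> y" for y
  proof -
    have "((\<lambda>x. f (Complex x y) - f (Complex x a)) has_vector_derivative
          integral {a..y} (\<lambda>t. partial_x (partial_y f) (Complex x0 t))) (at x0)"
      using 2[of y] 1[OF that] by simp
    moreover have "((\<lambda>x. f (Complex x y) - f (Complex x a)) has_vector_derivative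
          partial_x f (Complex x0 y) - partial_x f (Complex x0 a)) (at x0)"
      by (intro has_vector_derivative_diff has_vector_derivative_horizontal d)
    ultimately show ?thesis by (rule vector_derivative_unique_at)
  qed
  have y0: "y0 \<in> {a..y0 + 1}" "y0 \<in> {a<..<y0+1}" by (auto simp: a_def)
  have "((\<lambda>y. integral {a..y} (\<lambda>t. partial_x (partial_y f) (Complex x0 t))) has_vector_derivative
       partial_x (partial_y f) (Complex x0 y0)) (at y0 within {a..y0+1})"
    by (intro integral_has_vector_derivative y0) (auto intro!: cc continuous_intros)
  then have "((\<lambda>y. partial_x f (Complex x0 y) - partial_x f (Complex x0 a)) has_vector_derivative
       partial_x (partial_y f) (Complex x0 y0)) (at y0 within {a..y0+1})"
    by (rule has_vector_derivative_transform[rotated 2]) (use y0 3 in auto)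
  moreover have "((\<lambda>y. partial_x f (Complex x0 y) - partial_x f (Complex x0 a))
      has_vector_derivative
       partial_y (partial_x f) (Complex x0 y0) - 0) (at y0 within {a..y0+1})"
    by (intro has_vector_derivative_diff has_vector_derivative_vertical d
        has_vector_derivative_const)
  moreover have "at y0 within {a..y0 + 1} = at y0"
    using y0(2) by (intro at_within_Icc_at) auto
  ultimately show "partial_x (partial_y f) z = partial_y (partial_x f) z"
    unfolding z by (auto dest: vector_derivative_unique_at)
qed

text \<open>The real differential in Wirtinger form, \<open>df = f\<^sub>z dz + f\<^sub>z\<^sub>' dz'\<close>.\<close>

lemma has_derivative_z_zbar:
  assumes "f differentiable (at z)"
  shows "(f has_derivative (\<lambda>v. partial_z f z * v + partial_zbar f z * cnj v)) (at z)"
proof -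
  have "(\<lambda>v. Re v *\<^sub>R partial_x f z + Im v *\<^sub>R partial_y f z) = (\<lambda>v. partial_z f z * v
      + partial_zbar f z * cnj v)"
    by (auto simp: fun_eq_iff partial_z_def partial_zbar_def complex_eq_iff field_simps)
  then show ?thesis using has_derivative_partials[OF assms] by simp
qed

lemma partials_of_has_derivative_z_zbar:
  assumes "(f has_derivative (\<lambda>v. a * v + b * cnj v)) (at z)"
  shows "partial_x f z = a + b" "partial_y f z = \<i> * (a - b)" "partial_z f z = a" "partial_zbar f z
      = b"
proof -
  show 1: "partial_x f z = a + b" "partial_y f z = \<i> * (a - b)"
    using partials_of_has_derivative[OF assms] by (auto simp: algebra_simps)
  show "partial_z f z = a" "partial_zbar f z = b"
    unfolding partial_z_def partial_zbar_def 1 by (auto simp: algebra_simps)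
qed

lemma C_infinity_imp_C_k: "C_infinity f \<Longrightarrow> C_k k f"
  by (simp add: C_infinity_def)

lemma partial_partial_z:
  assumes "C_infinity f"
  shows "partial_x (partial_z f) = partial_z (partial_x f)" "partial_y (partial_z f)
      = partial_z (partial_y f)"
proof -
  note f = C_infinityD(3)[OF assms] C_infinityD(4)[OF assms]
  have comm: "partial_x (partial_y f) = partial_y (partial_x f)"
    by (rule partial_x_partial_y_commute) (rule C_infinity_imp_C_k[OF assms])
  have dx: "partial_x f differentiable (at z)" and dy: "(\<lambda>z. - \<i> * partial_y f z) differentiable (at
      z)" for z
    using C_infinityD(1)[OF f(1)] C_infinityD(1)[OF f(2)] by (auto intro!: differentiable_mult)
  have z: "partial_z f = (\<lambda>z. 1/2 * (partial_x f z + (- \<i>) * partial_y f z))"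
    by (auto simp: partial_z_def)
  have ds: "(\<lambda>z. partial_x f z + (- \<i>) * partial_y f z) differentiable (at z)" for z
    by (intro differentiable_add dx dy)
  show "partial_x (partial_z f) = partial_z (partial_x f)" "partial_y (partial_z f)
      = partial_z (partial_y f)"
    unfolding z partial_cmult[OF ds] partial_add[OF dx dy] partial_cmult[OF C_infinityD(1)[OF f(2)],
        of "- \<i>"]
    by (auto simp: partial_z_def comm)
qed

section \<open>Integration over the plane\<close>

lemma measurable_Complex [measurable (raw)]:
  assumes "f \<in> borel_measurable M" "g \<in> borel_measurable M"
  shows "(\<lambda>x. Complex (f x) (g x)) \<in> borel_measurable M"
  unfolding Complex_eq using assms by measurable

text \<open>Makes Tonelli's and Fubini's theorems in the real and imaginary parts available for integrals over
the complex plane.\<close>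

lemma lborel_complex_eq_distr:
  "(lborel :: complex measure) = distr (lborel \<Otimes>\<^sub>M lborel) borel (\<lambda>(x, y). Complex x y)"
proof (rule lborel_eqI)
  fix l u :: complex
  assume "\<And>b. b \<in> Basis \<Longrightarrow> l \<bullet> b \<le> u \<bullet> b"
  from this[of 1] this[of \<i>] have le: "Re l \<le> Re u" "Im l \<le> Im u" by auto
  have "(\<lambda>(x, y). Complex x y) -` box l u \<inter> space (lborel \<Otimes>\<^sub>M lborel)
      = {Re l<..<Re u} \<times> {Im l<..<Im u}"
    by (auto simp: space_pair_measure mem_box Basis_complex_def)
  then have "emeasure (distr (lborel \<Otimes>\<^sub>M lborel) borel (\<lambda>(x, y). Complex x y)) (box l u)
      = emeasure (lborel \<Otimes>\<^sub>M lborel) ({Re l<..<Re u} \<times> {Im l<..<Im u})"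
    by (subst emeasure_distr) auto
  also have "\<dots> = (\<Prod>b\<in>Basis. (u - l) \<bullet> b)"
    using le by (subst lborel.emeasure_pair_measure_Times)
        (auto simp: Basis_complex_def ennreal_mult)
  finally show "emeasure (distr (lborel \<Otimes>\<^sub>M lborel) borel (\<lambda>(x, y). Complex x y)) (box l u) =
      (\<Prod>b\<in>Basis. (u - l) \<bullet> b)" .
qed simp

lemma nn_integral_complex:
  assumes [measurable]: "f \<in> borel_measurable borel"
  shows "(\<integral>\<^sup>+z. f z \<partial>lborel) = (\<integral>\<^sup>+x. \<integral>\<^sup>+y. f (Complex x y) \<partial>lborel \<partial>lborel)"
    and "(\<integral>\<^sup>+z. f z \<partial>lborel) = (\<integral>\<^sup>+y. \<integral>\<^sup>+x. f (Complex x y) \<partial>lborel \<partial>lborel)"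
proof -
  have "(\<integral>\<^sup>+z. f z \<partial>lborel) = (\<integral>\<^sup>+p. f (Complex (fst p) (snd p)) \<partial>(lborel \<Otimes>\<^sub>M lborel))"
    unfolding lborel_complex_eq_distr by (subst nn_integral_distr) (auto simp: split_beta')
  also have "\<dots> = (\<integral>\<^sup>+x. \<integral>\<^sup>+y. f (Complex x y) \<partial>lborel \<partial>lborel)"
    by (subst lborel.nn_integral_fst[symmetric]) auto
  finally show "(\<integral>\<^sup>+z. f z \<partial>lborel) = (\<integral>\<^sup>+x. \<integral>\<^sup>+y. f (Complex x y) \<partial>lborel \<partial>lborel)" .
  also have "\<dots> = (\<integral>\<^sup>+y. \<integral>\<^sup>+x. f (Complex x y) \<partial>lborel \<partial>lborel)"
    by (subst lborel_pair.Fubini') auto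
  finally show "(\<integral>\<^sup>+z. f z \<partial>lborel) = (\<integral>\<^sup>+y. \<integral>\<^sup>+x. f (Complex x y) \<partial>lborel \<partial>lborel)" .
qed

lemma integral_complex:
  fixes f :: "complex \<Rightarrow> complex"
  assumes f: "integrable lborel f"
  shows "(\<integral>z. f z \<partial>lborel) = (\<integral>x. \<integral>y. f (Complex x y) \<partial>lborel \<partial>lborel)"
    and "(\<integral>z. f z \<partial>lborel) = (\<integral>y. \<integral>x. f (Complex x y) \<partial>lborel \<partial>lborel)"
proof -
  have [measurable]: "f \<in> borel_measurable borel" using f by auto
  have i: "integrable (lborel \<Otimes>\<^sub>M lborel) (\<lambda>(x, y). f (Complex x y))"
    using f unfolding lborel_complex_eq_distr by (subst (asm) integrable_distr_eq)
        (auto simp: split_beta')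
  have "(\<integral>z. f z \<partial>lborel) = (\<integral>p. (\<lambda>(x, y). f (Complex x y)) p \<partial>(lborel \<Otimes>\<^sub>M lborel))"
    unfolding lborel_complex_eq_distr by (subst integral_distr) (auto simp: split_beta')
  also have "\<dots> = (\<integral>x. \<integral>y. f (Complex x y) \<partial>lborel \<partial>lborel)"
    by (subst lborel_pair.integral_fst'[symmetric]) (use i in auto)
  finally show "(\<integral>z. f z \<partial>lborel) = (\<integral>x. \<integral>y. f (Complex x y) \<partial>lborel \<partial>lborel)" .
  also have "\<dots> = (\<integral>y. \<integral>x. f (Complex x y) \<partial>lborel \<partial>lborel)"
    using lborel_pair.Fubini_integral[OF i] by simp
  finally show "(\<integral>z. f z \<partial>lborel) = (\<integral>y. \<integral>x. f (Complex x y) \<partial>lborel \<partial>lborel)" .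
qed

definition square :: "real \<Rightarrow> complex set" where
  "square R = cbox (Complex (-R) (-R)) (Complex R R)"

lemma mem_square: "z \<in> square R \<longleftrightarrow> \<bar>Re z\<bar> \<le> R \<and> \<bar>Im z\<bar> \<le> R"
  by (auto simp: square_def mem_box Basis_complex_def)

lemma square_measurable [measurable]: "square R \<in> sets borel"
  by (simp add: square_def)

lemma integrable_square:
  fixes f :: "complex \<Rightarrow> 'b::{banach,second_countable_topology}"
  assumes "continuous_on UNIV f"
  shows "integrable lborel (\<lambda>z. indicator (square R) z *\<^sub>R f z)"
  unfolding square_def using assms
  by (intro borel_integrable_compact) (auto intro: continuous_on_subset)

lemma integral_const_Icc_bound:
  fixes F :: "real \<Rightarrow> complex"
  assumes "\<And>y. norm (F y) \<le> C" "R \<ge> 0" "C \<ge> 0"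
  shows "norm (\<integral>y. indicator {-R..R} y *\<^sub>R F y \<partial>lborel) \<le> 2 * R * C"
proof -
  have "norm (\<integral>y. indicator {-R..R} y *\<^sub>R F y \<partial>lborel) \<le> (\<integral>y. indicator {-R..R} y *\<^sub>R C \<partial>lborel)"
    using assms by (intro order_trans[OF integral_norm_bound] integral_mono')
        (auto split: split_indicator)
  also have "\<dots> = 2 * R * C" using assms by simp
  finally show ?thesis .
qed

text \<open>By the fundamental theorem of calculus on horizontal lines the integral lives on the two vertical
sides of the square, which have total length \<open>4 R\<close>.\<close>

lemma norm_integral_square_partial_x:
  assumes d: "\<And>z. G differentiable (at z)" and c: "continuous_on UNIV (partial_x G)"
    and B: "\<And>z. R \<le> cmod z \<Longrightarrow> cmod (G z) \<le> B" and R: "R \<ge> 0"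
  shows "cmod (\<integral>z. indicator (square R) z *\<^sub>R partial_x G z \<partial>lborel) \<le> 4 * R * B"
proof -
  have B0: "B \<ge> 0" using B[of "of_real R"] R by (auto intro: order_trans[OF norm_ge_zero])
  have bnd: "cmod (G (Complex R y)) \<le> B" "cmod (G (Complex (-R) y)) \<le> B" for y
    using B[of "Complex R y"] B[of "Complex (-R) y"] abs_Re_le_cmod[of "Complex R y"]
      abs_Re_le_cmod[of "Complex (-R) y"] R by auto
  have inner: "(\<integral>x. indicator (square R) (Complex x y) *\<^sub>R partial_x G (Complex x y) \<partial>lborel)
      = indicator {-R..R} y *\<^sub>R (G (Complex R y) - G (Complex (-R) y))" for y
  proof -
    have "(\<integral>x. indicator (square R) (Complex x y) *\<^sub>R partial_x G (Complex x y) \<partial>lborel)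
      = (\<integral>x. indicator {-R..R} y *\<^sub>R (indicator {-R..R} x *\<^sub>R partial_x G (Complex x y)) \<partial>lborel)"
      by (intro Bochner_Integration.integral_cong) (auto simp: indicator_def mem_square)
    also have "\<dots> = indicator {-R..R} y *\<^sub>R (\<integral>x. indicator {-R..R} x *\<^sub>R partial_x G (Complex x y)
        \<partial>lborel)"
      by (rule integral_scaleR_right)
    also have "(\<integral>x. indicator {-R..R} x *\<^sub>R partial_x G (Complex x y) \<partial>lborel)
        = G (Complex R y) - G (Complex (-R) y)"
      using R by (intro integral_FTC_atLeastAtMost has_vector_derivative_horizontal d)
         (auto intro!: continuous_on_compose2[OF c] continuous_intros)
    finally show ?thesis .
  qed
  have "(\<integral>z. indicator (square R) z *\<^sub>R partial_x G z \<partial>lborel) =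
      (\<integral>y. indicator {-R..R} y *\<^sub>R (G (Complex R y) - G (Complex (-R) y)) \<partial>lborel)"
    by (subst integral_complex(2)[OF integrable_square[OF c]]) (simp only: inner)
  also have "cmod \<dots> \<le> 2 * R * (2 * B)"
    using B0 R by (intro integral_const_Icc_bound) (auto intro: order_trans[OF norm_triangle_ineq4]
        add_mono[OF bnd, of y y for y, simplified])
  finally show ?thesis by simp
qed

lemma norm_integral_square_partial_y:
  assumes d: "\<And>z. G differentiable (at z)" and c: "continuous_on UNIV (partial_y G)"
    and B: "\<And>z. R \<le> cmod z \<Longrightarrow> cmod (G z) \<le> B" and R: "R \<ge> 0"
  shows "cmod (\<integral>z. indicator (square R) z *\<^sub>R partial_y G z \<partial>lborel) \<le> 4 * R * B"
proof -
  have B0: "B \<ge> 0" using B[of "of_real R"] R by (auto intro: order_trans[OF norm_ge_zero])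
  have bnd: "cmod (G (Complex x R)) \<le> B" "cmod (G (Complex x (-R))) \<le> B" for x
    using B[of "Complex x R"] B[of "Complex x (-R)"] abs_Im_le_cmod[of "Complex x R"]
      abs_Im_le_cmod[of "Complex x (-R)"] R by auto
  have inner: "(\<integral>y. indicator (square R) (Complex x y) *\<^sub>R partial_y G (Complex x y) \<partial>lborel)
      = indicator {-R..R} x *\<^sub>R (G (Complex x R) - G (Complex x (-R)))" for x
  proof -
    have "(\<integral>y. indicator (square R) (Complex x y) *\<^sub>R partial_y G (Complex x y) \<partial>lborel)
      = (\<integral>y. indicator {-R..R} x *\<^sub>R (indicator {-R..R} y *\<^sub>R partial_y G (Complex x y)) \<partial>lborel)"
      by (intro Bochner_Integration.integral_cong) (auto simp: indicator_def mem_square)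
    also have "\<dots> = indicator {-R..R} x *\<^sub>R (\<integral>y. indicator {-R..R} y *\<^sub>R partial_y G (Complex x y)
        \<partial>lborel)"
      by (rule integral_scaleR_right)
    also have "(\<integral>y. indicator {-R..R} y *\<^sub>R partial_y G (Complex x y) \<partial>lborel)
        = G (Complex x R) - G (Complex x (-R))"
      using R by (intro integral_FTC_atLeastAtMost has_vector_derivative_vertical d)
         (auto intro!: continuous_on_compose2[OF c] continuous_intros)
    finally show ?thesis .
  qed
  have "(\<integral>z. indicator (square R) z *\<^sub>R partial_y G z \<partial>lborel) =
      (\<integral>x. indicator {-R..R} x *\<^sub>R (G (Complex x R) - G (Complex x (-R))) \<partial>lborel)"
    by (subst integral_complex(1)[OF integrable_square[OF c]]) (simp only: inner)
  also have "cmod \<dots> \<le> 2 * R * (2 * B)"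
    using B0 R by (intro integral_const_Icc_bound) (auto intro: order_trans[OF norm_triangle_ineq4]
        add_mono[OF bnd, of x x for x, simplified])
  finally show ?thesis by simp
qed

lemma partial_eq_0_outside:
  assumes "\<And>z. R < cmod z \<Longrightarrow> f z = 0" "R < cmod z"
  shows "partial_x f z = 0" "partial_y f z = 0"
proof -
  have o: "open {z. R < cmod z}" by (intro open_Collect_less continuous_intros)
  have "((\<lambda>_. 0) has_derivative (\<lambda>_. 0)) (at z)" by (rule has_derivative_const)
  then have "(f has_derivative (\<lambda>_. 0)) (at z)"
    by (rule has_derivative_transform_within_open[OF _ o]) (use assms in auto)
  from partials_of_has_derivative[OF this] show "partial_x f z = 0" "partial_y f z = 0" by auto
qed

lemma integral_partial_eq_0:
  assumes d: "\<And>z. G differentiable (at z)" and supp: "\<And>z. R < cmod z \<Longrightarrow> G z = 0"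
  shows "continuous_on UNIV (partial_x G) \<Longrightarrow> (\<integral>z. partial_x G z \<partial>lborel) = 0"
    and "continuous_on UNIV (partial_y G) \<Longrightarrow> (\<integral>z. partial_y G z \<partial>lborel) = 0"
proof -
  define R' where "R' = \<bar>R\<bar> + 1"
  have R': "R' \<ge> 0" "cmod (G z) \<le> 0" if "R' \<le> cmod z" for z using supp[of z] that by
      (auto simp: R'_def)
  have R'0: "R' \<ge> 0" by (simp add: R'_def)
  have out: "R < cmod z" if "z \<notin> square R'" for z
    using that abs_Re_le_cmod[of z] abs_Im_le_cmod[of z] by (auto simp: mem_square R'_def)
  have "(\<lambda>z. indicator (square R') z *\<^sub>R partial_x G z) = partial_x G"
    "(\<lambda>z. indicator (square R') z *\<^sub>R partial_y G z) = partial_y G"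
    using partial_eq_0_outside[of R G, OF supp] out by (auto simp: indicator_def fun_eq_iff)
  then show "continuous_on UNIV (partial_x G) \<Longrightarrow> (\<integral>z. partial_x G z \<partial>lborel) = 0"
    "continuous_on UNIV (partial_y G) \<Longrightarrow> (\<integral>z. partial_y G z \<partial>lborel) = 0"
    using norm_integral_square_partial_x[OF d _ R'(2) R'0] norm_integral_square_partial_y[OF d _
        R'(2) R'0]
    by auto
qed

lemma nn_integral_powr_minus_half_finite:
  "(\<integral>\<^sup>+x. ennreal (indicator {-R..R} x * \<bar>x\<bar> powr (-1/2)) \<partial>lborel) < \<infinity>"
proof (cases "R \<ge> 0")
  case True
  from has_integral_powr_from_0[of "-1/2" R] True obtain I where
    I: "((\<lambda>x. x powr (-1/2)) has_integral I) {0..R}" by auto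
  have 1: "((\<lambda>x. \<bar>x\<bar> powr (-1/2)) has_integral I) {0..R}"
    by (rule has_integral_eq[OF _ I]) auto
  then have 2: "((\<lambda>x. \<bar>x\<bar> powr (-1/2)) has_integral I) {-R..0}"
    using has_integral_reflect_real[where f="\<lambda>x. \<bar>x\<bar> powr (-1/2)" and a=0 and b=R and i=I] by simp
  have "((\<lambda>x. \<bar>x\<bar> powr (-1/2)) has_integral (I + I)) {-R..R}"
    by (rule has_integral_combine[OF _ _ 2 1]) (use True in auto)
  then have "(\<integral>\<^sup>+x. ennreal (indicator {-R..R} x * \<bar>x\<bar> powr (-1/2)) \<partial>lborel) = ennreal (I + I)"
    by (intro nn_integral_has_integral_lebesgue) auto
  then show ?thesis by simp
next
  case False
  then show ?thesis by simp
qed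

text \<open>For \<open>w = x + i y\<close> the inequality \<open>|x| |y| \<le> |w|\<^sup>2\<close> holds, so \<open>1 / |w|\<close> is dominated by the
product \<open>|x|\<^sup>-\<^sup>1\<^sup>/\<^sup>2 |y|\<^sup>-\<^sup>1\<^sup>/\<^sup>2\<close> of integrable functions of one variable. The bound fails on the coordinate axes,
where \<open>powr\<close> takes the default value 0, but the axes are null sets.\<close>

lemma integrable_inverse_norm:
  "integrable lborel (\<lambda>w::complex. indicator (cball 0 R) w * (1 / cmod w))"
proof (rule integrableI_bounded)
  define \<psi> where "\<psi> = (\<lambda>x::real. ennreal (indicator {-R..R} x * \<bar>x\<bar> powr (-1/2)))"
  have [measurable]: "\<psi> \<in> borel_measurable borel" unfolding \<psi>_def by measurable
  have [measurable]: "cball 0 R \<in> sets (borel :: complex measure)" by simp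
  have nz: "AE x in lborel. x \<noteq> (0::real)" by (rule AE_lborel_singleton)
  have *: "ennreal (norm (indicator (cball 0 R) (Complex x y) * (1 / cmod (Complex x y))))
      \<le> \<psi> x * \<psi> y"
    if "x \<noteq> 0" "y \<noteq> 0" for x y
  proof (cases "Complex x y \<in> cball 0 R")
    case True
    then have "\<bar>x\<bar> \<le> R" "\<bar>y\<bar> \<le> R"
      using abs_Re_le_cmod[of "Complex x y"] abs_Im_le_cmod[of "Complex x y"] by auto
    moreover have "1 / cmod (Complex x y) \<le> \<bar>x\<bar> powr (-1/2) * \<bar>y\<bar> powr (-1/2)"
    proof -
      have "\<bar>x\<bar> powr (1/2) * \<bar>y\<bar> powr (1/2) = sqrt (\<bar>x\<bar> * \<bar>y\<bar>)"
        by (simp add: powr_half_sqrt real_sqrt_mult)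
      also have "\<dots> \<le> sqrt (cmod (Complex x y) * cmod (Complex x y))"
        using abs_Re_le_cmod[of "Complex x y"] abs_Im_le_cmod[of "Complex x y"]
        by (intro real_sqrt_le_mono mult_mono) auto
      finally have "\<bar>x\<bar> powr (1/2) * \<bar>y\<bar> powr (1/2) \<le> cmod (Complex x y)" by simp
      moreover have "0 < \<bar>x\<bar> powr (1/2) * \<bar>y\<bar> powr (1/2)" using that by simp
      ultimately have "1 / cmod (Complex x y) \<le> 1 / (\<bar>x\<bar> powr (1/2) * \<bar>y\<bar> powr (1/2))"
        by (intro divide_left_mono mult_pos_pos) auto
      also have "\<dots> = \<bar>x\<bar> powr (-1/2) * \<bar>y\<bar> powr (-1/2)"
        by (simp add: powr_minus field_simps)
      finally show ?thesis .
    qed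
    ultimately show ?thesis using True
      unfolding \<psi>_def by (subst ennreal_mult[symmetric]) (auto intro!: ennreal_leI simp: abs_le_iff)
  qed auto
  have "(\<integral>\<^sup>+w. ennreal (norm (indicator (cball 0 R) w * (1 / cmod w))) \<partial>(lborel::complex measure)) =
     (\<integral>\<^sup>+x. \<integral>\<^sup>+y. ennreal (norm (indicator (cball 0 R) (Complex x y) * (1 / cmod (Complex x y))))
         \<partial>lborel \<partial>lborel)"
    by (rule nn_integral_complex(1)) measurable
  also have "\<dots> \<le> (\<integral>\<^sup>+x. \<integral>\<^sup>+y. \<psi> x * \<psi> y \<partial>lborel \<partial>lborel)"
  proof (rule nn_integral_mono_AE)
    show "AE x in lborel. (\<integral>\<^sup>+y. ennreal (norm (indicator (cball 0 R) (Complex x y) * (1 / cmod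
        (Complex x y)))) \<partial>lborel)
        \<le> (\<integral>\<^sup>+y. \<psi> x * \<psi> y \<partial>lborel)"
      using nz
    proof eventually_elim
      case (elim x)
      show ?case using nz
        by (intro nn_integral_mono_AE, eventually_elim) (use elim * in auto)
    qed
  qed
  also have "\<dots> = (\<integral>\<^sup>+x. \<psi> x \<partial>lborel) * (\<integral>\<^sup>+x. \<psi> x \<partial>lborel)"
    by (simp add: nn_integral_cmult nn_integral_multc)
  also have "\<dots> < \<infinity>"
    using nn_integral_powr_minus_half_finite[of R] unfolding \<psi>_def by
        (simp add: ennreal_mult_less_top)
  finally show "(\<integral>\<^sup>+w. ennreal (norm (indicator (cball 0 R) w * (1 / cmod w))) \<partial>(lborel::complex
      measure)) < \<infinity>" .
  have "(\<lambda>w::complex. indicator (cball 0 R) w * (1 / cmod w)) \<in> borel_measurable borel"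
    by measurable
  then show "(\<lambda>w::complex. indicator (cball 0 R) w * (1 / cmod w)) \<in> borel_measurable lborel"
    by (simp only: measurable_lborel1 measurable_lborel2)
qed

lemma nn_integral_cauchy_density_finite: "(\<integral>\<^sup>+x. ennreal (1 / (1
    + x\<^sup>2)) \<partial>(lborel :: real measure)) < \<infinity>"
proof -
  have pos: "(\<integral>\<^sup>+x. ennreal (1 / (1 + x\<^sup>2)) * indicator {0..} x \<partial>lborel)
      = ennreal (pi/2 - arctan 0)"
    by (rule nn_integral_FTC_atLeast)
      (auto intro!: derivative_eq_intros simp: tendsto_arctan_at_top inverse_eq_divide
          add_pos_nonneg)
  have "(\<integral>\<^sup>+x. ennreal (1 / (1 + x\<^sup>2)) \<partial>lborel) \<le>
     (\<integral>\<^sup>+x. ennreal (1 / (1 + x\<^sup>2)) * indicator {0..} x + ennreal (1 / (1 + (0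
         + (-1) * x)\<^sup>2)) * indicator {0..} (0 + (-1) * x) \<partial>lborel)"
    by (intro nn_integral_mono) (auto simp: indicator_def)
  also have "\<dots> = (\<integral>\<^sup>+x. ennreal (1 / (1 + x\<^sup>2)) * indicator {0..} x \<partial>lborel) +
     (\<integral>\<^sup>+x. ennreal (1 / (1 + (0 + (-1) * x)\<^sup>2)) * indicator {0..} (0 + (-1) * x) \<partial>lborel)"
    by (rule nn_integral_add) auto
  also have "(\<integral>\<^sup>+x. ennreal (1 / (1 + (0 + (-1) * x)\<^sup>2)) * indicator {0..} (0 + (-1) * x) \<partial>lborel) =
     (\<integral>\<^sup>+x. ennreal (1 / (1 + x\<^sup>2)) * indicator {0..} x \<partial>lborel)"
    using nn_integral_real_affine[of "\<lambda>x. ennreal (1 / (1 + x\<^sup>2)) * indicator {0..} x" "-1" 0]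
        by simp
  finally show ?thesis unfolding pos by (simp add: order_le_less_trans)
qed

text \<open>The Cauchy kernel \<open>1 / w = cnj w / |w|\<^sup>2\<close> with its singularity removed.\<close>

definition reg_kernel :: "real \<Rightarrow> complex \<Rightarrow> complex" where
  "reg_kernel e w = cnj w / of_real ((Re w)\<^sup>2 + (Im w)\<^sup>2 + e\<^sup>2)"

text \<open>This is \<open>\<partial>\<^sub>z\<^sub>'\<close> of \<open>reg_kernel e\<close>, an approximate identity as \<open>e\<close> tends to 0 (up to the
factor \<open>kernel_mass\<close>).\<close>

definition reg_kernel_zbar :: "real \<Rightarrow> complex \<Rightarrow> real" where
  "reg_kernel_zbar e w = e\<^sup>2 / ((cmod w)\<^sup>2 + e\<^sup>2)\<^sup>2"

lemma integrable_reg_kernel_zbar: "integrable lborel (reg_kernel_zbar 1)"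
proof (rule integrableI_bounded)
  define \<psi> where "\<psi> = (\<lambda>x::real. ennreal (1 / (1 + x\<^sup>2)))"
  have [measurable]: "\<psi> \<in> borel_measurable borel" unfolding \<psi>_def by measurable
  show [measurable]: "reg_kernel_zbar 1 \<in> borel_measurable lborel" unfolding reg_kernel_zbar_def
      by measurable
  have *: "ennreal (norm (reg_kernel_zbar 1 (Complex x y))) \<le> \<psi> x * \<psi> y" for x y
  proof -
    have "(1 + x\<^sup>2) * (1 + y\<^sup>2) \<le> (x\<^sup>2 + y\<^sup>2 + 1)\<^sup>2"
    proof -
      have "0 \<le> x^4 + y^4 + x\<^sup>2 * y\<^sup>2 + x\<^sup>2 + y\<^sup>2" by simp
      also have "\<dots> = (x\<^sup>2 + y\<^sup>2 + 1)\<^sup>2 - (1 + x\<^sup>2) * (1 + y\<^sup>2)" by algebra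
      finally show ?thesis by simp
    qed
    then have "1 / (x\<^sup>2 + y\<^sup>2 + 1)\<^sup>2 \<le> 1 / ((1 + x\<^sup>2) * (1 + y\<^sup>2))"
      by (intro divide_left_mono mult_pos_pos zero_less_power)
          (auto simp: add_pos_nonneg add_nonneg_pos)
    then show ?thesis unfolding \<psi>_def reg_kernel_zbar_def
      by (subst ennreal_mult[symmetric]) (auto intro!: ennreal_leI simp: cmod_power2)
  qed
  have "(\<integral>\<^sup>+w. ennreal (norm (reg_kernel_zbar 1 w)) \<partial>lborel)
      = (\<integral>\<^sup>+x. \<integral>\<^sup>+y. ennreal (norm (reg_kernel_zbar 1 (Complex x y))) \<partial>lborel \<partial>lborel)"
    by (rule nn_integral_complex(1)) auto
  also have "\<dots> \<le> (\<integral>\<^sup>+x. \<integral>\<^sup>+y. \<psi> x * \<psi> y \<partial>lborel \<partial>lborel)"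
    by (intro nn_integral_mono *)
  also have "\<dots> = (\<integral>\<^sup>+x. \<psi> x \<partial>lborel) * (\<integral>\<^sup>+x. \<psi> x \<partial>lborel)"
    by (simp add: nn_integral_cmult nn_integral_multc)
  also have "\<dots> < \<infinity>"
    using nn_integral_cauchy_density_finite unfolding \<psi>_def by (simp add: ennreal_mult_less_top)
  finally show "(\<integral>\<^sup>+w. ennreal (norm (reg_kernel_zbar 1 w)) \<partial>lborel) < \<infinity>" .
qed

text \<open>The constant \<open>\<pi>\<close> of Cauchy's formula, in the form in which it arises here: the mass of the approximate
identity.\<close>

definition kernel_mass :: real where "kernel_mass = (\<integral>w. reg_kernel_zbar 1 w \<partial>lborel)"

lemma kernel_mass_pos: "kernel_mass > 0"
proof -
  have "reg_kernel_zbar 1 w > 0" for w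
    unfolding reg_kernel_zbar_def by (intro divide_pos_pos zero_less_power add_nonneg_pos) auto
  then have pos: "reg_kernel_zbar 1 w \<ge> 0" "reg_kernel_zbar 1 w \<noteq> 0" for w
    by (auto simp: less_imp_le order_less_imp_not_eq2)
  have "(\<integral>w. reg_kernel_zbar 1 w \<partial>lborel) \<noteq> 0"
  proof
    assume "(\<integral>w. reg_kernel_zbar 1 w \<partial>lborel) = 0"
    then have "AE w in (lborel :: complex measure). False"
      using integral_nonneg_eq_0_iff_AE[OF integrable_reg_kernel_zbar] pos by simp
    then have "(UNIV :: complex set) \<in> null_sets lborel"
      by (subst (asm) AE_iff_null) auto
    then show False by (simp add: null_sets_def)
  qed
  moreover have "(\<integral>w. reg_kernel_zbar 1 w \<partial>lborel) \<ge> 0"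
    by (intro Bochner_Integration.integral_nonneg pos)
  ultimately show ?thesis by (simp add: kernel_mass_def)
qed

text \<open>The scaling \<open>w = e v\<close> shows that every \<open>reg_kernel_zbar e\<close> has the same mass, concentrated at scale \<open>e\<close>.\<close>

lemma integral_reg_kernel_zbar_scale:
  fixes h :: "complex \<Rightarrow> complex"
  assumes [measurable]: "h \<in> borel_measurable borel" and e: "e > 0"
  shows "(\<integral>w. reg_kernel_zbar e w *\<^sub>R h w \<partial>lborel) = (\<integral>v. reg_kernel_zbar 1 v *\<^sub>R h (e *\<^sub>R v)
      \<partial>lborel)"
proof -
  have [measurable]: "reg_kernel_zbar e \<in> borel_measurable borel" for e unfolding
      reg_kernel_zbar_def by measurable
  have "(\<integral>w. reg_kernel_zbar e w *\<^sub>R h w \<partial>lborel) =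
     integral\<^sup>L (density (distr lborel borel (\<lambda>x. 0 + e *\<^sub>R x)) (\<lambda>_. ennreal (\<bar>e\<bar>^DIM(complex))))
         (\<lambda>w. reg_kernel_zbar e w *\<^sub>R h w)"
    using e by (subst lborel_affine[of e 0]) auto
  also have "\<dots> = (\<integral>v. (\<bar>e\<bar>^DIM(complex)) *\<^sub>R (reg_kernel_zbar e (e *\<^sub>R v) *\<^sub>R h (e *\<^sub>R v)) \<partial>lborel)"
    by (subst integral_density) (auto simp: integral_distr)
  also have "\<dots> = (\<integral>v. reg_kernel_zbar 1 v *\<^sub>R h (e *\<^sub>R v) \<partial>lborel)"
  proof (intro Bochner_Integration.integral_cong refl)
    fix v :: complex
    have "e^2 * reg_kernel_zbar e (e *\<^sub>R v) = reg_kernel_zbar 1 v"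
    proof -
      have "((cmod (e *\<^sub>R v))\<^sup>2 + e\<^sup>2) = e\<^sup>2 * ((cmod v)\<^sup>2 + 1)"
        by (simp add: power_mult_distrib algebra_simps)
      then have "reg_kernel_zbar e (e *\<^sub>R v) = e\<^sup>2 / (e\<^sup>2 * ((cmod v)\<^sup>2 + 1))\<^sup>2" by
          (simp add: reg_kernel_zbar_def)
      also have "\<dots> = e\<^sup>2 / (e\<^sup>2 * (e\<^sup>2 * ((cmod v)\<^sup>2 + 1)\<^sup>2))" by
          (simp add: power_mult_distrib power2_eq_square mult_ac)
      finally show ?thesis using e by (simp add: reg_kernel_zbar_def add_nonneg_eq_0_iff)
    qed
    then show "(\<bar>e\<bar>^DIM(complex)) *\<^sub>R (reg_kernel_zbar e (e *\<^sub>R v) *\<^sub>R h (e *\<^sub>R v))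
        = reg_kernel_zbar 1 v *\<^sub>R h (e *\<^sub>R v)"
      using e by simp
  qed
  finally show ?thesis .
qed

section \<open>The Cauchy transform\<close>

definition supported :: "real \<Rightarrow> (complex \<Rightarrow> complex) \<Rightarrow> bool" where
  "supported R h \<longleftrightarrow> (\<forall>z. R < cmod z \<longrightarrow> h z = 0)"

lemma supportedD: "supported R h \<Longrightarrow> R < cmod z \<Longrightarrow> h z = 0"
  by (simp add: supported_def)

lemma supported_partial:
  assumes "supported R h"
  shows "supported R (partial_x h)" "supported R (partial_y h)" "supported R (partial_z h)"
      "supported R (partial_zbar h)"
  using assms partial_eq_0_outside[of R h] by (auto simp: supported_def partial_z_def
      partial_zbar_def)

lemma supported_bounded:
  assumes "continuous_on UNIV h" "supported R h"
  obtains B where "B \<ge> 0" "\<And>z. cmod (h z) \<le> B"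
proof -
  have "compact (h ` cball 0 R)"
    by (intro compact_continuous_image compact_cball continuous_on_subset[OF assms(1)]) auto
  then obtain B where B: "\<And>z. z \<in> cball 0 R \<Longrightarrow> cmod (h z) \<le> B"
    using compact_imp_bounded by (metis (no_types, lifting) bounded_iff imageI)
  show ?thesis
  proof (rule that[of "max B 0"])
    show "cmod (h z) \<le> max B 0" for z
      using B[of z] supportedD[OF assms(2), of z] by (cases "R < cmod z") auto
  qed simp
qed

lemma supported_uniformly_continuous:
  assumes "continuous_on UNIV h" "supported R h" "e > 0"
  obtains d where "d > 0" "\<And>p q. dist p q < d \<Longrightarrow> dist (h p) (h q) < e"
proof -
  have "uniformly_continuous_on (cball 0 (R + 1)) h"
    by (intro compact_uniformly_continuous compact_cball continuous_on_subset[OF assms(1)]) auto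
  then obtain d where d: "d > 0" "\<And>p q. p \<in> cball 0 (R + 1) \<Longrightarrow> q \<in> cball 0 (R + 1) \<Longrightarrow> dist p q < d
      \<Longrightarrow> dist (h p) (h q) < e"
    unfolding uniformly_continuous_on_def using assms(3) by metis
  show ?thesis
  proof (rule that[of "min d 1"])
    fix p q :: complex assume pq: "dist p q < min d 1"
    show "dist (h p) (h q) < e"
    proof (cases "p \<in> cball 0 (R + 1) \<and> q \<in> cball 0 (R + 1)")
      case True
      then show ?thesis using d pq by auto
    next
      case False
      have "cmod p \<le> cmod q + dist p q" "cmod q \<le> cmod p + dist p q"
        using norm_triangle_sub[of p q] norm_triangle_sub[of q p] by
            (auto simp: dist_norm norm_minus_commute)
      with False pq have "R < cmod p" "R < cmod q" by auto
      then show ?thesis using supportedD[OF assms(2)] assms(3) by simp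
    qed
  qed (use d in auto)
qed

text \<open>The local mass of the kernel \<open>1 / |w|\<close>; it is the constant in all pointwise bounds for convolutions
with \<open>1 / w\<close>.\<close>

definition inverse_norm_mass :: "real \<Rightarrow> real" where
  "inverse_norm_mass r = (\<integral>w. indicator (cball 0 r) w * (1 / cmod w) \<partial>(lborel :: complex measure))"

lemma inverse_norm_mass_nonneg: "inverse_norm_mass r \<ge> 0"
  unfolding inverse_norm_mass_def by (intro Bochner_Integration.integral_nonneg) auto

lemma integrable_div:
  assumes "k \<in> borel_measurable borel" and B: "\<And>w. cmod (k w) \<le> B" and r: "\<And>w. r < cmod w \<Longrightarrow> k w = 0"
  shows "integrable lborel (\<lambda>w::complex. k w / w)"
    and "cmod (\<integral>w. k w / w \<partial>lborel) \<le> B * inverse_norm_mass r"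
proof -
  have [measurable]: "k \<in> borel_measurable borel" by fact
  have i: "integrable lborel (\<lambda>w::complex. B * (indicator (cball 0 r) w * (1 / cmod w)))"
    by (intro integrable_mult_right integrable_inverse_norm)
  have le: "cmod (k w / w) \<le> B * (indicator (cball 0 r) w * (1 / cmod w))" for w
  proof (cases "w \<in> cball 0 r")
    case True
    then show ?thesis using B[of w] by (auto simp: norm_divide intro!: divide_right_mono)
  next
    case False
    then show ?thesis using r[of w] by auto
  qed
  show "integrable lborel (\<lambda>w::complex. k w / w)"
  proof (rule Bochner_Integration.integrable_bound[OF i])
    show "AE w in lborel. norm (k w / w) \<le> norm (B * (indicator (cball 0 r) w * (1 / cmod w)))"
      unfolding real_norm_def by (intro AE_I2 order_trans[OF le abs_ge_self])
  qed measurable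
  then show "cmod (\<integral>w. k w / w \<partial>lborel) \<le> B * inverse_norm_mass r"
    using Bochner_Integration.integral_norm_bound_integral[OF _ i le] integral_mult_right_zero[of
        lborel B]
    unfolding inverse_norm_mass_def by metis
qed

text \<open>The differentiated function carries no singularity in this form of the convolution, so derivatives in
\<open>z\<close> fall on \<open>h\<close>. The integrand at \<open>w = 0\<close> is 0, by the convention for division by zero.\<close>

definition cauchy_transform :: "(complex \<Rightarrow> complex) \<Rightarrow> complex \<Rightarrow> complex" where
  "cauchy_transform h z = (\<integral>w. h (z - w) / w \<partial>lborel) / of_real kernel_mass"

lemma supported_translate:
  assumes "supported R h" "cmod z + R < cmod w"
  shows "h (z - w) = 0"
  using norm_triangle_ineq2[of w z] assms by (intro supportedD[OF assms(1)])
      (auto simp: norm_minus_commute)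

lemma measurable_translate:
  assumes "continuous_on UNIV h"
  shows "(\<lambda>w::complex. h (z - w)) \<in> borel_measurable borel"
  by (intro borel_measurable_continuous_onI continuous_on_compose2[OF assms] continuous_intros) auto

lemma cauchy_integrable:
  assumes "continuous_on UNIV h" "supported R h"
  shows "integrable lborel (\<lambda>w. h (z - w) / w)"
proof -
  obtain B where "\<And>z. cmod (h z) \<le> B" using supported_bounded[OF assms] by blast
  then show ?thesis
    by (intro integrable_div(1)[where r="cmod z + R"] measurable_translate assms
        supported_translate[OF assms(2)])
qed

lemma cauchy_transform_bound:
  assumes "continuous_on UNIV h" "supported R h" "\<And>z. cmod (h z) \<le> B"
  shows "cmod (cauchy_transform h z) \<le> B * (inverse_norm_mass (cmod z + R) / kernel_mass)"
  using integrable_div(2)[of "\<lambda>w. h (z - w)" B "cmod z + R"] measurable_translate[OF assms(1)]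
    supported_translate[OF assms(2)] assms(3) kernel_mass_pos
  by (auto simp: cauchy_transform_def norm_divide divide_right_mono)

text \<open>When \<open>z\<close> is at least twice as far out as the support of \<open>h\<close>, only points with \<open>|w| \<ge> |z| / 2\<close> contribute,
and they fill a disc of radius \<open>R\<close>.\<close>

lemma cauchy_transform_decay:
  assumes "continuous_on UNIV h" "supported R h" "\<And>z. cmod (h z) \<le> B" "R > 0" "2 * R \<le> cmod z"
  shows "cmod (cauchy_transform h z) \<le> B * (2 * (unit_ball_vol 2 * R\<^sup>2) / kernel_mass) / cmod z"
proof -
  have B: "B \<ge> 0" using assms(3)[of 0] norm_ge_zero order_trans by blast
  have le: "cmod (h (z - w) / w) \<le> indicator (cball z R) w *\<^sub>R (2 * B / cmod z)" for w
  proof (cases "w \<in> cball z R")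
    case True
    then have "cmod (z - w) \<le> R" by (simp add: dist_norm)
    with norm_triangle_ineq2[of z w] have w: "cmod z \<le> 2 * cmod w"
      using norm_triangle_sub[of z w] assms(5) by linarith
    have "cmod (h (z - w) / w) \<le> B / cmod w" using assms(3) by
        (simp add: norm_divide divide_right_mono)
    also have "\<dots> \<le> 2 * B / cmod z"
    proof -
      have z: "0 < cmod z" using assms(4,5) by linarith
      have "B * cmod z \<le> B * (2 * cmod w)" using w B by (rule mult_left_mono)
      moreover have "0 < cmod w" using z w by linarith
      ultimately show ?thesis using z by (simp add: field_simps)
    qed
    finally show ?thesis using True by simp
  next
    case False
    then show ?thesis using supportedD[OF assms(2), of "z - w"] by (simp add: dist_norm)
  qed
  have fin: "emeasure lborel (cball z R) < \<infinity>" using assms(4) by (simp add: emeasure_cball)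
  have i: "integrable lborel (\<lambda>w. indicator (cball z R) w *\<^sub>R (2 * B / cmod z))"
    using fin by (intro integrable_scaleR_left integrable_real_indicator) auto
  have "cmod (\<integral>w. h (z - w) / w \<partial>lborel) \<le> (\<integral>w. indicator (cball z R) w *\<^sub>R (2 * B / cmod z)
      \<partial>lborel)"
    by (rule Bochner_Integration.integral_norm_bound_integral[OF cauchy_integrable[OF assms(1,2)] i
        le])
  also have "\<dots> = unit_ball_vol 2 * R\<^sup>2 * (2 * B / cmod z)"
    using assms(4) content_cball[of R z] by (simp add: measure_def)
  finally have "cmod (\<integral>w. h (z - w) / w \<partial>lborel) / kernel_mass
      \<le> unit_ball_vol 2 * R\<^sup>2 * (2 * B / cmod z) / kernel_mass"
    using kernel_mass_pos by (intro divide_right_mono) auto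
  then show ?thesis using kernel_mass_pos by (simp add: cauchy_transform_def norm_divide mult_ac)
qed

lemma cauchy_transform_add:
  assumes "continuous_on UNIV f" "supported R f" "continuous_on UNIV g" "supported R g"
  shows "cauchy_transform (\<lambda>z. f z + g z) z = cauchy_transform f z + cauchy_transform g z"
  unfolding cauchy_transform_def add_divide_distrib
  by (simp add: add_divide_distrib Bochner_Integration.integral_add[OF cauchy_integrable[OF
      assms(1,2)] cauchy_integrable[OF assms(3,4)]])

lemma cauchy_transform_cmult:
  "cauchy_transform (\<lambda>z. c * f z) z = c * cauchy_transform f z"
proof -
  have "(\<integral>w. c * f (z - w) / w \<partial>lborel) = (\<integral>w. c * (f (z - w) / w) \<partial>lborel)"
    by (simp only: times_divide_eq_right)
  also have "\<dots> = c * (\<integral>w. f (z - w) / w \<partial>lborel)" by (rule integral_mult_right_zero)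
  finally show ?thesis by (simp add: cauchy_transform_def)
qed

text \<open>The first partial derivatives are uniformly continuous because they have compact support; this makes
the remainder in the definition of the derivative uniform in the base point.\<close>

lemma uniform_taylor:
  assumes d: "\<And>z. h differentiable (at z)" and "continuous_on UNIV (partial_x h)"
      "continuous_on UNIV (partial_y h)"
    and supp: "supported R h" and e: "e > 0"
  obtains d where "d > 0"
    "\<And>p v. cmod v < d \<Longrightarrow> cmod (h (p + v) - h p - (Re v *\<^sub>R partial_x h p + Im v *\<^sub>R partial_y h p))
        \<le> e * cmod v"
proof -
  have e2: "e / 2 > 0" using e by simp
  obtain d1 where d1: "d1 > 0" "\<And>p q. dist p q < d1 \<Longrightarrow> dist (partial_x h p) (partial_x h q) < e / 2"
    using supported_uniformly_continuous[OF assms(2) supported_partial(1)[OF supp] e2] by blast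
  obtain d2 where d2: "d2 > 0" "\<And>p q. dist p q < d2 \<Longrightarrow> dist (partial_y h p) (partial_y h q) < e / 2"
    using supported_uniformly_continuous[OF assms(3) supported_partial(2)[OF supp] e2] by blast
  show ?thesis
  proof (rule that[of "min d1 d2"])
    fix p v :: complex assume v: "cmod v < min d1 d2"
    let ?D = "\<lambda>p v. Re v *\<^sub>R partial_x h p + Im v *\<^sub>R partial_y h p"
    define S where "S = ball p (min d1 d2)"
    have "cmod ((h (p + v) - ?D p (p + v)) - (h p - ?D p p)) \<le> e * cmod ((p + v) - p)"
    proof (rule differentiable_bound[where f="\<lambda>q. h q - ?D p q" and f'="\<lambda>q v. ?D q v - ?D p v"])
      show "convex S" "p + v \<in> S" "p \<in> S" using v d1(1) d2(1) by (auto simp: S_def dist_norm)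
      fix q assume q: "q \<in> S"
      show "((\<lambda>q. h q - ?D p q) has_derivative (\<lambda>v. ?D q v - ?D p v)) (at q within S)"
        by (rule has_derivative_at_withinI)
           (auto intro!: derivative_eq_intros has_derivative_partials[OF d])
      show "onorm (\<lambda>v. ?D q v - ?D p v) \<le> e"
      proof (rule onorm_le)
        fix v
        have "dist q p < d1" "dist q p < d2" using q by (auto simp: S_def dist_commute)
        note b = d1(2)[OF this(1)] d2(2)[OF this(2)]
        have "cmod (?D q v - ?D p v) = cmod (Re v *\<^sub>R (partial_x h q - partial_x h p)
            + Im v *\<^sub>R (partial_y h q - partial_y h p))"
          by (simp add: algebra_simps)
        also have "\<dots> \<le> \<bar>Re v\<bar> * cmod (partial_x h q - partial_x h p)
            + \<bar>Im v\<bar> * cmod (partial_y h q - partial_y h p)"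
          by (rule order_trans[OF norm_triangle_ineq]) simp
        also have "\<dots> \<le> cmod v * (e / 2) + cmod v * (e / 2)"
          using b e by (intro add_mono mult_mono abs_Re_le_cmod abs_Im_le_cmod)
              (auto simp: dist_norm)
        finally show "cmod (?D q v - ?D p v) \<le> e * cmod v" by simp
      qed
    qed
    then show "cmod (h (p + v) - h p - ?D p v) \<le> e * cmod v" by (simp add: algebra_simps)
  qed (use d1 d2 in auto)
qed

text \<open>The uniform first order expansion of \<open>h\<close> is integrated against \<open>1 / w\<close>. All the functions involved vanish
outside one fixed disc while the increment stays below 1, so the error is the uniform error times the
mass of \<open>1 / |w|\<close> on that disc.\<close>

lemma has_derivative_cauchy_transform:
  assumes d: "\<And>z. h differentiable (at z)" and cx: "continuous_on UNIV (partial_x h)" and cy: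
      "continuous_on UNIV (partial_y h)"
    and supp: "supported R h"
  shows "(cauchy_transform h has_derivative
     (\<lambda>v. Re v *\<^sub>R cauchy_transform (partial_x h) z + Im v *\<^sub>R cauchy_transform (partial_y h) z))
         (at z)"
  unfolding has_derivative_at_alt
proof (intro conjI allI impI)
  let ?D = "\<lambda>v. Re v *\<^sub>R cauchy_transform (partial_x h) z
      + Im v *\<^sub>R cauchy_transform (partial_y h) z"
  show "bounded_linear ?D"
    by (intro bounded_linear_add bounded_linear_scaleR_const bounded_linear_Re bounded_linear_Im)
  fix e :: real assume e: "e > 0"
  have c: "continuous_on UNIV h"
    by (intro continuous_at_imp_continuous_on ballI differentiable_imp_continuous_within d)
  note sx = supported_partial(1)[OF supp] and sy = supported_partial(2)[OF supp]
  \<comment> \<open>Adding 1 makes the constant positive, so that one may divide by it.\<close>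
  define A where "A = inverse_norm_mass (cmod z + 1 + R) / kernel_mass + 1"
  have A: "A > 0" using inverse_norm_mass_nonneg kernel_mass_pos by (simp add: A_def add_nonneg_pos)
  then have "e / A > 0" using e by simp
  then obtain \<delta> where \<delta>: "\<delta> > 0"
    "\<And>p v. cmod v < \<delta> \<Longrightarrow> cmod (h (p + v) - h p - (Re v *\<^sub>R partial_x h p + Im v *\<^sub>R partial_y h p))
        \<le> (e / A) * cmod v"
    using uniform_taylor[OF d cx cy supp, of "e / A"] by blast
  show "\<exists>d>0. \<forall>y. cmod (y - z) < d \<longrightarrow> cmod (cauchy_transform h y - cauchy_transform h z - ?D (y - z))
      \<le> e * cmod (y - z)"
  proof (intro exI[of _ "min \<delta> 1"] conjI allI impI)
    fix y assume y: "cmod (y - z) < min \<delta> 1"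
    define v where "v = y - z"
    define k where "k = (\<lambda>w. h (y - w) - h (z - w) - (Re v *\<^sub>R partial_x h (z - w)
        + Im v *\<^sub>R partial_y h (z - w)))"
    have "k w = h ((z - w) + v) - h (z - w) - (Re v *\<^sub>R partial_x h (z - w)
        + Im v *\<^sub>R partial_y h (z - w))" for w
      by (simp add: k_def v_def)
    then have kB: "cmod (k w) \<le> (e / A) * cmod v" for w using \<delta>(2)[of v "z - w"] y by
        (simp add: v_def)
    have kr: "k w = 0" if w: "cmod z + 1 + R < cmod w" for w
    proof -
      have "cmod y \<le> cmod z + 1" using y norm_triangle_sub[of y z] by simp
      then have "h (y - w) = 0" "h (z - w) = 0" "partial_x h (z - w) = 0" "partial_y h (z - w) = 0"
        using w by (intro supported_translate[OF supp] supported_translate[OF sx]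
            supported_translate[OF sy]; simp)+
      then show ?thesis by (simp add: k_def)
    qed
    have [measurable]: "k \<in> borel_measurable borel"
      unfolding k_def by (intro borel_measurable_diff borel_measurable_add borel_measurable_scaleR
          measurable_translate c cx cy) auto
    have "(\<integral>w. k w / w \<partial>lborel) = (\<integral>w. (h (y - w) / w - h (z - w) / w) - (Re v *\<^sub>R (partial_x h (z -
        w) / w) + Im v *\<^sub>R (partial_y h (z - w) / w)) \<partial>lborel)"
      by (intro Bochner_Integration.integral_cong) (auto simp: k_def diff_divide_distrib
          add_divide_distrib scaleR_conv_of_real)
    also have "\<dots> = ((\<integral>w. h (y - w) / w \<partial>lborel) - (\<integral>w. h (z - w) / w \<partial>lborel))
        - (Re v *\<^sub>R (\<integral>w. partial_x h (z - w) / w \<partial>lborel)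
            + Im v *\<^sub>R (\<integral>w. partial_y h (z - w) / w \<partial>lborel))"
      using cauchy_integrable[OF c supp] cauchy_integrable[OF cx sx] cauchy_integrable[OF cy sy]
      by simp
    finally have "cauchy_transform h y - cauchy_transform h z - ?D v
        = (\<integral>w. k w / w \<partial>lborel) / of_real kernel_mass"
      unfolding cauchy_transform_def by (simp add: diff_divide_distrib add_divide_distrib
          scaleR_conv_of_real)
    also have "cmod \<dots> \<le> (e / A) * cmod v * inverse_norm_mass (cmod z + 1 + R) / kernel_mass"
    proof -
      have "cmod (\<integral>w. k w / w \<partial>lborel) \<le> (e / A) * cmod v * inverse_norm_mass (cmod z + 1 + R)"
        by (rule integrable_div(2)[OF _ kB kr]) measurable
      from divide_right_mono[OF this, of kernel_mass] show ?thesis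
        using kernel_mass_pos by (simp add: norm_divide)
    qed
    also have "\<dots> = (e / A) * cmod v * (A - 1)" by (simp add: A_def)
    also have "\<dots> \<le> (e / A) * cmod v * A" using A e by (intro mult_left_mono) auto
    also have "\<dots> = e * cmod v" using A by simp
    finally show "cmod (cauchy_transform h y - cauchy_transform h z - ?D (y - z))
        \<le> e * cmod (y - z)"
      by (simp add: v_def)
  qed (use \<delta> in auto)
qed

lemma partial_cauchy_transform:
  assumes "C_infinity h" "supported R h"
  shows "cauchy_transform h differentiable (at z)"
    and "partial_x (cauchy_transform h) = cauchy_transform (partial_x h)"
    and "partial_y (cauchy_transform h) = cauchy_transform (partial_y h)"
proof -
  have D: "(cauchy_transform h has_derivative
     (\<lambda>v. Re v *\<^sub>R cauchy_transform (partial_x h) z + Im v *\<^sub>R cauchy_transform (partial_y h) z))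
         (at z)" for z
    using assms by (intro has_derivative_cauchy_transform C_infinityD) (auto intro: C_infinityD)
  show "cauchy_transform h differentiable (at z)" using D differentiable_def by blast
  show "partial_x (cauchy_transform h) = cauchy_transform (partial_x h)"
    "partial_y (cauchy_transform h) = cauchy_transform (partial_y h)"
    using partials_of_has_derivative[OF D] by auto
qed

lemma C_infinity_cauchy_transform:
  assumes "C_infinity h" "supported R h"
  shows "C_infinity (cauchy_transform h)"
proof -
  have "C_k k (cauchy_transform h)" if "C_infinity h" "supported R h" for k h
    using that
  proof (induction k arbitrary: h)
    case 0
    then have "continuous_on UNIV (cauchy_transform h)"
      by (intro continuous_at_imp_continuous_on ballI differentiable_imp_continuous_within
          partial_cauchy_transform)
    then show ?case by simp
  next
    case (Suc k)
    have "C_k k (cauchy_transform (partial_x h))" "C_k k (cauchy_transform (partial_y h))"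
      using Suc by (auto intro!: Suc.IH C_infinityD supported_partial)
    then show ?case unfolding C_k.simps using partial_cauchy_transform[OF Suc.prems] by simp
  qed
  then show ?thesis using assms by (simp add: C_infinity_def)
qed

lemma reg_kernel_partials:
  assumes "e > 0"
  shows "reg_kernel e differentiable (at w)"
    "partial_x (reg_kernel e) w = 1 / of_real ((Re w)\<^sup>2 + (Im w)\<^sup>2
        + e\<^sup>2) - cnj w * of_real (2 * Re w) / (of_real ((Re w)\<^sup>2 + (Im w)\<^sup>2 + e\<^sup>2))\<^sup>2"
    "partial_y (reg_kernel e) w = - \<i> / of_real ((Re w)\<^sup>2 + (Im w)\<^sup>2
        + e\<^sup>2) - cnj w * of_real (2 * Im w) / (of_real ((Re w)\<^sup>2 + (Im w)\<^sup>2 + e\<^sup>2))\<^sup>2"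
    "partial_zbar (reg_kernel e) w = of_real (reg_kernel_zbar e w)"
proof -
  define q where "q = (\<lambda>w. (Re w)\<^sup>2 + (Im w)\<^sup>2 + e\<^sup>2)"
  have q: "q w > 0" for w using assms by (simp add: q_def add_nonneg_pos)
  have D: "(reg_kernel e has_derivative (\<lambda>v. cnj v / of_real (q w) - cnj w * of_real (2 * Re w * Re
      v + 2 * Im w * Im v) / (of_real (q w))\<^sup>2)) (at w)"
  proof -
    have "(q has_derivative (\<lambda>v. 2 * Re w * Re v + 2 * Im w * Im v)) (at w)"
      unfolding q_def by (auto intro!: derivative_eq_intros simp: fun_eq_iff)
    then have dq: "((\<lambda>w. complex_of_real (q w)) has_derivative (\<lambda>v. of_real (2 * Re w * Re v
        + 2 * Im w * Im v))) (at w)"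
      by (rule has_derivative_of_real)
    have nz: "complex_of_real (q w) \<noteq> 0" using q[of w] by simp
    have "((\<lambda>w. cnj w / of_real (q w)) has_derivative (\<lambda>v. (cnj v * of_real (q w) - cnj w * of_real
        (2 * Re w * Re v + 2 * Im w * Im v))
        / (of_real (q w) * of_real (q w)))) (at w)"
      by (intro has_derivative_divide' dq nz derivative_intros has_derivative_ident)
    moreover have "(\<lambda>w. cnj w / of_real (q w)) = reg_kernel e" by (auto simp: reg_kernel_def q_def)
    moreover have "(\<lambda>v. (cnj v * of_real (q w) - cnj w * of_real (2 * Re w * Re v
        + 2 * Im w * Im v)) / (of_real (q w) * of_real (q w))) =
       (\<lambda>v. cnj v / of_real (q w) - cnj w * of_real (2 * Re w * Re v
           + 2 * Im w * Im v) / (of_real (q w))\<^sup>2)"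
      using nz by (simp only: diff_divide_distrib power2_eq_square) simp
    ultimately show ?thesis by simp
  qed
  show "reg_kernel e differentiable (at w)" using D differentiable_def by blast
  show X: "partial_x (reg_kernel e) w = 1 / of_real ((Re w)\<^sup>2 + (Im w)\<^sup>2
      + e\<^sup>2) - cnj w * of_real (2 * Re w) / (of_real ((Re w)\<^sup>2 + (Im w)\<^sup>2 + e\<^sup>2))\<^sup>2"
    using partials_of_has_derivative(1)[OF D] by (simp add: q_def)
  show Y: "partial_y (reg_kernel e) w = - \<i> / of_real ((Re w)\<^sup>2 + (Im w)\<^sup>2
      + e\<^sup>2) - cnj w * of_real (2 * Im w) / (of_real ((Re w)\<^sup>2 + (Im w)\<^sup>2 + e\<^sup>2))\<^sup>2"
    using partials_of_has_derivative(2)[OF D] by (simp add: q_def)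
  have nz: "complex_of_real (q w) \<noteq> 0" using q[of w] by simp
  have "partial_zbar (reg_kernel e) w = 1 / of_real (q w) - cnj w * (of_real (Re w)
      + \<i> * of_real (Im w)) / (of_real (q w))\<^sup>2"
  proof -
    define Q where "Q = complex_of_real (q w)"
    have XY: "partial_x (reg_kernel e) w = 1 / Q - cnj w * of_real (2 * Re w) / Q\<^sup>2"
      "partial_y (reg_kernel e) w = - \<i> / Q - cnj w * of_real (2 * Im w) / Q\<^sup>2"
      using X Y by (auto simp only: Q_def q_def)
    show ?thesis
      unfolding partial_zbar_def XY Q_def[symmetric]
      by (simp add: algebra_simps diff_divide_distrib add_divide_distrib)
  qed
  also have "of_real (Re w) + \<i> * of_real (Im w) = w" by (simp add: complex_eq_iff)
  also have "cnj w * w = of_real (q w - e\<^sup>2)"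
    by (simp add: q_def complex_norm_square[symmetric] mult.commute[of "cnj w"] cmod_power2)
  also have "1 / of_real (q w) - of_real (q w - e\<^sup>2) / (of_real (q w))\<^sup>2
      = complex_of_real (e\<^sup>2) / (of_real (q w))\<^sup>2"
    using nz by (simp add: field_simps power2_eq_square)
  finally show "partial_zbar (reg_kernel e) w = of_real (reg_kernel_zbar e w)"
    by (simp add: reg_kernel_zbar_def cmod_power2 q_def)
qed

lemma continuous_supported_integrable:
  fixes f :: "complex \<Rightarrow> complex"
  assumes "continuous_on UNIV f" "supported R f"
  shows "integrable lborel f"
proof -
  have "(\<lambda>z. indicator (cball 0 R) z *\<^sub>R f z) = f"
    using supportedD[OF assms(2)] by (auto simp: fun_eq_iff indicator_def not_le)
  then show ?thesis
    using borel_integrable_compact[of "cball 0 R" f] continuous_on_subset[OF assms(1)] by simp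
qed

text \<open>Integration by parts. The product of \<open>h (z - w)\<close> with the regularised kernel is of class \<open>C\<^sup>1\<close> with
compact support, so the integral of its \<open>\<partial>\<^sub>z\<^sub>'\<close> derivative vanishes.\<close>

lemma integral_reg_kernel_by_parts:
  assumes "C_infinity h" "supported R h" "e > 0"
  shows "(\<integral>w. partial_zbar h (z - w) * reg_kernel e w \<partial>lborel)
      = (\<integral>w. reg_kernel_zbar e w *\<^sub>R h (z - w) \<partial>lborel)"
proof -
  note hd = C_infinityD(1)[OF assms(1)] and hc = C_infinityD(2)[OF assms(1)]
  note hcx = C_infinityD(2)[OF C_infinityD(3)[OF assms(1)], of UNIV]
  note hcy = C_infinityD(2)[OF C_infinityD(4)[OF assms(1)], of UNIV]
  define G where "G = (\<lambda>w. h (z - w) * reg_kernel e w)"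
  have dh: "((\<lambda>w. h (z - w)) has_derivative (\<lambda>v. Re (- v) *\<^sub>R partial_x h (z - w)
      + Im (- v) *\<^sub>R partial_y h (z - w))) (at w)" for w
    by (rule has_derivative_compose[OF _ has_derivative_partials[OF hd]])
        (auto intro!: derivative_eq_intros)
  then have dh': "(\<lambda>w. h (z - w)) differentiable (at w)" for w using differentiable_def by blast
  have ph: "partial_x (\<lambda>w. h (z - w)) = (\<lambda>w. - partial_x h (z - w))" "partial_y (\<lambda>w. h (z - w))
      = (\<lambda>w. - partial_y h (z - w))"
    using partials_of_has_derivative[OF dh] by auto
  have nz: "(Re w)\<^sup>2 + (Im w)\<^sup>2 + e\<^sup>2 \<noteq> 0" for w using assms(3)
    by (metis add_nonneg_pos less_irrefl sum_power2_ge_zero zero_less_power)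
  then have nzc: "complex_of_real ((Re w)\<^sup>2 + (Im w)\<^sup>2 + e\<^sup>2) \<noteq> 0" for w
    by (metis of_real_eq_0_iff)
  have kc: "continuous_on UNIV (reg_kernel e)" "continuous_on UNIV (partial_x (reg_kernel e))"
     "continuous_on UNIV (partial_y (reg_kernel e))"
  proof -
    show "continuous_on UNIV (reg_kernel e)"
      unfolding reg_kernel_def using nzc by (intro continuous_intros) auto
    have "partial_x (reg_kernel e) = (\<lambda>w. 1 / of_real ((Re w)\<^sup>2 + (Im w)\<^sup>2
        + e\<^sup>2) - cnj w * of_real (2 * Re w) / (of_real ((Re w)\<^sup>2 + (Im w)\<^sup>2 + e\<^sup>2))\<^sup>2)"
      using reg_kernel_partials(2)[OF assms(3)] by auto
    then show "continuous_on UNIV (partial_x (reg_kernel e))"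
      using nzc by (simp only:) (intro continuous_intros; simp)
    have "partial_y (reg_kernel e) = (\<lambda>w. - \<i> / of_real ((Re w)\<^sup>2 + (Im w)\<^sup>2
        + e\<^sup>2) - cnj w * of_real (2 * Im w) / (of_real ((Re w)\<^sup>2 + (Im w)\<^sup>2 + e\<^sup>2))\<^sup>2)"
      using reg_kernel_partials(3)[OF assms(3)] by auto
    then show "continuous_on UNIV (partial_y (reg_kernel e))"
      using nzc by (simp only:) (intro continuous_intros; simp)
  qed
  have pG: "partial_x G = (\<lambda>w. h (z - w) * partial_x (reg_kernel e) w - partial_x h (z - w) *
      reg_kernel e w)"
    "partial_y G = (\<lambda>w. h (z - w) * partial_y (reg_kernel e) w - partial_y h (z - w) * reg_kernel e
        w)"
    unfolding G_def using partial_mult[OF dh' reg_kernel_partials(1)[OF assms(3)]] by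
        (auto simp: ph)
  have dG: "G differentiable (at w)" for w
    unfolding G_def by (intro differentiable_mult dh' reg_kernel_partials assms)
  have G0: "supported (cmod z + R) G"
    using supported_translate[OF assms(2)] by (auto simp: supported_def G_def)
  have tr: "continuous_on UNIV (\<lambda>w. h (z - w))" "continuous_on UNIV (\<lambda>w. partial_x h (z - w))"
    "continuous_on UNIV (\<lambda>w. partial_y h (z - w))"
    by (auto intro!: continuous_on_compose2[OF hc[of UNIV]] continuous_on_compose2[OF hcx]
        continuous_on_compose2[OF hcy] continuous_intros)
  have cG: "continuous_on UNIV (partial_x G)" "continuous_on UNIV (partial_y G)"
    unfolding pG by (intro continuous_intros kc tr)+
  have iG: "integrable lborel (partial_x G)" "integrable lborel (partial_y G)"
    using continuous_supported_integrable cG supported_partial[OF G0] by auto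
  have "0 = (\<integral>w. 1/2 * (partial_x G w + \<i> * partial_y G w) \<partial>lborel)"
    using iG integral_partial_eq_0[OF dG supportedD[OF G0]] cG by simp
  also have "\<dots> = (\<integral>w. reg_kernel_zbar e w *\<^sub>R h (z - w) - partial_zbar h (z - w) * reg_kernel e w
      \<partial>lborel)"
  proof (intro Bochner_Integration.integral_cong refl)
    fix w
    have "1/2 * (partial_x G w + \<i> * partial_y G w) = h (z - w) * partial_zbar (reg_kernel e) w -
        partial_zbar h (z - w) * reg_kernel e w"
      unfolding pG partial_zbar_def by (simp add: algebra_simps)
    then show "1/2 * (partial_x G w + \<i> * partial_y G w)
        = reg_kernel_zbar e w *\<^sub>R h (z - w) - partial_zbar h (z - w) * reg_kernel e w"
      unfolding reg_kernel_partials(4)[OF assms(3)] by (simp add: scaleR_conv_of_real)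
  qed
  also have "\<dots> = (\<integral>w. reg_kernel_zbar e w *\<^sub>R h (z - w) \<partial>lborel) - (\<integral>w. partial_zbar h (z - w) *
      reg_kernel e w \<partial>lborel)"
  proof (intro Bochner_Integration.integral_diff)
    have "continuous_on UNIV (reg_kernel_zbar e)"
      unfolding reg_kernel_zbar_def using nz by (intro continuous_intros) (simp add: cmod_power2)
    then show "integrable lborel (\<lambda>w. reg_kernel_zbar e w *\<^sub>R h (z - w))"
      using supported_translate[OF assms(2)]
      by (intro continuous_supported_integrable[where R="cmod z + R"] continuous_on_scaleR tr)
          (auto simp: supported_def)
    have "continuous_on UNIV (\<lambda>w. partial_zbar h (z - w))"
      unfolding partial_zbar_def by (intro continuous_intros tr)
    then show "integrable lborel (\<lambda>w. partial_zbar h (z - w) * reg_kernel e w)"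
      using supported_translate[OF supported_partial(4)[OF assms(2)]]
      by (intro continuous_supported_integrable[where R="cmod z + R"] continuous_on_mult kc)
          (auto simp: supported_def)
  qed
  finally show ?thesis by simp
qed

text \<open>The Cauchy-Pompeiu formula. Regularise the kernel, move \<open>\<partial>\<^sub>z\<^sub>'\<close> from \<open>h\<close> to the kernel, and let \<open>e\<close> tend
to 0: the left side converges to the Cauchy transform by domination with \<open>1 / |w|\<close>, while on the right
the approximate identity produces \<open>h z\<close>.\<close>

lemma cauchy_transform_partial_zbar:
  assumes "C_infinity h" "supported R h"
  shows "cauchy_transform (partial_zbar h) z = h z"
proof -
  note hc = C_infinityD(2)[OF assms(1)]
  define e :: "nat \<Rightarrow> real" where "e n = inverse (real (Suc n))" for n
  have e0: "e n > 0" for n by (simp add: e_def)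
  have elim: "e \<longlonglongrightarrow> 0" unfolding e_def by (rule LIMSEQ_inverse_real_of_nat)
  have cz: "continuous_on UNIV (partial_zbar h)"
    unfolding partial_zbar_def using C_infinityD assms(1)
        by (intro continuous_intros C_infinityD) auto
  have [measurable]: "(\<lambda>w. partial_zbar h (z - w)) \<in> borel_measurable borel"
      "(\<lambda>w. h (z - w)) \<in> borel_measurable borel"
    "reg_kernel e \<in> borel_measurable borel" "reg_kernel_zbar e \<in> borel_measurable borel" for e
  proof -
    have [measurable]: "cnj \<in> borel_measurable borel"
      by (intro borel_measurable_continuous_onI continuous_intros)
    show "reg_kernel e \<in> borel_measurable borel" "reg_kernel_zbar e \<in> borel_measurable borel"
      unfolding reg_kernel_def reg_kernel_zbar_def by measurable
  qed (use measurable_translate[OF cz] measurable_translate[OF hc] in auto)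
  have 1: "(\<lambda>n. \<integral>w. partial_zbar h (z - w) * reg_kernel (e n) w \<partial>lborel) \<longlonglongrightarrow> (\<integral>w. partial_zbar h (z -
      w) / w \<partial>lborel)"
  proof (rule integral_dominated_convergence)
    show "integrable lborel (\<lambda>w. norm (partial_zbar h (z - w) / w))"
      using cauchy_integrable[OF cz supported_partial(4)[OF assms(2)]] by (rule integrable_norm)
    show "AE w in lborel. (\<lambda>n. partial_zbar h (z - w) * reg_kernel (e n) w) \<longlonglongrightarrow> partial_zbar h (z - w)
        / w"
    proof (intro AE_I2)
      fix w
      show "(\<lambda>n. partial_zbar h (z - w) * reg_kernel (e n) w) \<longlonglongrightarrow> partial_zbar h (z - w) / w"
      proof (cases "w = 0")
        case False
        then have nz: "(Re w)\<^sup>2 + (Im w)\<^sup>2 \<noteq> 0" by (simp add: complex_eq_iff sum_power2_eq_zero_iff)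
        have "(\<lambda>n. partial_zbar h (z - w) * (cnj w / of_real ((Re w)\<^sup>2 + (Im w)\<^sup>2 + (e n)\<^sup>2))) \<longlonglongrightarrow>
          partial_zbar h (z - w) * (cnj w / of_real ((Re w)\<^sup>2 + (Im w)\<^sup>2 + 0\<^sup>2))"
          using nz by (intro tendsto_intros elim) (simp del: of_real_add)
        also have "cnj w / of_real ((Re w)\<^sup>2 + (Im w)\<^sup>2 + 0\<^sup>2) = 1 / w"
        proof -
          have "complex_of_real ((Re w)\<^sup>2 + (Im w)\<^sup>2 + 0\<^sup>2) = of_real ((cmod w)\<^sup>2)"
            by (simp only: cmod_power2 zero_power2 add_0_right)
          also have "\<dots> = w * cnj w" using complex_norm_square[of w] by simp
          finally show ?thesis using False by simp
        qed
        finally show ?thesis by (simp add: reg_kernel_def)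
      qed (simp add: reg_kernel_def)
    qed
    show "AE w in lborel. norm (partial_zbar h (z - w) * reg_kernel (e n) w)
        \<le> norm (partial_zbar h (z - w) / w)" for n
    proof (intro AE_I2)
      fix w
      have "cmod (reg_kernel (e n) w) \<le> 1 / cmod w"
      proof (cases "w = 0")
        case False
        have "cmod (reg_kernel (e n) w) = cmod w / ((cmod w)\<^sup>2 + (e n)\<^sup>2)"
          unfolding reg_kernel_def norm_divide norm_of_real by (simp add: cmod_power2)
        also have "\<dots> \<le> cmod w / (cmod w)\<^sup>2"
          using False by (intro divide_left_mono) (auto simp: add_pos_nonneg)
        finally show ?thesis using False by (simp add: power2_eq_square)
      qed (simp add: reg_kernel_def)
      from mult_left_mono[OF this norm_ge_zero[of "partial_zbar h (z - w)"]]
      show "norm (partial_zbar h (z - w) * reg_kernel (e n) w) \<le> norm (partial_zbar h (z - w) / w)"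
        by (simp add: norm_mult norm_divide)
    qed
  qed measurable
  obtain B where B: "\<And>z. cmod (h z) \<le> B" using supported_bounded[OF hc assms(2)] by blast
  have 2: "(\<lambda>n. \<integral>v. reg_kernel_zbar 1 v *\<^sub>R h (z - e n *\<^sub>R v) \<partial>lborel) \<longlonglongrightarrow> (\<integral>v. reg_kernel_zbar 1 v
      *\<^sub>R h z \<partial>lborel)"
  proof (rule integral_dominated_convergence)
    show "integrable lborel (\<lambda>v. B * reg_kernel_zbar 1 v)"
      by (intro integrable_mult_right integrable_reg_kernel_zbar)
    show "AE v in lborel. (\<lambda>n. reg_kernel_zbar 1 v *\<^sub>R h (z - e n *\<^sub>R v)) \<longlonglongrightarrow> reg_kernel_zbar 1 v *\<^sub>R
        h z"
    proof (intro AE_I2 tendsto_intros)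
      fix v
      have "(\<lambda>n. z - e n *\<^sub>R v) \<longlonglongrightarrow> z - 0 *\<^sub>R v" by (intro tendsto_intros elim)
      then have "(\<lambda>n. z - e n *\<^sub>R v) \<longlonglongrightarrow> z" by simp
      moreover have "isCont h z" using hc[of UNIV] continuous_on_eq_continuous_at[of UNIV h] by auto
      ultimately show "(\<lambda>n. h (z - e n *\<^sub>R v)) \<longlonglongrightarrow> h z" by (rule isCont_tendsto_compose[rotated])
    qed
    show "AE v in lborel. norm (reg_kernel_zbar 1 v *\<^sub>R h (z - e n *\<^sub>R v))
        \<le> B * reg_kernel_zbar 1 v" for n
    proof (intro AE_I2)
      fix v
      have "reg_kernel_zbar 1 v \<ge> 0" by (simp add: reg_kernel_zbar_def)
      then show "norm (reg_kernel_zbar 1 v *\<^sub>R h (z - e n *\<^sub>R v)) \<le> B * reg_kernel_zbar 1 v"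
        using mult_left_mono[OF B, of "reg_kernel_zbar 1 v" "z - e n *\<^sub>R v"] by
            (simp add: mult.commute)
    qed
    have "(\<lambda>v. h (z - e n *\<^sub>R v)) \<in> borel_measurable borel" for n
      by (intro borel_measurable_continuous_onI continuous_on_compose2[OF hc] continuous_intros)
          auto
    then show "(\<lambda>v. reg_kernel_zbar 1 v *\<^sub>R h (z - e n *\<^sub>R v)) \<in> borel_measurable lborel" for n
      by (intro borel_measurable_scaleR) auto
  qed measurable
  have "(\<integral>w. partial_zbar h (z - w) * reg_kernel (e n) w \<partial>lborel)
      = (\<integral>v. reg_kernel_zbar 1 v *\<^sub>R h (z - e n *\<^sub>R v) \<partial>lborel)" for n
    using integral_reg_kernel_by_parts[OF assms e0] integral_reg_kernel_zbar_scale[OF _ e0, of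
        "\<lambda>w. h (z - w)"] by simp
  with 1 2 have "(\<integral>w. partial_zbar h (z - w) / w \<partial>lborel)
      = (\<integral>v. reg_kernel_zbar 1 v *\<^sub>R h z \<partial>lborel)"
    using LIMSEQ_unique by auto
  also have "\<dots> = of_real kernel_mass * h z"
    using integrable_reg_kernel_zbar by (simp add: kernel_mass_def scaleR_conv_of_real)
  finally show ?thesis using kernel_mass_pos by (simp add: cauchy_transform_def)
qed

lemma partial_zbar_cauchy_transform:
  assumes h: "C_infinity h" "supported R h"
  shows "partial_zbar (cauchy_transform h) = h"
proof
  fix z
  note hx = C_infinityD(3)[OF h(1)] and hy = C_infinityD(4)[OF h(1)]
  note s = supported_partial(1)[OF h(2)] supported_partial(2)[OF h(2)]
  have ch: "continuous_on UNIV (partial_x h)" "continuous_on UNIV (partial_y h)"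
    by (intro C_infinityD(2) hx hy)+
  have "cauchy_transform (partial_zbar h) z = cauchy_transform (\<lambda>z. 1/2 * (partial_x h z
      + \<i> * partial_y h z)) z"
    by (simp add: partial_zbar_def[abs_def])
  also have "\<dots> = 1/2 * (cauchy_transform (partial_x h) z + \<i> * cauchy_transform (partial_y h) z)"
    unfolding cauchy_transform_cmult
    using s(2) by (subst cauchy_transform_add[OF ch(1) s(1)])
        (auto intro!: continuous_intros ch simp: supported_def cauchy_transform_cmult)
  finally have "partial_zbar (cauchy_transform h) z = cauchy_transform (partial_zbar h) z"
    unfolding partial_zbar_def partial_cauchy_transform(2,3)[OF h] by simp
  then show "partial_zbar (cauchy_transform h) z = h z" using cauchy_transform_partial_zbar[OF h]
      by simp
qed

section \<open>Energy, a Sobolev inequality and the Beurling transform\<close>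

text \<open>The squared \<open>L\<^sup>2\<close> norm. As a nonnegative integral with extended values it is meaningful for functions not
yet known to be square integrable, such as Beurling transforms.\<close>

definition energy :: "(complex \<Rightarrow> complex) \<Rightarrow> ennreal" where
  "energy f = (\<integral>\<^sup>+z. ennreal ((cmod (f z))\<^sup>2) \<partial>lborel)"

text \<open>Integrate the derivative of \<open>(t - b + 1) |u t|\<^sup>2\<close> over \<open>[b - 1, b]\<close>. The weight vanishes at the left end point
and is 1 at the right one, and it is at most 1 in between.\<close>

lemma sobolev_line:
  fixes u u' :: "real \<Rightarrow> complex"
  assumes d: "\<And>t. (u has_vector_derivative u' t) (at t)" and c': "continuous_on UNIV u'"
  shows "ennreal ((cmod (u b))\<^sup>2) \<le> (\<integral>\<^sup>+t. (2 * ennreal ((cmod (u t))\<^sup>2)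
      + ennreal ((cmod (u' t))\<^sup>2)) \<partial>lborel)"
proof -
  have c: "continuous_on UNIV u"
    using d by (meson continuous_at_imp_continuous_on has_vector_derivative_continuous)
  define F where "F = (\<lambda>t. (t - b + 1) * (u t \<bullet> u t))"
  define F' where "F' = (\<lambda>t. (t - b + 1) * (2 * (u t \<bullet> u' t)) + (u t \<bullet> u t))"
  define g where "g = (\<lambda>t. 2 * (cmod (u t))\<^sup>2 + (cmod (u' t))\<^sup>2)"
  have F: "(F has_vector_derivative F' t) (at t within S)" for t S
  proof -
    have "((\<lambda>t. u t \<bullet> u t) has_derivative (\<lambda>h. u t \<bullet> (h *\<^sub>R u' t) + (h *\<^sub>R u' t) \<bullet> u t)) (at t)"
      using d[of t] by (intro has_derivative_inner) (auto simp: has_vector_derivative_def)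
    then have "((\<lambda>t. u t \<bullet> u t) has_real_derivative (2 * (u t \<bullet> u' t))) (at t)"
      by (simp add: has_field_derivative_def inner_commute mult.commute mult_ac algebra_simps)
        (auto elim!: has_derivative_eq_rhs simp: inner_commute fun_eq_iff)
    then have "(F has_real_derivative F' t) (at t)"
      unfolding F_def F'_def by (auto intro!: derivative_eq_intros)
    then show ?thesis
      by (auto simp: has_real_derivative_iff_has_vector_derivative[symmetric] intro: DERIV_subset)
  qed
  have I1: "(F' has_integral (F b - F (b - 1))) {b-1..b}"
    by (rule fundamental_theorem_of_calculus) (auto intro: F)
  have "continuous_on {b-1..b} g"
    unfolding g_def by (intro continuous_intros continuous_on_subset[OF c] continuous_on_subset[OF
        c']) auto
  then have "g integrable_on {b-1..b}" by (rule integrable_continuous_interval)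
  then obtain I where I2: "(g has_integral I) {b-1..b}" by (auto simp: integrable_on_def)
  have "(cmod (u b))\<^sup>2 = F b - F (b - 1)" by (simp add: F_def power2_norm_eq_inner)
  also have "\<dots> \<le> I"
  proof (rule has_integral_le[OF I1 I2])
    fix t assume t: "t \<in> {b-1..b}"
    have "u t \<bullet> u' t \<le> cmod (u t) * cmod (u' t)" by (rule norm_cauchy_schwarz)
    moreover have "2 * (cmod (u t) * cmod (u' t)) \<le> (cmod (u t))\<^sup>2 + (cmod (u' t))\<^sup>2"
      using sum_squares_bound[of "cmod (u t)" "cmod (u' t)"] by simp
    ultimately have *: "2 * (u t \<bullet> u' t) \<le> (cmod (u t))\<^sup>2 + (cmod (u' t))\<^sup>2" by linarith
    have "(t - b + 1) * (2 * (u t \<bullet> u' t)) \<le> (t - b + 1) * ((cmod (u t))\<^sup>2 + (cmod (u' t))\<^sup>2)"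
      using t by (intro mult_left_mono *) auto
    also have "\<dots> \<le> 1 * ((cmod (u t))\<^sup>2 + (cmod (u' t))\<^sup>2)"
      using t by (intro mult_right_mono) auto
    finally show "F' t \<le> g t" by (simp add: F'_def g_def power2_norm_eq_inner)
  qed
  finally have "ennreal ((cmod (u b))\<^sup>2) \<le> ennreal I" by (rule ennreal_leI)
  also have "ennreal I = (\<integral>\<^sup>+t. ennreal (indicator {b-1..b} t * g t) \<partial>lborel)"
    by (rule nn_integral_has_integral_lebesgue[symmetric, OF _ I2]) (simp add: g_def)
  also have "\<dots> \<le> (\<integral>\<^sup>+t. (2 * ennreal ((cmod (u t))\<^sup>2) + ennreal ((cmod (u' t))\<^sup>2)) \<partial>lborel)"
  proof (rule nn_integral_mono)
    fix t
    have "ennreal (indicator {b-1..b} t * g t) \<le> ennreal (g t)"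
      by (intro ennreal_leI) (auto simp: indicator_def g_def)
    also have "\<dots> = 2 * ennreal ((cmod (u t))\<^sup>2) + ennreal ((cmod (u' t))\<^sup>2)"
      by (simp add: g_def ennreal_plus ennreal_mult)
    finally show "ennreal (indicator {b-1..b} t * g t) \<le> 2 * ennreal ((cmod (u t))\<^sup>2)
        + ennreal ((cmod (u' t))\<^sup>2)" .
  qed
  finally show ?thesis .
qed

lemma C_infinity_measurable:
  assumes "C_infinity f" shows "f \<in> borel_measurable borel"
  by (intro borel_measurable_continuous_onI C_infinityD assms)

text \<open>The inequality on the line, first in \<open>x\<close> and then in \<open>y\<close>. The second application is made to \<open>f\<close> and to
\<open>\<partial>\<^sub>x f\<close>, and therefore the mixed derivative is the only one of order two that appears.\<close>

lemma sobolev_plane: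
  assumes f: "C_infinity f"
  shows "ennreal ((cmod (f z))\<^sup>2) \<le> 4 * energy f + 2 * energy (partial_y f)
      + 2 * energy (partial_x f) + energy (partial_y (partial_x f))"
proof -
  obtain x0 y0 where z: "z = Complex x0 y0" by (cases z)
  note fx = C_infinityD(3)[OF f] and fy = C_infinityD(4)[OF f]
  note fyx = C_infinityD(4)[OF fx]
  have [measurable]: "f \<in> borel_measurable borel" "partial_x f \<in> borel_measurable borel"
    "partial_y f \<in> borel_measurable borel" "partial_y (partial_x f) \<in> borel_measurable borel"
    using C_infinity_measurable f fx fy fyx by auto
  have vert: "ennreal ((cmod (g (Complex s y0)))\<^sup>2) \<le>
      (\<integral>\<^sup>+t. (2 * ennreal ((cmod (g (Complex s t)))\<^sup>2) + ennreal ((cmod (partial_y g (Complex s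
          t)))\<^sup>2)) \<partial>lborel)"
    if "C_infinity g" for g s
    by (rule sobolev_line) (auto intro!: has_vector_derivative_vertical C_infinityD(1)[OF that]
        continuous_on_compose2[OF C_infinityD(2)[OF C_infinityD(4)[OF that], of UNIV]]
            continuous_intros)
  have "ennreal ((cmod (f z))\<^sup>2) \<le>
      (\<integral>\<^sup>+s. (2 * ennreal ((cmod (f (Complex s y0)))\<^sup>2) + ennreal ((cmod (partial_x f (Complex s
          y0)))\<^sup>2)) \<partial>lborel)"
    unfolding z
    by (rule sobolev_line) (auto intro!: has_vector_derivative_horizontal C_infinityD(1)[OF f]
        continuous_on_compose2[OF C_infinityD(2)[OF fx, of UNIV]] continuous_intros)
  also have "\<dots> \<le> (\<integral>\<^sup>+s. (2 * (\<integral>\<^sup>+t. (2 * ennreal ((cmod (f (Complex s t)))\<^sup>2)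
      + ennreal ((cmod (partial_y f (Complex s t)))\<^sup>2)) \<partial>lborel)
      + (\<integral>\<^sup>+t. (2 * ennreal ((cmod (partial_x f (Complex s t)))\<^sup>2)
          + ennreal ((cmod (partial_y (partial_x f) (Complex s t)))\<^sup>2)) \<partial>lborel)) \<partial>lborel)"
    by (intro nn_integral_mono add_mono mult_left_mono vert f fx) auto
  also have "\<dots> = 2 * (2 * energy f + energy (partial_y f)) + (2 * energy (partial_x f)
      + energy (partial_y (partial_x f)))"
    unfolding energy_def nn_integral_complex(1)[of "\<lambda>z. ennreal ((cmod (f z))\<^sup>2)", simplified]
      nn_integral_complex(1)[of "\<lambda>z. ennreal ((cmod (partial_x f z))\<^sup>2)", simplified]
      nn_integral_complex(1)[of "\<lambda>z. ennreal ((cmod (partial_y f z))\<^sup>2)", simplified]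
      nn_integral_complex(1)[of "\<lambda>z. ennreal ((cmod (partial_y (partial_x f) z))\<^sup>2)", simplified]
    by (simp add: nn_integral_add nn_integral_cmult)
  also have "\<dots> = 4 * energy f + 2 * energy (partial_y f) + 2 * energy (partial_x f)
      + energy (partial_y (partial_x f))"
    by (simp add: distrib_left add_ac mult.assoc[symmetric])
  finally show ?thesis .
qed

text \<open>On functions \<open>\<partial>\<^sub>z\<^sub>' f\<close> with \<open>f\<close> a test function this is the operator \<open>\<partial>\<^sub>z\<^sub>' f \<mapsto> \<partial>\<^sub>z f\<close>.\<close>

definition beurling :: "(complex \<Rightarrow> complex) \<Rightarrow> complex \<Rightarrow> complex" where
  "beurling h = partial_z (cauchy_transform h)"

lemma partial_cnj:
  assumes "f differentiable (at z)"
  shows "(\<lambda>z. cnj (f z)) differentiable (at z)"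
    "partial_x (\<lambda>z. cnj (f z)) z = cnj (partial_x f z)"
    "partial_y (\<lambda>z. cnj (f z)) z = cnj (partial_y f z)"
proof -
  have D: "((\<lambda>z. cnj (f z)) has_derivative (\<lambda>v. cnj (Re v *\<^sub>R partial_x f z
      + Im v *\<^sub>R partial_y f z))) (at z)"
    by (rule has_derivative_cnj[OF has_derivative_partials[OF assms]])
  show "(\<lambda>z. cnj (f z)) differentiable (at z)" using D differentiable_def by blast
  show "partial_x (\<lambda>z. cnj (f z)) z = cnj (partial_x f z)" "partial_y (\<lambda>z. cnj (f z)) z
      = cnj (partial_y f z)"
    using partials_of_has_derivative[OF D] by auto
qed

text \<open>The difference \<open>|f\<^sub>z|\<^sup>2 - |f\<^sub>z\<^sub>'|\<^sup>2\<close> is the Jacobian determinant of \<open>f\<close>. It is the divergence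
\<open>(\<partial>\<^sub>x P - \<partial>\<^sub>y Q) / 2 i\<close> with \<open>P = cnj f \<partial>\<^sub>y f\<close> and \<open>Q = cnj f \<partial>\<^sub>x f\<close>, where the second derivatives of \<open>f\<close>
cancel. So its integral over a square is controlled by the values of \<open>f\<close> and its first derivatives
near the boundary.\<close>

lemma norm_diff_energy_square:
  assumes f: "C_infinity f" and R: "R > 0"
    and K: "\<And>z. R \<le> cmod z \<Longrightarrow> cmod (f z) \<le> K" "\<And>z. R \<le> cmod z \<Longrightarrow> cmod (partial_x f z) \<le> K"
      "\<And>z. R \<le> cmod z \<Longrightarrow> cmod (partial_y f z) \<le> K"
  shows "(\<integral>z. indicator (square R) z *\<^sub>R (cmod (partial_z f z))\<^sup>2 \<partial>lborel) \<le>
    (\<integral>z. indicator (square R) z *\<^sub>R (cmod (partial_zbar f z))\<^sup>2 \<partial>lborel) + 4 * R * K\<^sup>2"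
proof -
  note fx = C_infinityD(3)[OF f] and fy = C_infinityD(4)[OF f]
  note d = C_infinityD(1)[OF f] C_infinityD(1)[OF fx] C_infinityD(1)[OF fy]
  note c = C_infinityD(2)[OF f] C_infinityD(2)[OF fx] C_infinityD(2)[OF fy]
  note fyx = C_infinityD(4)[OF fx]
  have comm: "partial_x (partial_y f) = partial_y (partial_x f)"
    by (rule partial_x_partial_y_commute) (rule C_infinity_imp_C_k[OF f])
  have K0: "K \<ge> 0" using K(1)[of "of_real R"] R by (auto intro: order_trans[OF norm_ge_zero])
  define P where "P = (\<lambda>z. cnj (f z) * partial_y f z)"
  define Q where "Q = (\<lambda>z. cnj (f z) * partial_x f z)"
  have dP: "P differentiable (at z)" and dQ: "Q differentiable (at z)" for z
    unfolding P_def Q_def by (auto intro!: differentiable_mult partial_cnj d)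
  have Px: "partial_x P = (\<lambda>z. cnj (f z) * partial_y (partial_x f) z
      + cnj (partial_x f z) * partial_y f z)"
    unfolding P_def using partial_mult(1)[OF partial_cnj(1)[OF d(1)] d(3)] partial_cnj[OF d(1)] comm
        by auto
  have Qy: "partial_y Q = (\<lambda>z. cnj (f z) * partial_y (partial_x f) z
      + cnj (partial_y f z) * partial_x f z)"
    unfolding Q_def using partial_mult(2)[OF partial_cnj(1)[OF d(1)] d(2)] partial_cnj[OF d(1)]
        by auto
  have cP: "continuous_on UNIV (partial_x P)" and cQ: "continuous_on UNIV (partial_y Q)"
    unfolding Px Qy by (intro continuous_intros c C_infinityD(2)[OF fyx])+
  have PB: "cmod (P z) \<le> K\<^sup>2" and QB: "cmod (Q z) \<le> K\<^sup>2" if "R \<le> cmod z" for z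
    using K(1)[OF that] K(2)[OF that] K(3)[OF that] K0
    by (auto simp: P_def Q_def norm_mult power2_eq_square intro!: mult_mono)
  have cz: "continuous_on UNIV (\<lambda>z. (cmod (partial_z f z))\<^sup>2)"
      "continuous_on UNIV (\<lambda>z. (cmod (partial_zbar f z))\<^sup>2)"
    unfolding partial_z_def partial_zbar_def by (intro continuous_intros c)+
  have key: "complex_of_real ((cmod (partial_z f z))\<^sup>2) = of_real ((cmod (partial_zbar f z))\<^sup>2)
      + (- \<i> / 2) * (partial_x P z - partial_y Q z)" for z
    unfolding complex_norm_square partial_z_def partial_zbar_def Px Qy
    by (simp add: field_simps complex_eq_iff)
  have iz: "integrable lborel (\<lambda>z. indicator (square R) z *\<^sub>R complex_of_real ((cmod (partial_z f
      z))\<^sup>2))"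
    "integrable lborel (\<lambda>z. indicator (square R) z *\<^sub>R complex_of_real ((cmod (partial_zbar f
        z))\<^sup>2))"
    by (intro integrable_square continuous_on_of_real cz)+
  note iP = integrable_square[OF cP] and iQ = integrable_square[OF cQ]
  define A where "A = (\<integral>z. indicator (square R) z *\<^sub>R (cmod (partial_z f z))\<^sup>2 \<partial>lborel)"
  define B where "B = (\<integral>z. indicator (square R) z *\<^sub>R (cmod (partial_zbar f z))\<^sup>2 \<partial>lborel)"
  have "complex_of_real A = (\<integral>z. indicator (square R) z *\<^sub>R complex_of_real ((cmod (partial_z f
      z))\<^sup>2) \<partial>lborel)"
    unfolding A_def by (subst integral_complex_of_real[symmetric])
        (auto intro!: Bochner_Integration.integral_cong simp: scaleR_conv_of_real)
  also have "\<dots> = (\<integral>z. indicator (square R) z *\<^sub>R complex_of_real ((cmod (partial_zbar f z))\<^sup>2)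
       + (- \<i> / 2) * (indicator (square R) z *\<^sub>R partial_x P z - indicator (square R) z *\<^sub>R
           partial_y Q z) \<partial>lborel)"
    unfolding key by (intro Bochner_Integration.integral_cong)
        (auto simp: algebra_simps indicator_def)
  also have "\<dots> = (\<integral>z. indicator (square R) z *\<^sub>R complex_of_real ((cmod (partial_zbar f z))\<^sup>2)
      \<partial>lborel)
       + (- \<i> / 2) * ((\<integral>z. indicator (square R) z *\<^sub>R partial_x P z \<partial>lborel) - (\<integral>z. indicator
           (square R) z *\<^sub>R partial_y Q z \<partial>lborel))"
    by (subst Bochner_Integration.integral_add[OF iz(2)])
        (use iP iQ in \<open>auto simp del: of_real_power\<close>)
  also have "(\<integral>z. indicator (square R) z *\<^sub>R complex_of_real ((cmod (partial_zbar f z))\<^sup>2) \<partial>lborel)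
      = of_real B"
    unfolding B_def by (subst integral_complex_of_real[symmetric])
        (auto intro!: Bochner_Integration.integral_cong simp: scaleR_conv_of_real)
  finally have "complex_of_real (A - B) = (- \<i> / 2) * ((\<integral>z. indicator (square R) z *\<^sub>R partial_x P z
      \<partial>lborel) - (\<integral>z. indicator (square R) z *\<^sub>R partial_y Q z \<partial>lborel))"
    by simp
  then have "cmod (complex_of_real (A - B)) = cmod (- \<i> / 2) * cmod ((\<integral>z. indicator (square R) z *\<^sub>R
      partial_x P z \<partial>lborel) - (\<integral>z. indicator (square R) z *\<^sub>R partial_y Q z \<partial>lborel))"
    by (simp only: norm_mult)
  also have "\<dots> \<le> cmod (- \<i> / 2) * (4 * R * K\<^sup>2 + 4 * R * K\<^sup>2)"
    using R by (intro mult_left_mono order_trans[OF norm_triangle_ineq4] add_mono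
        norm_integral_square_partial_x[OF dP cP PB] norm_integral_square_partial_y[OF dQ cQ QB])
            auto
  finally have "\<bar>A - B\<bar> \<le> 4 * R * K\<^sup>2"
    by (simp only: norm_of_real) (simp add: norm_divide)
  then show ?thesis unfolding A_def[symmetric] B_def[symmetric] by linarith
qed

text \<open>The Cauchy transform and its first derivatives are \<open>O(1 / |z|)\<close>, so on the square of half side \<open>r\<close> the
boundary term comparing the energies of \<open>f\<^sub>z\<close> and \<open>f\<^sub>z\<^sub>' = h\<close> is \<open>O(1 / r)\<close>. Monotone
convergence then also yields square integrability of \<open>f\<^sub>z\<close>.\<close>

lemma energy_beurling_le:
  assumes h: "C_infinity h" "supported R h"
  shows "energy (beurling h) \<le> energy h"
proof -
  define f where "f = cauchy_transform h"
  have f: "C_infinity f" unfolding f_def by (rule C_infinity_cauchy_transform[OF h])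
  note hx = C_infinityD(3)[OF h(1)] and hy = C_infinityD(4)[OF h(1)]
  note s = h(2) supported_partial(1)[OF h(2)] supported_partial(2)[OF h(2)]
  define R0 where "R0 = max R 1"
  have s0: "supported R0 h" "supported R0 (partial_x h)" "supported R0 (partial_y h)" and R0:
      "R0 > 0"
    using s by (auto simp: supported_def R0_def)
  have ch: "continuous_on UNIV h" "continuous_on UNIV (partial_x h)"
      "continuous_on UNIV (partial_y h)"
    by (intro C_infinityD(2) h hx hy)+
  have "\<exists>K\<ge>0. \<forall>z. 2 * R0 \<le> cmod z \<longrightarrow> cmod (cauchy_transform g z) \<le> K / cmod z"
    if g: "continuous_on UNIV g" "supported R0 g" for g
  proof -
    obtain B where B: "B \<ge> 0" "\<And>z. cmod (g z) \<le> B" using supported_bounded[OF g] by blast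
    show ?thesis
      using cauchy_transform_decay[OF g B(2) R0] B(1) kernel_mass_pos R0
      by (intro exI[of _ "B * (2 * (unit_ball_vol 2 * R0\<^sup>2) / kernel_mass)"]) auto
  qed
  from this[OF ch(1) s0(1)] this[OF ch(2) s0(2)] this[OF ch(3) s0(3)] obtain K1 K2 K3 where
    K: "K1 \<ge> 0" "K2 \<ge> 0" "K3 \<ge> 0"
      "\<And>z. 2 * R0 \<le> cmod z \<Longrightarrow> cmod (f z) \<le> K1 / cmod z"
      "\<And>z. 2 * R0 \<le> cmod z \<Longrightarrow> cmod (partial_x f z) \<le> K2 / cmod z"
      "\<And>z. 2 * R0 \<le> cmod z \<Longrightarrow> cmod (partial_y f z) \<le> K3 / cmod z"
    unfolding f_def partial_cauchy_transform(2,3)[OF h] by blast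
  define K where "K = K1 + K2 + K3"
  have zbar: "partial_zbar f = h"
    unfolding f_def by (rule partial_zbar_cauchy_transform[OF h])
  define I where "I r = (\<integral>\<^sup>+z. ennreal ((cmod (partial_z f z))\<^sup>2) * indicator (square r) z \<partial>lborel)"
      for r
  have cz: "continuous_on UNIV (partial_z f)" unfolding partial_z_def
    by (intro continuous_intros C_infinityD(2) C_infinityD(3,4) f)
  have [measurable]: "partial_z f \<in> borel_measurable borel" "h \<in> borel_measurable borel"
    using cz ch borel_measurable_continuous_onI by auto
  have nn: "(\<integral>\<^sup>+z. ennreal ((cmod (g z))\<^sup>2) * indicator (square r) z \<partial>lborel) =
      ennreal (\<integral>z. indicator (square r) z *\<^sub>R (cmod (g z))\<^sup>2 \<partial>lborel)" if
          "continuous_on UNIV g" for g r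
  proof -
    have "(\<integral>\<^sup>+z. ennreal ((cmod (g z))\<^sup>2) * indicator (square r) z \<partial>lborel) =
       (\<integral>\<^sup>+z. ennreal (indicator (square r) z *\<^sub>R (cmod (g z))\<^sup>2) \<partial>lborel)"
      by (intro nn_integral_cong) (auto simp: indicator_def)
    also have "\<dots> = ennreal (\<integral>z. indicator (square r) z *\<^sub>R (cmod (g z))\<^sup>2 \<partial>lborel)"
      using that by (intro nn_integral_eq_integral integrable_square continuous_intros) auto
    finally show ?thesis .
  qed
  have step: "I r \<le> energy h + ennreal (4 * K\<^sup>2 / r)" if r: "2 * R0 \<le> r" for r
  proof -
    have r0: "r > 0" using R0 r by simp
    have b: "cmod (f z) \<le> K / r" "cmod (partial_x f z) \<le> K / r" "cmod (partial_y f z) \<le> K / r" if z: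
        "r \<le> cmod z" for z
    proof -
      have z': "2 * R0 \<le> cmod z" using r z by simp
      have le: "a / cmod z \<le> K / r" if "a \<le> K" "a \<ge> 0" for a
        using that z r0 by (intro frac_le) auto
      show "cmod (f z) \<le> K / r" "cmod (partial_x f z) \<le> K / r" "cmod (partial_y f z) \<le> K / r"
        using K(4)[OF z'] K(5)[OF z'] K(6)[OF z'] le[of K1] le[of K2] le[of K3] K(1-3) by
            (auto simp: K_def)
    qed
    have "I r = ennreal (\<integral>z. indicator (square r) z *\<^sub>R (cmod (partial_z f z))\<^sup>2 \<partial>lborel)"
      unfolding I_def by (rule nn[OF cz])
    also have "\<dots> \<le> ennreal ((\<integral>z. indicator (square r) z *\<^sub>R (cmod (partial_zbar f z))\<^sup>2 \<partial>lborel)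
        + 4 * r * (K / r)\<^sup>2)"
      by (intro ennreal_leI norm_diff_energy_square f r0 b)
    also have "\<dots> = ennreal (\<integral>z. indicator (square r) z *\<^sub>R (cmod (h z))\<^sup>2 \<partial>lborel)
        + ennreal (4 * K\<^sup>2 / r)"
      unfolding zbar using r0 by (subst ennreal_plus) (auto simp: power2_eq_square)
    also have "ennreal (\<integral>z. indicator (square r) z *\<^sub>R (cmod (h z))\<^sup>2 \<partial>lborel) =
        (\<integral>\<^sup>+z. ennreal ((cmod (h z))\<^sup>2) * indicator (square r) z \<partial>lborel)"
      by (rule nn[OF ch(1), symmetric])
    also have "\<dots> \<le> energy h"
      unfolding energy_def by (intro nn_integral_mono) (auto simp: indicator_def)
    finally show ?thesis by simp
  qed
  have mono: "I r \<le> I r'" if "r \<le> r'" for r r'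
    unfolding I_def using that by (intro nn_integral_mono) (auto simp: indicator_def mem_square)
  have I_le: "I r \<le> energy h" for r
  proof (rule ennreal_le_epsilon)
    fix e :: real assume e: "e > 0"
    define r' where "r' = max r (max (2 * R0) (4 * K\<^sup>2 / e))"
    have r': "r' > 0" using R0 by (simp add: r'_def)
    have "4 * K\<^sup>2 / e \<le> r'" by (simp add: r'_def)
    then have "4 * K\<^sup>2 / r' \<le> e" using r' e by (simp add: field_simps)
    then have "energy h + ennreal (4 * K\<^sup>2 / r') \<le> energy h + ennreal e"
        by (intro add_left_mono ennreal_leI)
    moreover have "I r \<le> I r'" by (rule mono) (simp add: r'_def)
    moreover have "I r' \<le> energy h + ennreal (4 * K\<^sup>2 / r')" by (rule step) (simp add: r'_def)
    ultimately show "I r \<le> energy h + ennreal e" by order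
  qed
  have "energy (partial_z f) = (\<integral>\<^sup>+z. (SUP n::nat. ennreal ((cmod (partial_z f z))\<^sup>2) * indicator
      (square (real n)) z) \<partial>lborel)"
    unfolding energy_def
  proof (rule nn_integral_cong)
    fix z
    obtain n where n: "cmod z \<le> real n" using real_arch_simple by blast
    then have "z \<in> square (real n)" using abs_Re_le_cmod[of z] abs_Im_le_cmod[of z] by
        (simp add: mem_square)
    then have "ennreal ((cmod (partial_z f z))\<^sup>2) \<le> (SUP n::nat. ennreal ((cmod (partial_z f z))\<^sup>2)
        * indicator (square (real n)) z)"
      by (intro SUP_upper2[of n]) auto
    then show "ennreal ((cmod (partial_z f z))\<^sup>2) = (SUP n::nat. ennreal ((cmod (partial_z f z))\<^sup>2)
        * indicator (square (real n)) z)"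
      by (rule antisym[OF _ SUP_least]) (simp split: split_indicator)
  qed
  also have "\<dots> = (SUP n::nat. I (real n))"
    unfolding I_def
    by (rule nn_integral_monotone_convergence_SUP)
      (auto simp: incseq_def le_fun_def indicator_def mem_square)
  also have "\<dots> \<le> energy h" by (intro SUP_least I_le)
  finally show ?thesis by (simp add: beurling_def f_def)
qed

section \<open>The Neumann series\<close>

text \<open>The Beurling transform is a convolution, so it commutes with derivatives; this is what makes the energy
estimate available for derivatives of all orders.\<close>

lemma
  assumes "C_infinity h" "supported R h"
  shows C_infinity_beurling: "C_infinity (beurling h)"
    and partial_x_beurling: "partial_x (beurling h) = beurling (partial_x h)"
    and partial_y_beurling: "partial_y (beurling h) = beurling (partial_y h)"
  using C_infinity_cauchy_transform[OF assms] partial_partial_z[OF C_infinity_cauchy_transform[OF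
      assms]]
    partial_cauchy_transform(2,3)[OF assms]
  by (auto simp: beurling_def intro: C_infinity_partial_z)

lemma energy_mult_le:
  assumes [measurable]: "f \<in> borel_measurable borel" and M: "\<And>z. cmod (m z) \<le> M"
  shows "energy (\<lambda>z. m z * f z) \<le> ennreal (M\<^sup>2) * energy f"
proof -
  have "energy (\<lambda>z. m z * f z) \<le> (\<integral>\<^sup>+z. ennreal (M\<^sup>2) * ennreal ((cmod (f z))\<^sup>2) \<partial>lborel)"
    unfolding energy_def
  proof (rule nn_integral_mono)
    fix z
    have "(cmod (m z * f z))\<^sup>2 \<le> M\<^sup>2 * (cmod (f z))\<^sup>2"
      using M[of z] by (simp add: norm_mult power_mult_distrib mult_right_mono power_mono)
    then show "ennreal ((cmod (m z * f z))\<^sup>2) \<le> ennreal (M\<^sup>2) * ennreal ((cmod (f z))\<^sup>2)"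
      by (subst ennreal_mult[symmetric]) (auto intro: ennreal_leI)
  qed
  also have "\<dots> = ennreal (M\<^sup>2) * energy f"
    unfolding energy_def by (rule nn_integral_cmult) auto
  finally show ?thesis .
qed

text \<open>Young's inequality. The factor \<open>1 + \<delta>\<close> can be kept so close to 1 that a contraction constant below 1
survives the splitting of a square.\<close>

lemma norm_add_power2_le:
  fixes a b :: complex
  assumes "\<delta> > 0"
  shows "(cmod (a + b))\<^sup>2 \<le> (1 + \<delta>) * (cmod a)\<^sup>2 + (1 + 1 / \<delta>) * (cmod b)\<^sup>2"
proof -
  have "(cmod (a + b))\<^sup>2 \<le> (cmod a + cmod b)\<^sup>2" by (intro power_mono norm_triangle_ineq) auto
  also have "\<dots> = (cmod a)\<^sup>2 + (cmod b)\<^sup>2 + 2 * (sqrt \<delta> * cmod a) * (cmod b / sqrt \<delta>)"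
    using assms by (simp add: power2_sum)
  also have "\<dots> \<le> (cmod a)\<^sup>2 + (cmod b)\<^sup>2 + ((sqrt \<delta> * cmod a)\<^sup>2 + (cmod b / sqrt \<delta>)\<^sup>2)"
    by (intro add_left_mono sum_squares_bound)
  also have "\<dots> = (1 + \<delta>) * (cmod a)\<^sup>2 + (1 + 1 / \<delta>) * (cmod b)\<^sup>2"
    using assms by (simp add: power_mult_distrib power_divide algebra_simps)
  finally show ?thesis .
qed

lemma energy_add_le:
  assumes [measurable]: "f \<in> borel_measurable borel" "g \<in> borel_measurable borel" and \<delta>: "\<delta> > 0"
  shows "energy (\<lambda>z. f z + g z) \<le> ennreal (1 + \<delta>) * energy f + ennreal (1 + 1 / \<delta>) * energy g"
proof -
  have "energy (\<lambda>z. f z + g z) \<le> (\<integral>\<^sup>+z. ennreal (1 + \<delta>) * ennreal ((cmod (f z))\<^sup>2) + ennreal (1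
      + 1 / \<delta>) * ennreal ((cmod (g z))\<^sup>2) \<partial>lborel)"
    unfolding energy_def
  proof (rule nn_integral_mono)
    fix z
    have "ennreal ((cmod (f z + g z))\<^sup>2) \<le> ennreal ((1 + \<delta>) * (cmod (f z))\<^sup>2 + (1
        + 1 / \<delta>) * (cmod (g z))\<^sup>2)"
      by (intro ennreal_leI norm_add_power2_le \<delta>)
    also have "\<dots> = ennreal (1 + \<delta>) * ennreal ((cmod (f z))\<^sup>2) + ennreal (1
        + 1 / \<delta>) * ennreal ((cmod (g z))\<^sup>2)"
      using \<delta> by (simp add: ennreal_plus ennreal_mult)
    finally show "ennreal ((cmod (f z + g z))\<^sup>2) \<le> ennreal (1 + \<delta>) * ennreal ((cmod (f z))\<^sup>2)
        + ennreal (1 + 1 / \<delta>) * ennreal ((cmod (g z))\<^sup>2)" .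
  qed
  also have "\<dots> = ennreal (1 + \<delta>) * energy f + ennreal (1 + 1 / \<delta>) * energy g"
    unfolding energy_def by (simp add: nn_integral_add nn_integral_cmult)
  finally show ?thesis .
qed

lemma energy_finite:
  assumes "continuous_on UNIV f" "supported R f"
  shows "energy f < \<infinity>"
proof -
  have "integrable lborel (\<lambda>z. f z * cnj (f z))"
    using assms by (intro continuous_supported_integrable[where R=R] continuous_intros)
        (auto simp: supported_def)
  then have "(\<integral>\<^sup>+z. ennreal (norm (f z * cnj (f z))) \<partial>lborel) < \<infinity>"
    by (simp add: integrable_iff_bounded)
  then show ?thesis by (simp add: energy_def norm_mult power2_eq_square)
qed

definition geometrically_bounded :: "(nat \<Rightarrow> ennreal) \<Rightarrow> bool" where
  "geometrically_bounded u \<longleftrightarrow> (\<exists>B s. 0 \<le> B \<and> 0 < s \<and> s < 1 \<and> (\<forall>n. u n \<le> ennreal (B * s ^ n)))"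

lemma geometrically_bounded_cmult_le:
  assumes "geometrically_bounded u" "\<And>n. v n \<le> ennreal C * u n" "C \<ge> 0"
  shows "geometrically_bounded v"
proof -
  obtain B s where B: "0 \<le> B" "0 < s" "s < 1" "\<And>n. u n \<le> ennreal (B * s ^ n)"
      using assms(1) unfolding geometrically_bounded_def by blast
  have "v n \<le> ennreal (C * B * s ^ n)" for n
  proof -
    have "v n \<le> ennreal C * ennreal (B * s ^ n)"
      by (rule order_trans[OF assms(2) mult_left_mono[OF B(4)]]) simp
    also have "\<dots> = ennreal (C * B * s ^ n)" using B assms(3) by
        (simp add: ennreal_mult[symmetric] mult.assoc)
    finally show ?thesis .
  qed
  then show ?thesis unfolding geometrically_bounded_def using B assms(3) by (intro exI[of _
      "C * B"] exI[of _ s]) auto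
qed

lemma geometrically_bounded_add:
  assumes "geometrically_bounded u" "geometrically_bounded v"
  shows "geometrically_bounded (\<lambda>n. u n + v n)"
proof -
  obtain B s where B: "0 \<le> B" "0 < s" "s < 1" "\<And>n. u n \<le> ennreal (B * s ^ n)"
      using assms(1) unfolding geometrically_bounded_def by blast
  obtain C t where C: "0 \<le> C" "0 < t" "t < 1" "\<And>n. v n \<le> ennreal (C * t ^ n)"
      using assms(2) unfolding geometrically_bounded_def by blast
  have "u n + v n \<le> ennreal ((B + C) * (max s t) ^ n)" for n
  proof -
    have "u n + v n \<le> ennreal (B * s ^ n) + ennreal (C * t ^ n)" by (intro add_mono B C)
    also have "\<dots> = ennreal (B * s ^ n + C * t ^ n)" using B C by (subst ennreal_plus) auto
    also have "\<dots> \<le> ennreal (B * max s t ^ n + C * max s t ^ n)"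
      using B C by (intro ennreal_leI add_mono mult_left_mono power_mono) auto
    finally show ?thesis by (simp add: algebra_simps)
  qed
  then show ?thesis unfolding geometrically_bounded_def using B C by (intro exI[of _ "B
      + C"] exI[of _ "max s t"]) auto
qed

text \<open>A linear recursion with factor \<open>q < 1\<close> and a geometrically small perturbation: the solution decays with
any ratio \<open>t\<close> above \<open>q\<close> that is no smaller than the ratio of the perturbation.\<close>

lemma geometrically_bounded_recursion:
  assumes u0: "u 0 < \<infinity>" and step: "\<And>n. u (Suc n) \<le> ennreal q * u n + v n"
    and q: "0 \<le> q" "q < 1" and v: "geometrically_bounded v"
  shows "geometrically_bounded u"
proof -
  obtain B s where B: "0 \<le> B" "0 < s" "s < 1" "\<And>n. v n \<le> ennreal (B * s ^ n)"
      using v unfolding geometrically_bounded_def by blast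
  define t where "t = max s ((1 + q) / 2)"
  have t: "0 < t" "t < 1" "q < t" "s \<le> t" using B q by (auto simp: t_def less_max_iff_disj)
  \<comment> \<open>The choice \<open>B \<le> D (t - q)\<close> makes \<open>q D t\<^sup>n + B t\<^sup>n \<le> D t\<^sup>n\<^sup>+\<^sup>1\<close>.\<close>
  define D where "D = max (enn2real (u 0)) (B / (t - q))"
  have D: "D \<ge> 0" "enn2real (u 0) \<le> D" "B \<le> D * (t - q)"
    using t by (auto simp: D_def pos_divide_le_eq[symmetric] le_max_iff_disj)
  have "u n \<le> ennreal (D * t ^ n)" for n
  proof (induction n)
    case 0
    have "u 0 = ennreal (enn2real (u 0))" using u0 by (simp add: less_top)
    also have "\<dots> \<le> ennreal D" by (intro ennreal_leI D)
    finally show ?case by simp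
  next
    case (Suc n)
    have "u (Suc n) \<le> ennreal q * ennreal (D * t ^ n) + ennreal (B * s ^ n)"
      by (rule order_trans[OF step]) (intro add_mono mult_left_mono Suc B(4); simp)
    also have "\<dots> = ennreal (q * (D * t ^ n) + B * s ^ n)"
      using q D(1) t B by (simp add: ennreal_mult ennreal_plus)
    also have "\<dots> \<le> ennreal (q * (D * t ^ n) + D * (t - q) * t ^ n)"
      using B t D by (intro ennreal_leI add_left_mono mult_mono power_mono) auto
    also have "q * (D * t ^ n) + D * (t - q) * t ^ n = D * t ^ Suc n"
      by (simp add: algebra_simps)
    finally show ?case .
  qed
  then show ?thesis unfolding geometrically_bounded_def using D t
      by (intro exI[of _ D] exI[of _ t]) auto
qed

lemma geometrically_bounded_sup_bound:
  assumes "geometrically_bounded u" "\<And>n z. ennreal ((cmod (f n z))\<^sup>2) \<le> u n"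
  shows "\<exists>B r. 0 \<le> B \<and> 0 < r \<and> r < 1 \<and> (\<forall>n z. cmod (f n z) \<le> B * r ^ n)"
proof -
  obtain B s where B: "0 \<le> B" "0 < s" "s < 1" "\<And>n. u n \<le> ennreal (B * s ^ n)"
      using assms(1) unfolding geometrically_bounded_def by blast
  have "cmod (f n z) \<le> sqrt B * sqrt s ^ n" for n z
  proof -
    have "ennreal ((cmod (f n z))\<^sup>2) \<le> ennreal (B * s ^ n)" by (rule order_trans[OF assms(2) B(4)])
    then have "(cmod (f n z))\<^sup>2 \<le> B * s ^ n" using B by (subst (asm) ennreal_le_iff) auto
    then have "cmod (f n z) \<le> sqrt (B * s ^ n)" by (rule real_le_rsqrt)
    then show ?thesis by (simp add: real_sqrt_mult real_sqrt_power)
  qed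
  then show ?thesis using B by (intro exI[of _ "sqrt B"] exI[of _ "sqrt s"]) auto
qed

text \<open>The operator \<open>u \<mapsto> \<mu> S u\<close> contracts the energy by \<open>k\<^sup>2\<close>. The energy of a sum is split so unevenly that the
factor of the first summand stays below 1; the large factor falls on the perturbation, which is
geometrically small.\<close>

lemma perturbed_contraction_geometric:
  assumes \<mu>: "\<And>z. cmod (\<mu> z) \<le> k" "k < 1" "continuous_on UNIV \<mu>"
    and u: "\<And>n. C_infinity (u n)" "\<And>n. supported R (u n)"
    and step: "\<And>n. u (Suc n) = (\<lambda>z. \<mu> z * beurling (u n) z + e n z)"
    and e: "\<And>n. e n \<in> borel_measurable borel" "geometrically_bounded (\<lambda>n. energy (e n))"
  shows "geometrically_bounded (\<lambda>n. energy (u n))"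
proof -
  have k0: "0 \<le> k" using \<mu>(1)[of 0] norm_ge_zero order_trans by blast
  have k1: "k\<^sup>2 < 1" using k0 \<mu>(2) by (simp add: power_less_one_iff)
  \<comment> \<open>With this \<open>\<delta>\<close> the product \<open>(1 + \<delta>) k\<^sup>2\<close> is still below 1.\<close>
  define \<delta> where "\<delta> = (1 - k\<^sup>2) / 2"
  have \<delta>: "\<delta> > 0" using k1 by (simp add: \<delta>_def)
  define q where "q = (1 + \<delta>) * k\<^sup>2"
  have q: "0 \<le> q" "q < 1"
  proof -
    show "0 \<le> q" using \<delta> by (simp add: q_def)
    have "\<delta> * k\<^sup>2 \<le> \<delta>" using \<delta> k1 by (simp add: mult_left_le)
    then show "q < 1" using k1 by (simp add: q_def \<delta>_def field_simps)
  qed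
  have mb: "beurling (u n) \<in> borel_measurable borel" for n
    by (rule C_infinity_measurable[OF C_infinity_beurling[OF u]])
  have mm: "(\<lambda>z. \<mu> z * beurling (u n) z) \<in> borel_measurable borel" for n
    using borel_measurable_continuous_onI[OF \<mu>(3)] mb by measurable
  show ?thesis
  proof (rule geometrically_bounded_recursion[OF _ _ q])
    show "energy (u 0) < \<infinity>" by (rule energy_finite[OF C_infinityD(2)[OF u(1)] u(2)])
    show "geometrically_bounded (\<lambda>n. ennreal (1 + 1 / \<delta>) * energy (e n))"
      using \<delta> by (intro geometrically_bounded_cmult_le[OF e(2), of _ "1 + 1 / \<delta>"]) auto
    fix n
    have "energy (u (Suc n)) \<le> ennreal (1 + \<delta>) * energy (\<lambda>z. \<mu> z * beurling (u n) z) + ennreal (1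
        + 1 / \<delta>) * energy (e n)"
      unfolding step by (intro energy_add_le mm e \<delta>)
    also have "\<dots> \<le> ennreal (1 + \<delta>) * (ennreal (k\<^sup>2) * energy (u n)) + ennreal (1
        + 1 / \<delta>) * energy (e n)"
    proof -
      have "energy (\<lambda>z. \<mu> z * beurling (u n) z) \<le> ennreal (k\<^sup>2) * energy (u n)"
        by (rule order_trans[OF energy_mult_le[OF mb \<mu>(1)] mult_left_mono[OF energy_beurling_le[OF
            u]]]) simp
      then show ?thesis by (intro add_right_mono mult_left_mono) auto
    qed
    also have "ennreal (1 + \<delta>) * (ennreal (k\<^sup>2) * energy (u n)) = ennreal q * energy (u n)"
      using \<delta> by (simp add: q_def ennreal_mult mult.assoc)
    finally show "energy (u (Suc n)) \<le> ennreal q * energy (u n) + ennreal (1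
        + 1 / \<delta>) * energy (e n)" .
  qed
qed

lemma supported_mult: "supported R f \<Longrightarrow> supported R (\<lambda>z. f z * g z)"
  by (simp add: supported_def)

lemma geometrically_bounded_energy_multiple:
  assumes "C_infinity m" "supported R m" "\<And>n. C_infinity (u n)" "\<And>n. supported R (u n)"
    and "geometrically_bounded (\<lambda>n. energy (u n))"
  shows "geometrically_bounded (\<lambda>n. energy (\<lambda>z. m z * beurling (u n) z))"
    and "(\<lambda>z. m z * beurling (u n) z) \<in> borel_measurable borel"
proof -
  obtain M where M: "M \<ge> 0" "\<And>z. cmod (m z) \<le> M" using supported_bounded[OF C_infinityD(2)[OF
      assms(1)] assms(2)] by blast
  note b = C_infinity_beurling[OF assms(3,4)]
  show "geometrically_bounded (\<lambda>n. energy (\<lambda>z. m z * beurling (u n) z))"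
  proof (rule geometrically_bounded_cmult_le[OF assms(5)])
    show "energy (\<lambda>z. m z * beurling (u n) z) \<le> ennreal (M\<^sup>2) * energy (u n)" for n
      by (intro order_trans[OF energy_mult_le[OF C_infinity_measurable[OF b] M(2)]] mult_left_mono
          energy_beurling_le[OF assms(3,4)]) auto
  qed simp
  show "(\<lambda>z. m z * beurling (u n) z) \<in> borel_measurable borel"
    by (intro C_infinity_measurable C_infinity_mult assms b)
qed

lemma geometrically_bounded_energy_add:
  assumes "\<And>n. f n \<in> borel_measurable borel" "\<And>n. g n \<in> borel_measurable borel"
    "geometrically_bounded (\<lambda>n. energy (f n))" "geometrically_bounded (\<lambda>n. energy (g n))"
  shows "geometrically_bounded (\<lambda>n. energy (\<lambda>z. f n z + g n z))"
proof (rule geometrically_bounded_cmult_le[OF geometrically_bounded_add[OF assms(3,4)]])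
  show "energy (\<lambda>z. f n z + g n z) \<le> ennreal 2 * (energy (f n) + energy (g n))" for n
    using energy_add_le[OF assms(1,2), of 1 n n] by (simp add: distrib_left)
qed simp

text \<open>The terms of the series for \<open>g = \<mu> S g + \<nu>\<close>.\<close>

primrec neumann :: "(complex \<Rightarrow> complex) \<Rightarrow> (complex \<Rightarrow> complex) \<Rightarrow> nat \<Rightarrow> complex \<Rightarrow> complex" where
  "neumann \<mu> \<nu> 0 = \<nu>"
| "neumann \<mu> \<nu> (Suc n) = (\<lambda>z. \<mu> z * beurling (neumann \<mu> \<nu> n) z)"

context
  fixes \<mu> \<nu> :: "complex \<Rightarrow> complex" and R k :: real
  assumes \<mu>: "C_infinity \<mu>" "supported R \<mu>" and \<nu>: "C_infinity \<nu>" "supported R \<nu>"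
    and k: "\<And>z. cmod (\<mu> z) \<le> k" "k < 1"
begin

lemma neumann_smooth: "C_infinity (neumann \<mu> \<nu> n)" and neumann_supported:
    "supported R (neumann \<mu> \<nu> n)"
proof -
  have "C_infinity (neumann \<mu> \<nu> n) \<and> supported R (neumann \<mu> \<nu> n)"
    by (induction n) (auto intro!: \<mu> \<nu> C_infinity_mult supported_mult C_infinity_beurling)
  then show "C_infinity (neumann \<mu> \<nu> n)" "supported R (neumann \<mu> \<nu> n)" by auto
qed

text \<open>By Leibniz' rule and because \<open>S\<close> commutes with derivatives, \<open>\<partial> (\<mu> S g) = \<mu> S (\<partial> g) + (\<partial> \<mu>) S g\<close>. The first
summand is the contraction again; the second one is geometrically small once the derivatives of lower
order have been treated. So the four statements are proved one after the other, in order of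
differentiation.\<close>

lemma neumann_energy_geometric:
  shows "geometrically_bounded (\<lambda>n. energy (neumann \<mu> \<nu> n))"
    and "geometrically_bounded (\<lambda>n. energy (partial_x (neumann \<mu> \<nu> n)))"
    and "geometrically_bounded (\<lambda>n. energy (partial_y (neumann \<mu> \<nu> n)))"
    and "geometrically_bounded (\<lambda>n. energy (partial_y (partial_x (neumann \<mu> \<nu> n))))"
proof -
  define g where "g = neumann \<mu> \<nu>"
  have Suc_g: "g (Suc n) = (\<lambda>z. \<mu> z * beurling (g n) z)" for n by (simp add: g_def)
  have g: "C_infinity (g n)" "supported R (g n)" for n by
      (auto simp: g_def neumann_smooth neumann_supported)
  note gx = C_infinityD(3)[OF g(1)] supported_partial(1)[OF g(2)]
  note gy = C_infinityD(4)[OF g(1)] supported_partial(2)[OF g(2)]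
  note gyx = C_infinityD(4)[OF gx(1)] supported_partial(2)[OF gx(2)]
  note \<mu>x = C_infinityD(3)[OF \<mu>(1)] supported_partial(1)[OF \<mu>(2)]
  note \<mu>y = C_infinityD(4)[OF \<mu>(1)] supported_partial(2)[OF \<mu>(2)]
  note \<mu>yx = C_infinityD(4)[OF \<mu>x(1)] supported_partial(2)[OF \<mu>x(2)]
  note contr = perturbed_contraction_geometric[OF k C_infinityD(2)[OF \<mu>(1)]]
  have B: "beurling f differentiable (at z)" if "C_infinity f" "supported R f" for f z
    using C_infinityD(1)[OF C_infinity_beurling[OF that]] .
  have zero: "geometrically_bounded (\<lambda>n. energy (\<lambda>z. 0))"
    unfolding geometrically_bounded_def energy_def by (intro exI[of _ 0] exI[of _ "1/2"]) auto
  have G: "geometrically_bounded (\<lambda>n. energy (g n))"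
    by (rule contr[where e="\<lambda>n z. 0", OF g]) (simp_all add: Suc_g zero)
  note e1 = geometrically_bounded_energy_multiple[OF \<mu>x g G]
  have Sx: "partial_x (g (Suc n)) = (\<lambda>z. \<mu> z * beurling (partial_x (g n)) z
      + partial_x \<mu> z * beurling (g n) z)" for n
    unfolding Suc_g using partial_mult(1)[OF C_infinityD(1)[OF \<mu>(1)] B[OF g]] partial_x_beurling[OF
        g] by auto
  have Gx: "geometrically_bounded (\<lambda>n. energy (partial_x (g n)))"
    by (rule contr[OF gx Sx e1(2) e1(1)])
  note e2 = geometrically_bounded_energy_multiple[OF \<mu>y g G]
  have Sy: "partial_y (g (Suc n)) = (\<lambda>z. \<mu> z * beurling (partial_y (g n)) z
      + partial_y \<mu> z * beurling (g n) z)" for n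
    unfolding Suc_g using partial_mult(2)[OF C_infinityD(1)[OF \<mu>(1)] B[OF g]] partial_y_beurling[OF
        g] by auto
  have Gy: "geometrically_bounded (\<lambda>n. energy (partial_y (g n)))"
    by (rule contr[OF gy Sy e2(2) e2(1)])
  have Syx: "partial_y (partial_x (g (Suc n))) = (\<lambda>z. \<mu> z * beurling (partial_y (partial_x (g n))) z
      +
     (partial_y \<mu> z * beurling (partial_x (g n)) z +
      (partial_x \<mu> z * beurling (partial_y (g n)) z + partial_y (partial_x \<mu>) z * beurling (g n)
          z)))" for n
  proof
    fix z
    have d: "(\<lambda>z. \<mu> z * beurling (partial_x (g n)) z) differentiable (at z)"
        "(\<lambda>z. partial_x \<mu> z * beurling (g n) z) differentiable (at z)"
      by (intro differentiable_mult C_infinityD(1) \<mu> \<mu>x B g gx)+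
    show "partial_y (partial_x (g (Suc n))) z = \<mu> z * beurling (partial_y (partial_x (g n))) z +
     (partial_y \<mu> z * beurling (partial_x (g n)) z +
      (partial_x \<mu> z * beurling (partial_y (g n)) z + partial_y (partial_x \<mu>) z * beurling (g n)
          z))"
      unfolding Sx partial_add(2)[OF d] partial_mult(2)[OF C_infinityD(1)[OF \<mu>(1)] B[OF gx]]
        partial_mult(2)[OF C_infinityD(1)[OF \<mu>x(1)] B[OF g]] partial_y_beurling[OF g]
            partial_y_beurling[OF gx]
      by simp
  qed
  note e3 = geometrically_bounded_energy_multiple[OF \<mu>y gx Gx] and e4
      = geometrically_bounded_energy_multiple[OF \<mu>x gy Gy]
    and e5 = geometrically_bounded_energy_multiple[OF \<mu>yx g G]
  have Gyx: "geometrically_bounded (\<lambda>n. energy (partial_y (partial_x (g n))))"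
    by (rule contr[where u = "\<lambda>n. partial_y (partial_x (g n))", OF gyx Syx])
       (intro geometrically_bounded_energy_add borel_measurable_add e3 e4 e5)+
  show "geometrically_bounded (\<lambda>n. energy (neumann \<mu> \<nu> n))"
    "geometrically_bounded (\<lambda>n. energy (partial_x (neumann \<mu> \<nu> n)))"
    "geometrically_bounded (\<lambda>n. energy (partial_y (neumann \<mu> \<nu> n)))"
    "geometrically_bounded (\<lambda>n. energy (partial_y (partial_x (neumann \<mu> \<nu> n))))"
    using G Gx Gy Gyx by (auto simp: g_def)
qed

text \<open>The Sobolev inequality applies to the Beurling transforms too: the derivatives of \<open>S g\<close> are the Beurling
transforms of the derivatives of \<open>g\<close>, whose energies are no larger.\<close>

lemma neumann_sup_geometric:
  obtains B r where "0 \<le> B" "0 < r" "r < 1" "\<And>n z. cmod (neumann \<mu> \<nu> n z) \<le> B * r ^ n"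
    "\<And>n z. cmod (beurling (neumann \<mu> \<nu> n) z) \<le> B * r ^ n"
proof -
  define g where "g = neumann \<mu> \<nu>"
  have g: "C_infinity (g n)" "supported R (g n)" for n by
      (auto simp: g_def neumann_smooth neumann_supported)
  note gx = C_infinityD(3)[OF g(1)] supported_partial(1)[OF g(2)]
  note gy = C_infinityD(4)[OF g(1)] supported_partial(2)[OF g(2)]
  note gyx = C_infinityD(4)[OF gx(1)] supported_partial(2)[OF gx(2)]
  define u where "u n = 4 * energy (g n) + 2 * energy (partial_y (g n))
      + 2 * energy (partial_x (g n)) + energy (partial_y (partial_x (g n)))" for n
  have u: "geometrically_bounded u"
    unfolding u_def using neumann_energy_geometric
    by (intro geometrically_bounded_add; unfold g_def) (auto intro:
        geometrically_bounded_cmult_le[where C=4] geometrically_bounded_cmult_le[where C=2])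
  have b1: "ennreal ((cmod (g n z))\<^sup>2) \<le> u n" for n z
    unfolding u_def by (rule sobolev_plane[OF g(1)])
  have b2: "ennreal ((cmod (beurling (g n) z))\<^sup>2) \<le> u n" for n z
  proof -
    have "ennreal ((cmod (beurling (g n) z))\<^sup>2) \<le> 4 * energy (beurling (g n))
        + 2 * energy (beurling (partial_y (g n)))
       + 2 * energy (beurling (partial_x (g n))) + energy (beurling (partial_y (partial_x (g n))))"
      using sobolev_plane[OF C_infinity_beurling[OF g]]
      unfolding partial_x_beurling[OF g] partial_y_beurling[OF g] partial_y_beurling[OF gx] .
    also have "\<dots> \<le> u n"
      unfolding u_def by (intro add_mono mult_left_mono energy_beurling_le[OF g]
          energy_beurling_le[OF gx] energy_beurling_le[OF gy] energy_beurling_le[OF gyx]) auto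
    finally show ?thesis .
  qed
  obtain B r where B: "0 \<le> B" "0 < r" "r < 1" "\<And>n z. cmod (g n z) \<le> B * r ^ n"
      using geometrically_bounded_sup_bound[where f = g, OF u b1] by blast
  obtain C s where C: "0 \<le> C" "0 < s" "s < 1" "\<And>n z. cmod (beurling (g n) z) \<le> C * s ^ n"
      using geometrically_bounded_sup_bound[where f = "\<lambda>n. beurling (g n)", OF u b2] by blast
  have le: "B * r ^ n \<le> max B C * max r s ^ n" "C * s ^ n \<le> max B C * max r s ^ n" for n
    using B C by (auto intro!: mult_mono power_mono)
  show ?thesis
    using B(1-3) C(1-3) order_trans[OF B(4) le(1)] order_trans[OF C(4) le(2)]
    by (intro that[of "max B C" "max r s"]) (auto simp: g_def)
qed

text \<open>Put \<open>\<sigma> = \<Sum> C g\<^sub>n\<close>. The derivatives of the summands are \<open>S g\<^sub>n\<close> and \<open>g\<^sub>n\<close>, both uniformly summable, so the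
series may be differentiated term by term; the equation is the recursion for \<open>g\<^sub>n\<close> summed over \<open>n\<close>. The decay at
infinity is that of the Cauchy transform, uniformly in \<open>n\<close>.\<close>

lemma inhomogeneous_beltrami_solution:
  obtains \<sigma> where "\<And>z. \<sigma> differentiable (at z)"
    "continuous_on UNIV (partial_z \<sigma>)" "continuous_on UNIV (partial_zbar \<sigma>)"
    "\<And>z. partial_zbar \<sigma> z = \<mu> z * partial_z \<sigma> z + \<nu> z" "(\<sigma> \<longlongrightarrow> 0) at_infinity"
proof -
  define g where "g = neumann \<mu> \<nu>"
  have g: "C_infinity (g n)" "supported R (g n)" for n by
      (auto simp: g_def neumann_smooth neumann_supported)
  obtain B r where B: "0 \<le> B" "0 < r" "r < 1" "\<And>n z. cmod (g n z) \<le> B * r ^ n"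
    "\<And>n z. cmod (beurling (g n) z) \<le> B * r ^ n" using neumann_sup_geometric unfolding g_def by blast
  have sB: "summable (\<lambda>n. B * r ^ n)" using B by (intro summable_mult summable_geometric) auto
  define a where "a z = (\<Sum>n. beurling (g n) z)" for z
  define b where "b z = (\<Sum>n. g n z)" for z
  have ua: "uniform_limit UNIV (\<lambda>n z. \<Sum>i<n. beurling (g i) z) a sequentially"
    unfolding a_def by (rule Weierstrass_m_test[OF B(5) sB])
  have ub: "uniform_limit UNIV (\<lambda>n z. \<Sum>i<n. g i z) b sequentially"
    unfolding b_def by (rule Weierstrass_m_test[OF B(4) sB])
  have ca: "continuous_on UNIV a"
    by (rule uniform_limit_theorem[OF _ ua])
       (auto intro!: eventuallyI continuous_on_sum C_infinityD(2)[OF C_infinity_beurling[OF g]])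
  have cb: "continuous_on UNIV b"
    by (rule uniform_limit_theorem[OF _ ub]) (auto intro!: eventuallyI continuous_on_sum
        C_infinityD(2)[OF g(1)])
  have bound: "cmod (cauchy_transform (g n) z) \<le> B * r ^ n * (inverse_norm_mass (cmod z
      + R) / kernel_mass)" for n z
    by (rule cauchy_transform_bound[OF C_infinityD(2)[OF g(1)] g(2) B(4)])
  have s0: "summable (\<lambda>n. cauchy_transform (g n) z)" for z
    by (rule summable_comparison_test'[OF summable_mult2[OF sB] bound])
  have "\<exists>\<sigma>. \<forall>z\<in>UNIV. (\<lambda>n. cauchy_transform (g n) z) sums \<sigma> z \<and> (\<sigma> has_derivative (\<lambda>v. a z * v
      + b z * cnj v)) (at z within UNIV)"
  proof (rule has_derivative_series)
    show "(cauchy_transform (g n) has_derivative (\<lambda>v. beurling (g n) z * v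
        + g n z * cnj v)) (at z within UNIV)" for n z
      using has_derivative_z_zbar[OF partial_cauchy_transform(1)[OF g, of n z]]
      unfolding partial_zbar_cauchy_transform[OF g] beurling_def by simp
    show "(\<lambda>n. cauchy_transform (g n) 0) sums (\<Sum>n. cauchy_transform (g n) 0)"
      by (rule summable_sums[OF s0])
    fix e :: real assume e: "e > 0"
    then have e2: "e / 2 > 0" by simp
    from uniform_limitD[OF ua e2] uniform_limitD[OF ub e2]
    show "\<forall>\<^sub>F n in sequentially. \<forall>z\<in>UNIV. \<forall>v. norm ((\<Sum>i<n. beurling (g i) z * v
        + g i z * cnj v) - (a z * v + b z * cnj v)) \<le> e * norm v"
    proof eventually_elim
      case (elim n)
      show ?case
      proof (intro ballI allI)
        fix z v :: complex
        have "(\<Sum>i<n. beurling (g i) z * v + g i z * cnj v) - (a z * v + b z * cnj v) =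
           ((\<Sum>i<n. beurling (g i) z) - a z) * v + ((\<Sum>i<n. g i z) - b z) * cnj v"
          by (simp add: sum.distrib sum_distrib_right[symmetric] ring_distribs)
        also have "cmod \<dots> \<le> cmod ((\<Sum>i<n. beurling (g i) z) - a z) * cmod v
            + cmod ((\<Sum>i<n. g i z) - b z) * cmod v"
          by (rule order_trans[OF norm_triangle_ineq]) (simp add: norm_mult)
        also have "\<dots> \<le> e / 2 * cmod v + e / 2 * cmod v"
          using elim by (intro add_mono mult_right_mono) (auto simp: dist_norm less_imp_le)
        finally show "norm ((\<Sum>i<n. beurling (g i) z * v + g i z * cnj v) - (a z * v + b z * cnj v))
            \<le> e * norm v" by simp
      qed
    qed
  qed auto
  then obtain \<sigma> where \<sigma>: "\<And>z. (\<lambda>n. cauchy_transform (g n) z) sums \<sigma> z"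
      "\<And>z. (\<sigma> has_derivative (\<lambda>v. a z * v + b z * cnj v)) (at z)"
    by auto
  note p = partials_of_has_derivative_z_zbar[OF \<sigma>(2)]
  define R0 where "R0 = max R 1"
  have R0: "R0 > 0" "supported R0 (g n)" for n using g(2)[of n] by (auto simp: R0_def supported_def)
  define D where "D = 2 * (unit_ball_vol 2 * R0\<^sup>2) / kernel_mass"
  have decay: "cmod (\<sigma> z) \<le> (\<Sum>n. B * r ^ n) * D / cmod z" if z: "2 * R0 \<le> cmod z" for z
  proof -
    have le: "cmod (cauchy_transform (g n) z) \<le> B * r ^ n * (D / cmod z)" for n
      using cauchy_transform_decay[OF C_infinityD(2)[OF g(1)] R0(2) B(4) R0(1) z] by
          (simp add: D_def)
    have "cmod (\<Sum>n. cauchy_transform (g n) z) \<le> (\<Sum>n. B * r ^ n * (D / cmod z))"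
      by (rule norm_suminf_le[OF le summable_mult2[OF sB]])
    also have "\<dots> = (\<Sum>n. B * r ^ n) * (D / cmod z)" by (rule suminf_mult2[OF sB, symmetric])
    finally show ?thesis using sums_unique[OF \<sigma>(1)] by simp
  qed
  have "(\<sigma> \<longlongrightarrow> 0) at_infinity"
  proof (rule Lim_null_comparison)
    show "\<forall>\<^sub>F z in at_infinity. cmod (\<sigma> z) \<le> (\<Sum>n. B * r ^ n) * D / cmod z"
      unfolding eventually_at_infinity using decay by blast
    show "((\<lambda>z::complex. (\<Sum>n. B * r ^ n) * D / cmod z) \<longlongrightarrow> 0) at_infinity"
      by (intro tendsto_divide_0[OF tendsto_const] filterlim_at_top_imp_at_infinity
          filterlim_norm_at_top)
  qed
  moreover have "b z = \<mu> z * a z + \<nu> z" for z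
  proof -
    have sa: "summable (\<lambda>n. beurling (g n) z)" and sb: "summable (\<lambda>n. g n z)"
      by (rule summable_comparison_test'[OF sB B(5)], rule summable_comparison_test'[OF sB B(4)])
    have "b z = g 0 z + (\<Sum>n. g (Suc n) z)"
      unfolding b_def using suminf_split_head[OF sb] by simp
    also have "(\<Sum>n. g (Suc n) z) = (\<Sum>n. \<mu> z * beurling (g n) z)" by (simp add: g_def)
    also have "\<dots> = \<mu> z * a z" unfolding a_def by (rule suminf_mult[OF sa])
    finally show ?thesis by (simp add: g_def)
  qed
  moreover have "partial_z \<sigma> = a" "partial_zbar \<sigma> = b" using p by auto
  ultimately show ?thesis using \<sigma>(2) ca cb
    by (intro that[of \<sigma>]) (auto simp: differentiable_def)
qed

end

section \<open>Primitives of closed forms\<close>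

text \<open>The real-linear map with Wirtinger coefficients \<open>a\<close> and \<open>b\<close> as a bounded operator, so that differentials
can depend continuously on the base point in the operator norm.\<close>

definition wirtinger_map :: "complex \<Rightarrow> complex \<Rightarrow> complex \<Rightarrow>\<^sub>L complex" where
  "wirtinger_map a b = blinfun_mult_right a + (blinfun_mult_right b o\<^sub>L Blinfun cnj)"

lemma wirtinger_map_apply [simp]: "blinfun_apply (wirtinger_map a b) v = a * v + b * cnj v"
  by (simp add: wirtinger_map_def blinfun.add_left bounded_linear_Blinfun_apply bounded_linear_cnj)

lemma continuous_on_wirtinger_map [continuous_intros]:
  assumes "continuous_on S a" "continuous_on S b"
  shows "continuous_on S (\<lambda>x. wirtinger_map (a x) (b x))"
  unfolding wirtinger_map_def
  by (intro continuous_intros bounded_linear.continuous_on[OF bounded_linear_blinfun_mult_right]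
      bounded_bilinear.continuous_on[OF bounded_bilinear_blinfun_compose] assms)

text \<open>Poincare's lemma for \<open>A dz + B dz'\<close>; closedness is the equation \<open>\<partial>\<^sub>z\<^sub>' A = \<partial>\<^sub>z B\<close>, expressed by the common
coefficient \<open>A2\<close>. The primitive integrates the form along the ray from 0 to \<open>z\<close>. Closedness turns the
derivative of the integrand in direction \<open>v\<close> into the derivative in \<open>t\<close> of \<open>t (A (t z) v + B (t z) v')\<close>,
which integrates to the value of the form at \<open>z\<close>.\<close>

lemma closed_form_has_primitive:
  assumes A: "\<And>z. (A has_derivative (\<lambda>v. A1 z * v + A2 z * cnj v)) (at z)"
    and B: "\<And>z. (B has_derivative (\<lambda>v. A2 z * v + B2 z * cnj v)) (at z)"
    and c: "continuous_on UNIV A1" "continuous_on UNIV A2" "continuous_on UNIV B2"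
  obtains \<Phi> where "\<And>z. (\<Phi> has_derivative (\<lambda>v. A z * v + B z * cnj v)) (at z)"
proof
  define F where "F z t = A (t *\<^sub>R z) * z + B (t *\<^sub>R z) * cnj z" for z :: complex and t :: real
  define a where "a z t = A (t *\<^sub>R z) + t *\<^sub>R (A1 (t *\<^sub>R z) * z
      + A2 (t *\<^sub>R z) * cnj z)" for z :: complex and t :: real
  define b where "b z t = B (t *\<^sub>R z) + t *\<^sub>R (A2 (t *\<^sub>R z) * z
      + B2 (t *\<^sub>R z) * cnj z)" for z :: complex and t :: real
  have cA: "continuous_on UNIV A" and cB: "continuous_on UNIV B"
    using has_derivative_continuous[OF A] has_derivative_continuous[OF B]
    by (auto intro!: continuous_at_imp_continuous_on)
  note cc = continuous_on_compose2[OF c(1)] continuous_on_compose2[OF c(2)]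
      continuous_on_compose2[OF c(3)]
    continuous_on_compose2[OF cA] continuous_on_compose2[OF cB]
  fix z :: complex
  have "((\<lambda>z. integral (cbox 0 1) (F z)) has_derivative blinfun_apply (integral (cbox 0 1) (\<lambda>t.
      wirtinger_map (a z t) (b z t)))) (at z within UNIV)"
  proof (rule leibniz_rule)
    fix z :: complex and t :: real
    have sc: "((\<lambda>z. t *\<^sub>R z) has_derivative (\<lambda>v. t *\<^sub>R v)) (at z)" by
        (auto intro!: derivative_eq_intros)
    show "((\<lambda>z. F z t) has_derivative blinfun_apply (wirtinger_map (a z t) (b z t))) (at z within
        UNIV)"
      unfolding F_def
      by (rule derivative_eq_intros has_derivative_compose[OF sc A] has_derivative_compose[OF sc B]
          refl)+
         (auto simp: fun_eq_iff a_def b_def scaleR_conv_of_real algebra_simps)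
    show "F z integrable_on cbox 0 1"
      unfolding F_def by (rule integrable_continuous) (auto intro!: cc continuous_intros)
  next
    show "continuous_on (UNIV \<times> cbox 0 1) (\<lambda>(z, t). wirtinger_map (a z t) (b z t))"
      unfolding a_def b_def split_beta by (auto intro!: cc continuous_intros)
  qed auto
  moreover have "blinfun_apply (integral (cbox 0 1) (\<lambda>t. wirtinger_map (a z t) (b z t)))
      = (\<lambda>v. A z * v + B z * cnj v)"
  proof
    fix v
    have int: "(\<lambda>t. wirtinger_map (a z t) (b z t)) integrable_on cbox 0 1"
      unfolding a_def b_def by (rule integrable_continuous) (auto intro!: cc continuous_intros)
    have der: "((\<lambda>t. t *\<^sub>R (A (t *\<^sub>R z) * v + B (t *\<^sub>R z) * cnj v)) has_vector_derivative (a z t * v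
        + b z t * cnj v)) (at t within S)" for t S
    proof -
      have sc: "((\<lambda>t. t *\<^sub>R z) has_derivative (\<lambda>s. s *\<^sub>R z)) (at t)" by
          (auto intro!: derivative_eq_intros)
      have "((\<lambda>t. t *\<^sub>R (A (t *\<^sub>R z) * v + B (t *\<^sub>R z) * cnj v)) has_derivative (\<lambda>s. s *\<^sub>R (a z t *
          v + b z t * cnj v))) (at t)"
        by (rule derivative_eq_intros has_derivative_compose[OF sc A] has_derivative_compose[OF sc
            B] refl)+
           (auto simp: fun_eq_iff a_def b_def scaleR_conv_of_real algebra_simps)
      then show ?thesis using has_derivative_at_withinI has_vector_derivative_def by blast
    qed
    have "blinfun_apply (integral (cbox 0 1) (\<lambda>t. wirtinger_map (a z t) (b z t))) v
        = integral (cbox 0 1) (\<lambda>t. a z t * v + b z t * cnj v)"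
      using blinfun_apply_integral[OF int, of v] by simp
    also have "\<dots> = 1 *\<^sub>R (A (1 *\<^sub>R z) * v + B (1 *\<^sub>R z) * cnj v) - 0 *\<^sub>R (A (0 *\<^sub>R z) * v
        + B (0 *\<^sub>R z) * cnj v)"
      unfolding cbox_interval by (intro integral_unique fundamental_theorem_of_calculus der) auto
    finally show "blinfun_apply (integral (cbox 0 1) (\<lambda>t. wirtinger_map (a z t) (b z t))) v
        = A z * v + B z * cnj v" by simp
  qed
  ultimately show "((\<lambda>z. integral (cbox 0 1) (F z)) has_derivative (\<lambda>v. A z * v
      + B z * cnj v)) (at z)" by simp
qed

section \<open>Maps with positive Jacobian that are close to the identity at infinity\<close>

text \<open>The determinant of \<open>v \<mapsto> a v + b v'\<close> is \<open>|a|\<^sup>2 - |b|\<^sup>2\<close>.\<close>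

lemma wirtinger_map_left_inverse:
  assumes "cmod b < cmod a"
  obtains T where "T o\<^sub>L wirtinger_map a b = id_blinfun"
proof
  define D where "D = a * cnj a - b * cnj b"
  have "D = of_real ((cmod a)\<^sup>2 - (cmod b)\<^sup>2)"
    unfolding D_def of_real_diff complex_norm_square ..
  moreover have "(cmod b)\<^sup>2 < (cmod a)\<^sup>2" using assms by (simp add: power_strict_mono)
  ultimately have D: "D \<noteq> 0" "cnj D = D" by (auto simp del: of_real_diff)
  show "wirtinger_map (cnj a / D) (- b / D) o\<^sub>L wirtinger_map a b = id_blinfun"
  proof (rule blinfun_eqI)
    fix v
    have "cnj a / D * (a * v + b * cnj v) + - b / D * cnj (a * v + b * cnj v) = (D * v) / D"
      by (simp add: D_def diff_divide_distrib add_divide_distrib algebra_simps)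
    then show "blinfun_apply (wirtinger_map (cnj a / D) (- b / D) o\<^sub>L wirtinger_map a b) v
        = blinfun_apply id_blinfun v"
      using D by simp
  qed
qed

context
  fixes \<Phi> A B :: "complex \<Rightarrow> complex"
  assumes der: "\<And>z. (\<Phi> has_derivative (\<lambda>v. A z * v + B z * cnj v)) (at z)"
    and cA: "continuous_on UNIV A" and cB: "continuous_on UNIV B"
    and jac: "\<And>z. cmod (B z) < cmod (A z)"
    and A_lim: "(A \<longlongrightarrow> 1) at_infinity" and B_lim: "(B \<longlongrightarrow> 0) at_infinity"
begin

lemma plane_map_continuous: "continuous_on S \<Phi>"
  using der by (meson continuous_at_imp_continuous_on has_derivative_continuous)

lemma locally_injective_open:
  obtains U where "open U" "z \<in> U" "inj_on \<Phi> U" "\<And>W. open W \<Longrightarrow> W \<subseteq> U \<Longrightarrow> open (\<Phi> ` W)"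
proof -
  obtain T where T: "T o\<^sub>L wirtinger_map (A z) (B z) = id_blinfun"
      using wirtinger_map_left_inverse[OF jac] by blast
  have c: "continuous_on UNIV (\<lambda>z. wirtinger_map (A z) (B z))" by (intro continuous_intros cA cB)
  have d: "(\<Phi> has_derivative blinfun_apply (wirtinger_map (A z) (B z))) (at z)" for z
    by (rule has_derivative_eq_rhs[OF der]) auto
  obtain U V g where UV: "open U" "z \<in> U" "open V" "homeomorphism U V \<Phi> g"
    using inverse_function_theorem[OF open_UNIV d c UNIV_I T] by metis
  show ?thesis
  proof (rule that[of U])
    show "inj_on \<Phi> U" using UV(4) by (metis homeomorphism_apply1 inj_onI)
    show "open (\<Phi> ` W)" if "open W" "W \<subseteq> U" for W
    proof -
      have "openin (top_of_set U) W" using that by (simp add: UV(1) openin_open_eq)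
      then have "openin (top_of_set V) (\<Phi> ` W)" using UV(4) homeomorphism_imp_open_map by blast
      then show ?thesis using UV(3) openin_open_trans by blast
    qed
  qed (use UV in auto)
qed

lemma plane_map_open_map:
  assumes "open W" shows "open (\<Phi> ` W)"
proof (subst open_subopen, safe)
  fix z assume z: "z \<in> W"
  obtain U where U: "open U" "z \<in> U" "\<And>W. open W \<Longrightarrow> W \<subseteq> U \<Longrightarrow> open (\<Phi> ` W)"
    using locally_injective_open[of z] by metis
  show "\<exists>T. open T \<and> \<Phi> z \<in> T \<and> T \<subseteq> \<Phi> ` W"
    using U z assms by (intro exI[of _ "\<Phi> ` (U \<inter> W)"]) auto
qed

text \<open>The differential of \<open>\<Phi> - id\<close> has norm at most 1/4 far out, so \<open>\<Phi> - id\<close> is a contraction on every convex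
set that stays there; the mean value inequality needs the segment between the two points.\<close>

lemma near_identity_at_infinity:
  obtains R where "R > 0"
    "\<And>S z w. convex S \<Longrightarrow> z \<in> S \<Longrightarrow> w \<in> S \<Longrightarrow> (\<And>q. q \<in> S \<Longrightarrow> R \<le> cmod q) \<Longrightarrow> cmod ((\<Phi> z - z) - (\<Phi> w - w))
        \<le> cmod (z - w) / 4"
proof -
  have "\<forall>\<^sub>F z in at_infinity. dist (A z) 1 < 1/8" "\<forall>\<^sub>F z in at_infinity. dist (B z) 0 < 1/8"
    using tendstoD[OF A_lim, of "1/8"] tendstoD[OF B_lim, of "1/8"] by auto
  then have "\<forall>\<^sub>F z in at_infinity. cmod (A z - 1) + cmod (B z) \<le> 1/4"
    by eventually_elim (auto simp: dist_norm)
  then obtain R0 where R0: "\<And>z. R0 \<le> cmod z \<Longrightarrow> cmod (A z - 1) + cmod (B z) \<le> 1/4"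
    unfolding eventually_at_infinity by auto
  show ?thesis
  proof (rule that[of "max R0 1"])
    fix S z w assume S: "convex S" "z \<in> S" "w \<in> S" "\<And>q. q \<in> S \<Longrightarrow> max R0 1 \<le> cmod q"
    have "cmod ((\<Phi> z - z) - (\<Phi> w - w)) \<le> 1/4 * cmod (z - w)"
    proof (rule differentiable_bound[OF S(1) _ _ S(2,3), where f'="\<lambda>q v. (A q * v
        + B q * cnj v) - v"])
      fix q assume q: "q \<in> S"
      show "((\<lambda>z. \<Phi> z - z) has_derivative (\<lambda>v. (A q * v + B q * cnj v) - v)) (at q within S)"
        by (intro has_derivative_diff has_derivative_at_withinI[OF der] has_derivative_ident)
      show "onorm (\<lambda>v. (A q * v + B q * cnj v) - v) \<le> 1/4"
      proof (rule onorm_le)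
        fix v
        have "cmod ((A q * v + B q * cnj v) - v) = cmod ((A q - 1) * v + B q * cnj v)" by
            (simp add: algebra_simps)
        also have "\<dots> \<le> (cmod (A q - 1) + cmod (B q)) * cmod v"
          by (rule order_trans[OF norm_triangle_ineq]) (simp add: norm_mult distrib_right)
        also have "\<dots> \<le> 1/4 * cmod v" using R0[of q] S(4)[OF q] by (intro mult_right_mono) auto
        finally show "cmod ((A q * v + B q * cnj v) - v) \<le> 1/4 * cmod v" .
      qed
    qed
    then show "cmod ((\<Phi> z - z) - (\<Phi> w - w)) \<le> cmod (z - w) / 4" by simp
  qed auto
qed

text \<open>Outside the disc of radius \<open>R\<close> compare \<open>z\<close> with its radial projection to the circle: the segment between
them stays outside the disc.\<close>

lemma plane_map_growth:
  obtains C where "C \<ge> 0" "\<And>z. cmod (\<Phi> z - z) \<le> cmod z / 4 + C"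
proof -
  obtain R where R: "R > 0"
    "\<And>S z w. convex S \<Longrightarrow> z \<in> S \<Longrightarrow> w \<in> S \<Longrightarrow> (\<And>q. q \<in> S \<Longrightarrow> R \<le> cmod q) \<Longrightarrow> cmod ((\<Phi> z - z) - (\<Phi> w - w))
        \<le> cmod (z - w) / 4"
    using near_identity_at_infinity by blast
  have "compact ((\<lambda>z. \<Phi> z - z) ` cball 0 R)"
    by (intro compact_continuous_image compact_cball continuous_intros plane_map_continuous)
  then have "bounded ((\<lambda>z. \<Phi> z - z) ` cball 0 R)" by (rule compact_imp_bounded)
  then obtain C where "\<forall>x\<in>(\<lambda>z. \<Phi> z - z) ` cball 0 R. cmod x \<le> C" unfolding bounded_iff by metis
  then have C: "\<And>z. z \<in> cball 0 R \<Longrightarrow> cmod (\<Phi> z - z) \<le> C" by blast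
  have C0: "C \<ge> 0" using order_trans[OF norm_ge_zero C[of 0]] R(1) by simp
  have "cmod (\<Phi> z - z) \<le> cmod z / 4 + C" for z
  proof (cases "cmod z \<le> R")
    case True
    then show ?thesis using C[of z] by (simp add: add_increasing)
  next
    case False
    define p where "p = (R / cmod z) *\<^sub>R z"
    have z0: "cmod z > 0" using False R(1) by linarith
    have p: "cmod p = R" using z0 R(1) by (simp add: p_def)
    have zp: "z - p = (1 - R / cmod z) *\<^sub>R z" by (simp add: p_def algebra_simps)
    have frac: "0 \<le> R / cmod z" "R / cmod z \<le> 1" using False R(1) z0 by (auto simp: divide_le_eq)
    have seg: "R \<le> cmod q" if "q \<in> closed_segment p z" for q
    proof -
      have "\<exists>u\<ge>0. u \<le> 1 \<and> q = (1 - u) *\<^sub>R p + u *\<^sub>R z" using that by (simp only: in_segment)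
      then obtain u where u: "0 \<le> u" "u \<le> 1" "q = (1 - u) *\<^sub>R p + u *\<^sub>R z" by metis
      define a where "a = (1 - u) * (R / cmod z) + u"
      have "a - R / cmod z = u * (1 - R / cmod z)" by (simp add: a_def diff_divide_distrib
          left_diff_distrib right_diff_distrib)
      also have "\<dots> \<ge> 0" using u frac by (intro mult_nonneg_nonneg) auto
      finally have a: "R / cmod z \<le> a" by simp
      have "q = a *\<^sub>R z" by (simp add: u p_def a_def algebra_simps)
      then have "cmod q = a * cmod z" using a frac by simp
      moreover have "R / cmod z * cmod z \<le> a * cmod z" using a by (intro mult_right_mono) auto
      ultimately show ?thesis using z0 by simp
    qed
    have "cmod ((\<Phi> z - z) - (\<Phi> p - p)) \<le> cmod (z - p) / 4"
      by (rule R(2)[of "closed_segment p z"]) (use seg in auto)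
    moreover have "cmod (z - p) \<le> cmod z" unfolding zp using frac by (simp add: mult_left_le_one_le)
    moreover have "cmod (\<Phi> p - p) \<le> C" using C[of p] p by simp
    moreover have "cmod (\<Phi> z - z) \<le> cmod (\<Phi> p - p) + cmod ((\<Phi> z - z) - (\<Phi> p - p))"
        by (rule norm_triangle_sub)
    ultimately show ?thesis by linarith
  qed
  with C0 that show ?thesis by blast
qed

lemma plane_map_preimage_bound:
  obtains C where "\<And>z. cmod z \<le> 2 * cmod (\<Phi> z) + C"
proof -
  obtain C where C: "\<And>z. cmod (\<Phi> z - z) \<le> cmod z / 4 + C" using plane_map_growth by blast
  have "cmod z \<le> 2 * cmod (\<Phi> z) + 2 * \<bar>C\<bar>" for z
  proof -
    have "cmod z \<le> cmod (\<Phi> z) + cmod (\<Phi> z - z)"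
      using norm_triangle_sub[of z "\<Phi> z"] by (simp add: norm_minus_commute)
    then show ?thesis using C[of z] norm_ge_zero[of "\<Phi> z"] by linarith
  qed
  with that show ?thesis by blast
qed

text \<open>Properness of \<open>\<Phi>\<close>, in the sequential form in which it is used.\<close>

lemma plane_map_preimage_convergent_subsequence:
  assumes "(\<lambda>n. \<Phi> (x n)) \<longlonglongrightarrow> w"
  obtains l r where "strict_mono (r :: nat \<Rightarrow> nat)" "(x \<circ> r) \<longlonglongrightarrow> l" "\<Phi> l = w"
proof -
  obtain C where C: "\<And>z. cmod z \<le> 2 * cmod (\<Phi> z) + C" using plane_map_preimage_bound by blast
  have "bounded (range (\<lambda>n. \<Phi> (x n)))" using assms convergent_imp_bounded by blast
  then obtain M where M: "\<And>n. cmod (\<Phi> (x n)) \<le> M" unfolding bounded_iff by auto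
  have "cmod (x n) \<le> 2 * M + C" for n using C[of "x n"] M[of n] by linarith
  then have "bounded (range x)" unfolding bounded_iff by auto
  then obtain l r where l: "strict_mono r" "(x \<circ> r) \<longlonglongrightarrow> l"
    using bounded_imp_convergent_subsequence by blast
  have "isCont \<Phi> l" using der has_derivative_continuous by blast
  then have "(\<lambda>n. \<Phi> ((x \<circ> r) n)) \<longlonglongrightarrow> \<Phi> l" using l(2) by (rule isCont_tendsto_compose)
  moreover have "(\<lambda>n. \<Phi> ((x \<circ> r) n)) \<longlonglongrightarrow> w" using LIMSEQ_subseq_LIMSEQ[OF assms l(1)] by
      (simp add: o_def)
  ultimately have "\<Phi> l = w" by (rule LIMSEQ_unique)
  with l that show ?thesis by blast
qed

lemma plane_map_surj: "range \<Phi> = UNIV"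
proof -
  have "closed (range \<Phi>)"
    unfolding closed_sequential_limits
  proof (intro allI impI, elim conjE)
    fix y l assume y: "\<forall>n. y n \<in> range \<Phi>" "y \<longlonglongrightarrow> l"
    then have "\<forall>n. \<exists>x. y n = \<Phi> x" by auto
    then obtain x where "\<And>n. y n = \<Phi> (x n)" by metis
    then have "(\<lambda>n. \<Phi> (x n)) \<longlonglongrightarrow> l" using y(2) by presburger
    then show "l \<in> range \<Phi>" using plane_map_preimage_convergent_subsequence by (metis rangeI)
  qed
  then show ?thesis using plane_map_open_map[OF open_UNIV] clopen[of "range \<Phi>"] by auto
qed

text \<open>The set \<open>T\<close> of points with at most one preimage is closed, since two distinct preimages persist nearby
by openness of \<open>\<Phi>\<close>. It is open, since by properness pairs of distinct preimages of points converging to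
\<open>w\<close> accumulate at preimages of \<open>w\<close>, and local injectivity keeps their limits apart. It is not empty,
because the preimages of a large real number lie in a half plane on which \<open>\<Phi> - id\<close> is a contraction.\<close>

lemma plane_map_inj: "inj \<Phi>"
proof -
  define T where "T = {w. \<forall>z1 z2. \<Phi> z1 = w \<longrightarrow> \<Phi> z2 = w \<longrightarrow> z1 = z2}"
  have "open (- T)"
  proof (subst open_subopen, safe)
    fix w assume "w \<notin> T"
    then obtain z1 z2 where z: "\<Phi> z1 = w" "\<Phi> z2 = w" "z1 \<noteq> z2" by (auto simp: T_def)
    obtain U1 U2 where U: "open U1" "open U2" "z1 \<in> U1" "z2 \<in> U2" "U1 \<inter> U2 = {}"
      using hausdorff[OF z(3)] by blast
    have "w' \<notin> T" if w': "w' \<in> \<Phi> ` U1 \<inter> \<Phi> ` U2" for w'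
    proof -
      obtain p q where "p \<in> U1" "q \<in> U2" "\<Phi> p = w'" "\<Phi> q = w'" using w' by auto
      moreover from this have "p \<noteq> q" using U(5) by auto
      ultimately show ?thesis by (auto simp: T_def)
    qed
    moreover have "w \<in> \<Phi> ` U1 \<inter> \<Phi> ` U2" using U(3,4) z(1,2) by (metis IntI imageI)
    moreover have "open (\<Phi> ` U1 \<inter> \<Phi> ` U2)" by (intro open_Int plane_map_open_map U)
    ultimately show "\<exists>V. open V \<and> w \<in> V \<and> V \<subseteq> - T"
      by (intro exI[of _ "\<Phi> ` U1 \<inter> \<Phi> ` U2"]) blast
  qed
  then have "closed T" by (simp add: closed_def)
  moreover have "closed (- T)"
    unfolding closed_sequential_limits
  proof (intro allI impI, elim conjE)
    fix y w assume y: "\<forall>n. y n \<in> - T" "y \<longlonglongrightarrow> w"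
    then have "\<forall>n. \<exists>p. \<Phi> (fst p) = y n \<and> \<Phi> (snd p) = y n \<and> fst p \<noteq> snd p" by (auto simp: T_def)
    then obtain p where p: "\<And>n. \<Phi> (fst (p n)) = y n" "\<And>n. \<Phi> (snd (p n)) = y n"
        "\<And>n. fst (p n) \<noteq> snd (p n)"
      by metis
    have "(\<lambda>n. \<Phi> ((fst \<circ> p) n)) \<longlonglongrightarrow> w" using y(2) p(1) by (simp add: o_def)
    then obtain l1 r1 where l1: "strict_mono r1" "((fst \<circ> p) \<circ> r1) \<longlonglongrightarrow> l1" "\<Phi> l1 = w"
      using plane_map_preimage_convergent_subsequence by blast
    have "(\<lambda>n. \<Phi> ((snd \<circ> p \<circ> r1) n)) \<longlonglongrightarrow> w"
      using LIMSEQ_subseq_LIMSEQ[OF y(2) l1(1)] p(2) by (simp add: o_def)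
    then obtain l2 r2 where l2: "strict_mono r2" "((snd \<circ> p \<circ> r1) \<circ> r2) \<longlonglongrightarrow> l2" "\<Phi> l2 = w"
      using plane_map_preimage_convergent_subsequence by blast
    define r where "r = r1 \<circ> r2"
    have lim1: "(\<lambda>n. fst (p (r n))) \<longlonglongrightarrow> l1"
      using LIMSEQ_subseq_LIMSEQ[OF l1(2) l2(1)] by (simp add: o_def r_def)
    have lim2: "(\<lambda>n. snd (p (r n))) \<longlonglongrightarrow> l2"
      using l2(2) by (simp add: o_def r_def)
    have "l1 \<noteq> l2"
    proof
      assume eq: "l1 = l2"
      obtain U where U: "open U" "l1 \<in> U" "inj_on \<Phi> U" using locally_injective_open[of l1] by metis
      have "\<forall>\<^sub>F n in sequentially. fst (p (r n)) \<in> U" "\<forall>\<^sub>F n in sequentially. snd (p (r n)) \<in> U"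
        using topological_tendstoD[OF lim1 U(1,2)] topological_tendstoD[OF lim2 U(1)] U(2) eq
            by auto
      then have "\<forall>\<^sub>F n in sequentially. False"
        by eventually_elim (use U(3) p in \<open>metis inj_onD\<close>)
      then show False by simp
    qed
    then show "w \<in> - T" using l1(3) l2(3) by (auto simp: T_def)
  qed
  ultimately have "T = {} \<or> T = UNIV" using clopen[of T] by (auto simp: closed_def)
  moreover have "T \<noteq> {}"
  proof -
    obtain R where R: "R > 0"
      "\<And>S z w. convex S \<Longrightarrow> z \<in> S \<Longrightarrow> w \<in> S \<Longrightarrow> (\<And>q. q \<in> S \<Longrightarrow> R \<le> cmod q) \<Longrightarrow> cmod ((\<Phi> z - z) - (\<Phi> w - w))
          \<le> cmod (z - w) / 4"
      using near_identity_at_infinity by blast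
    obtain C where C: "C \<ge> 0" "\<And>z. cmod (\<Phi> z - z) \<le> cmod z / 4 + C" using plane_map_growth by blast
    \<comment> \<open>The growth bound puts every preimage of this \<open>x\<close> into the half plane of real part at least \<open>R\<close>.\<close>
    define x where "x = 2 * R + 2 * C"
    define H where "H = {z. R \<le> Re z}"
    have H: "convex H" "\<And>q. q \<in> H \<Longrightarrow> R \<le> cmod q"
      unfolding H_def using convex_halfspace_Re_ge[of R] complex_Re_le_cmod order_trans by
          (auto simp: Collect_mono)
    have pre: "z \<in> H" if "\<Phi> z = of_real x" for z
    proof -
      have "cmod (of_real x - z) \<le> cmod z / 4 + C" using C(2)[of z] that by simp
      moreover have "cmod z \<le> x + cmod (of_real x - z)"
      proof -
        have "x \<ge> 0" using R(1) C(1) by (simp add: x_def)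
        then show ?thesis using norm_triangle_sub[of z "of_real x"] by
            (simp add: norm_minus_commute)
      qed
      moreover have "x - Re z \<le> cmod (of_real x - z)" using complex_Re_le_cmod[of "of_real x - z"]
          by simp
      ultimately show "z \<in> H" using R(1) C(1) by (simp add: H_def x_def)
    qed
    have "z1 = z2" if "\<Phi> z1 = of_real x" "\<Phi> z2 = of_real x" for z1 z2
    proof -
      have "cmod ((\<Phi> z1 - z1) - (\<Phi> z2 - z2)) \<le> cmod (z1 - z2) / 4"
        by (rule R(2)[OF H(1) pre[OF that(1)] pre[OF that(2)] H(2)])
      then have "cmod (z2 - z1) \<le> cmod (z1 - z2) / 4" using that by simp
      then show "z1 = z2" by (simp add: norm_minus_commute)
    qed
    then have "of_real x \<in> T" by (auto simp: T_def)
    then show ?thesis by auto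
  qed
  ultimately have "T = UNIV" by simp
  then show ?thesis by (auto simp: T_def inj_def)
qed

text \<open>As \<open>\<Phi>\<close> is injective, the image of a circle can be expanded to the image of a large concentric circle
without meeting \<open>\<Phi> z\<close>. On a circle of large radius \<open>s\<close> the displacement \<open>\<Phi> - id\<close> varies by less than
\<open>s\<close> from its value at the centre, so the image is homotopic to a round circle about \<open>\<Phi> z\<close>.\<close>

lemma plane_map_orientation_preserving_homeomorphism: "orientation_preserving_homeomorphism \<Phi>"
  unfolding orientation_preserving_homeomorphism_def
proof (intro conjI allI impI)
  show "\<exists>g. homeomorphism UNIV UNIV \<Phi> g"
    using invariance_of_domain_homeomorphism[OF open_UNIV plane_map_continuous _ plane_map_inj]
        plane_map_surj by (metis order_refl)
next
  fix z :: complex and r :: real assume r: "r > 0"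
  obtain C where C: "C \<ge> 0" "\<And>z. cmod (\<Phi> z - z) \<le> cmod z / 4 + C" using plane_map_growth by blast
  define s where "s = 2 * (cmod z + C + cmod (\<Phi> z - z)) + 1"
  have s: "s > 0" using C(1) by (simp add: s_def add_nonneg_pos)
  have "homotopic_loops (- {z}) (circlepath z r) (circlepath z s)"
  proof (rule homotopic_loops_linear)
    fix t :: real
    define c where "c = exp (2 * of_real pi * \<i> * of_real t)"
    have c: "c \<noteq> 0" by (simp add: c_def)
    show "closed_segment (circlepath z r t) (circlepath z s t) \<subseteq> - {z}"
    proof
      fix q assume "q \<in> closed_segment (circlepath z r t) (circlepath z s t)"
      then obtain u where u: "0 \<le> u" "u \<le> 1" "q = (1 - u) *\<^sub>R (circlepath z r t)
          + u *\<^sub>R (circlepath z s t)"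
        by (auto simp: closed_segment_def)
      have "q - z = of_real ((1 - u) * r + u * s) * c"
        by (simp add: u(3) circlepath c_def scaleR_conv_of_real algebra_simps)
      moreover have "(1 - u) * r + u * s > 0"
        using u r s by (cases "u = 0") (auto intro!: add_nonneg_pos)
      then have "complex_of_real ((1 - u) * r + u * s) \<noteq> 0" by (metis of_real_eq_0_iff less_irrefl)
      ultimately have "q - z \<noteq> 0" using c by (simp del: of_real_add)
      then show "q \<in> - {z}" by simp
    qed
  qed auto
  then have "homotopic_loops (- {\<Phi> z}) (\<Phi> \<circ> circlepath z r) (\<Phi> \<circ> circlepath z s)"
    by (rule homotopic_loops_continuous_image[OF _ plane_map_continuous])
        (use plane_map_inj in \<open>auto simp: inj_def\<close>)
  moreover have "homotopic_loops (- {\<Phi> z}) (circlepath (\<Phi> z) s) (\<Phi> \<circ> circlepath z s)"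
  proof (rule homotopic_loops_nearby_explicit)
    show "path (\<Phi> \<circ> circlepath z s)" by (intro path_continuous_image plane_map_continuous) auto
    fix t x assume x: "x \<notin> - {\<Phi> z}"
    define q where "q = circlepath z s t"
    have qz: "cmod (q - z) = s" using s by (simp add: q_def circlepath norm_mult)
    have "circlepath (\<Phi> z) s t = \<Phi> z + (q - z)" by (simp add: q_def circlepath)
    then have e: "(\<Phi> \<circ> circlepath z s) t - circlepath (\<Phi> z) s t = (\<Phi> q - q) - (\<Phi> z - z)"
      "circlepath (\<Phi> z) s t - x = q - z" using x by (auto simp: q_def)
    have "cmod ((\<Phi> q - q) - (\<Phi> z - z)) \<le> cmod (\<Phi> q - q) + cmod (\<Phi> z - z)"
        by (rule norm_triangle_ineq4)
    moreover have "cmod (\<Phi> q - q) \<le> cmod q / 4 + C" by (rule C(2))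
    moreover have "cmod q \<le> cmod z + s" using norm_triangle_sub[of q z] qz by simp
    moreover have "a < s" if "a \<le> b + g" "b \<le> d / 4 + C" "d \<le> w + s" "0 \<le> w" "0 \<le> g" "s = 2 * (w + C
        + g) + 1" for a b d w g :: real
      using that C(1) by argo
    ultimately have "cmod ((\<Phi> q - q) - (\<Phi> z - z)) < s"
      using s_def norm_ge_zero by metis
    then show "cmod ((\<Phi> \<circ> circlepath z s) t - circlepath (\<Phi> z) s t) < cmod (circlepath (\<Phi> z) s t -
        x)"
      unfolding e qz .
  qed (auto simp: pathfinish_compose pathstart_compose)
  ultimately have "winding_number (\<Phi> \<circ> circlepath z r) (\<Phi> z)
      = winding_number (circlepath (\<Phi> z) s) (\<Phi> z)"
    using winding_number_homotopic_loops by metis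
  then show "winding_number (\<Phi> \<circ> circlepath z r) (\<Phi> z) = 1"
    using s by (simp add: winding_number_circlepath_centre)
qed

end

section \<open>The solution of the Beltrami equation\<close>

theorem theorem3p1:
  fixes \<mu> :: "complex \<Rightarrow> complex" and k :: real
  assumes "C_c_infinity \<mu>"
    and "sup_norm \<mu> = k"
    and "k < 1"
  shows "\<exists>\<Phi> :: complex \<Rightarrow> complex.
           orientation_preserving_homeomorphism \<Phi> \<and> C_k 1 \<Phi> \<and>
           (\<forall>z. partial_zbar \<Phi> z = \<mu> z * partial_z \<Phi> z)"
proof -
  have \<mu>: "C_infinity \<mu>" using assms(1) by (simp add: C_c_infinity_def)
  have "bounded (closure {z. \<mu> z \<noteq> 0})" using assms(1) compact_imp_bounded by
      (auto simp: C_c_infinity_def)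
  then obtain R where R: "\<And>z. z \<in> closure {z. \<mu> z \<noteq> 0} \<Longrightarrow> cmod z \<le> R" unfolding bounded_iff by blast
  have \<mu>R: "supported R \<mu>"
    unfolding supported_def
  proof (intro allI impI)
    fix z assume "R < cmod z"
    then have "z \<notin> closure {z. \<mu> z \<noteq> 0}" using R[of z] by auto
    then show "\<mu> z = 0" using closure_subset[of "{z. \<mu> z \<noteq> 0}"] by blast
  qed
  obtain M where M: "\<And>z. cmod (\<mu> z) \<le> M" using supported_bounded[OF C_infinityD(2)[OF \<mu>] \<mu>R]
      by blast
  have k: "cmod (\<mu> z) \<le> k" for z
    unfolding assms(2)[symmetric] sup_norm_def by (rule cSUP_upper) (auto intro: bdd_aboveI2[OF M])
  define \<nu> where "\<nu> = partial_z \<mu>"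
  have \<nu>: "C_infinity \<nu>" "supported R \<nu>"
    unfolding \<nu>_def by (intro C_infinity_partial_z \<mu> supported_partial \<mu>R)+
  obtain \<sigma> where \<sigma>: "\<And>z. \<sigma> differentiable (at z)"
    "continuous_on UNIV (partial_z \<sigma>)" "continuous_on UNIV (partial_zbar \<sigma>)"
    "\<And>z. partial_zbar \<sigma> z = \<mu> z * partial_z \<sigma> z + \<nu> z" "(\<sigma> \<longlongrightarrow> 0) at_infinity"
    using inhomogeneous_beltrami_solution[OF \<mu> \<mu>R \<nu> k assms(3)] by metis
  define A where "A z = exp (\<sigma> z)" for z
  \<comment> \<open>The candidates \<open>A = \<partial>\<^sub>z \<Phi>\<close> and \<open>B = \<partial>\<^sub>z\<^sub>' \<Phi>\<close>; the equation for \<open>\<sigma>\<close> says that \<open>A dz + B dz'\<close> is closed.\<close>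
  define B where "B z = \<mu> z * A z" for z
  have dA: "(A has_derivative (\<lambda>v. (A z * partial_z \<sigma> z) * v
      + (A z * partial_zbar \<sigma> z) * cnj v)) (at z)" for z
  proof -
    have "((\<lambda>z. exp (\<sigma> z)) has_derivative (\<lambda>v. exp (\<sigma> z) * (partial_z \<sigma> z * v
        + partial_zbar \<sigma> z * cnj v))) (at z)"
      by (rule has_derivative_compose[OF has_derivative_z_zbar[OF \<sigma>(1)]])
        (simp add: has_field_derivative_imp_has_derivative[OF DERIV_exp])
    then show ?thesis by (simp add: A_def[abs_def] algebra_simps)
  qed
  have dB: "(B has_derivative (\<lambda>v. (A z * partial_zbar \<sigma> z) * v + (A z * (partial_zbar \<mu> z
      + \<mu> z * partial_zbar \<sigma> z)) * cnj v)) (at z)" for z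
  proof -
    have "(B has_derivative (\<lambda>v. \<mu> z * ((A z * partial_z \<sigma> z) * v
        + (A z * partial_zbar \<sigma> z) * cnj v) +
       (partial_z \<mu> z * v + partial_zbar \<mu> z * cnj v) * A z)) (at z)"
      unfolding B_def by (rule has_derivative_mult[OF has_derivative_z_zbar[OF C_infinityD(1)[OF \<mu>]]
          dA])
    then show ?thesis
      by (rule has_derivative_eq_rhs) (auto simp: fun_eq_iff \<sigma>(4) \<nu>_def algebra_simps)
  qed
  have cA: "continuous_on UNIV A" and cB: "continuous_on UNIV B"
    using dA dB by (meson continuous_at_imp_continuous_on has_derivative_continuous)+
  have c\<mu>: "continuous_on UNIV (partial_zbar \<mu>)"
    unfolding partial_zbar_def by (intro continuous_intros C_infinityD(2) C_infinityD(3,4) \<mu>)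
  obtain \<Phi> where \<Phi>: "\<And>z. (\<Phi> has_derivative (\<lambda>v. A z * v + B z * cnj v)) (at z)"
    by (rule closed_form_has_primitive[OF dA dB])
       (auto intro!: continuous_intros cA \<sigma> c\<mu> C_infinityD(2)[OF \<mu>])
  note p = partials_of_has_derivative_z_zbar[OF \<Phi>]
  have jac: "cmod (B z) < cmod (A z)" for z
  proof -
    have "cmod (\<mu> z) * cmod (A z) < 1 * cmod (A z)"
      using k[of z] assms(3) by (intro mult_strict_right_mono) (auto simp: A_def)
    then show ?thesis by (simp add: B_def norm_mult)
  qed
  have A_lim: "(A \<longlongrightarrow> 1) at_infinity"
    using tendsto_exp[OF \<sigma>(5)] by (simp add: A_def[abs_def])
  have B_lim: "(B \<longlongrightarrow> 0) at_infinity"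
  proof (rule tendsto_eventually)
    show "\<forall>\<^sub>F z in at_infinity. B z = 0"
      unfolding eventually_at_infinity using supportedD[OF \<mu>R] by (auto intro!: exI[of _ "R
          + 1"] simp: B_def)
  qed
  have "C_k 1 \<Phi>"
  proof -
    have "\<Phi> differentiable (at z)" for z using \<Phi> differentiable_def by blast
    moreover have "partial_x \<Phi> = (\<lambda>z. A z + B z)" "partial_y \<Phi> = (\<lambda>z. \<i> * (A z - B z))"
      using p by auto
    ultimately show ?thesis using cA cB by (auto intro!: continuous_intros)
  qed
  moreover have "orientation_preserving_homeomorphism \<Phi>"
    by (rule plane_map_orientation_preserving_homeomorphism[OF \<Phi> cA cB jac A_lim B_lim])
  ultimately show ?thesis using p(3,4) by (intro exI[of _ \<Phi>]) (auto simp: B_def)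
qed

end
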